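(* Let $n\ge 1$, $T>0$, and let $b:\mathbb{R}\to[0,\infty)$ be a continuous $T$-periodic function, not identically zero, whose weak derivative satisfies $b'\in L^\infty$. Let $m_0\in\mathbb{R}$, $m_0\neq 0$, and let $m_1=m_1(t)$ be a real-valued measurable $T$-periodic function with $\sup_{t\ge 0}|m_1(t)|=1$. Then there exists a sufficiently small $\epsilon>0$ (with $m_0^2+\epsilon m_1(t)>0$ for all $t$) such that, with $m_\epsilon^2(t)=m_0^2+\epsilon m_1(t)$, the solution $u=u(t,x)$, $t\ge0$, $x\in\mathbb{R}^n$, to the Cauchy problem $$u_{tt}-\Delta u+2b(t)u_t+m_\epsilon^2(t)u=0,\qquad u(0,x)=u_0(x),\quad u_t(0,x)=u_1(x),$$ satisfies for all $t\ge 0$ $$\|u(t,\cdot)\|_{L^2}\le Ce^{-\sigma t}\big(\|u_0\|_{L^2}+\|u_1\|_{H^{-1}}\big),$$ $$\|\nabla u(t,\cdot)\|_{L^2}\le Ce^{-\sigma t}\big(\|u_0\|_{H^1}+\|u_1\|_{L^2}\big),$$ $$\|u_t(t,\cdot)\|_{L^2}\le Ce^{-\sigma t}\big(\|u_0\|_{H^1}+\|u_1\|_{L^2}\big),$$ where $\sigma>0$ and $C>0$ are constants depending only on $m_0$, $m_1$, $b$ and $\epsilon$, and each estimate holds for all initial data $(u_0,u_1)$ for which the norms on its right-hand side are finite.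
   Context: $H^s=H^s(\mathbb{R}^n)$ are the usual inhomogeneous $L^2$-based Sobolev spaces and $L^2=L^2(\mathbb{R}^n)$. The solution is the one whose partial Fourier transform $\hat u(t,\xi)$ in $x$ solves, for each $\xi$, the ordinary differential equation $\hat u_{tt}+|\xi|^2\hat u+2b(t)\hat u_t+m_\epsilon^2(t)\hat u=0$ (in the Carathéodory sense, i.e. for almost every $t$) with $\hat u(0,\xi)=\hat u_0(\xi)$, $\hat u_t(0,\xi)=\hat u_1(\xi)$. *)

theory Defs
  imports "HOL-Analysis.Analysis"
begin

section \<open>Functions of one real variable\<close>

definition test_function :: "(real \<Rightarrow> real) \<Rightarrow> bool" where
  "test_function \<phi> \<longleftrightarrow>
     (\<forall>k x. (deriv ^^ k) \<phi> differentiable (at x)) \<and> (\<exists>R. \<forall>x. R < \<bar>x\<bar> \<longrightarrow> \<phi> x = 0)"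

definition has_weak_derivative :: "(real \<Rightarrow> real) \<Rightarrow> (real \<Rightarrow> real) \<Rightarrow> bool" where
  "has_weak_derivative f g \<longleftrightarrow>
     (\<forall>a c. set_integrable lebesgue {a..c} f \<and> set_integrable lebesgue {a..c} g) \<and>
     (\<forall>\<phi>. test_function \<phi> \<longrightarrow>
        (LINT x|lebesgue. f x * deriv \<phi> x) = - (LINT x|lebesgue. g x * \<phi> x))"

definition L_infinity :: "(real \<Rightarrow> real) set" where
  "L_infinity = {g. g \<in> borel_measurable lebesgue \<and> (\<exists>M. AE x in lebesgue. \<bar>g x\<bar> \<le> M)}"

text \<open>Absolute continuity on \<open>[a, c]\<close>: finite families of non-overlapping compact intervals are
  given as divisions of their union.\<close>

definition abs_continuous_on :: "real \<Rightarrow> real \<Rightarrow> (real \<Rightarrow> complex) \<Rightarrow> bool" where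
  "abs_continuous_on a c f \<longleftrightarrow>
     (\<forall>e>0. \<exists>d>0. \<forall>D. D division_of (\<Union>D) \<and> \<Union>D \<subseteq> {a..c} \<and> (\<Sum>K\<in>D. measure lborel K) < d \<longrightarrow>
        (\<Sum>K\<in>D. norm (f (Sup K) - f (Inf K))) < e)"

text \<open>\<open>y'' + \<mu> y + 2 b(t) y' + q(t) y = 0\<close> on \<open>[0, \<infinity>)\<close> with \<open>y(0) = y0\<close>, \<open>y'(0) = y1\<close>, in the
  sense of Caratheodory: \<open>y\<close> is differentiable with locally absolutely continuous derivative \<open>p\<close>,
  and the equation holds for almost every \<open>t\<close>.\<close>

definition caratheodory_solution ::
  "(real \<Rightarrow> real) \<Rightarrow> (real \<Rightarrow> real) \<Rightarrow> real \<Rightarrow> complex \<Rightarrow> complex \<Rightarrow> (real \<Rightarrow> complex) \<Rightarrow> bool" where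
  "caratheodory_solution b q \<mu> y0 y1 y \<longleftrightarrow>
     (\<exists>p. (\<forall>t\<ge>0. (y has_vector_derivative p t) (at t within {0..})) \<and>
          (\<forall>c>0. abs_continuous_on 0 c p) \<and>
          (AE t in lebesgue. 0 < t \<longrightarrow>
             (\<exists>z. (p has_vector_derivative z) (at t) \<and>
                  z + of_real \<mu> * y t + 2 * of_real (b t) * p t + of_real (q t) * y t = 0)) \<and>
          y 0 = y0 \<and> p 0 = y1)"

section \<open>Euclidean space of dimension \<open>n\<close>\<close>

text \<open>The dimension is a natural number rather than a type, so that constants can be stated to be
  independent of it.  Points are the (extensional) elements of \<open>space (lebn n)\<close>; values of functions
  at other arguments are irrelevant.\<close>

type_synonym vec = "nat \<Rightarrow> real"

definition lebn :: "nat \<Rightarrow> vec measure" where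
  "lebn n = (\<Pi>\<^sub>M i\<in>{..<n}. lborel)"

definition euclid_norm :: "nat \<Rightarrow> vec \<Rightarrow> real" where
  "euclid_norm n x = L2_set x {..<n}"

definition dot :: "nat \<Rightarrow> vec \<Rightarrow> vec \<Rightarrow> real" where
  "dot n x y = (\<Sum>i<n. x i * y i)"

definition square_integrable :: "nat \<Rightarrow> (vec \<Rightarrow> complex) \<Rightarrow> bool" where
  "square_integrable n f \<longleftrightarrow>
     f \<in> borel_measurable (lebn n) \<and> integrable (lebn n) (\<lambda>x. (norm (f x))\<^sup>2)"

definition L2norm_fun :: "nat \<Rightarrow> (vec \<Rightarrow> complex) \<Rightarrow> real" where
  "L2norm_fun n f = sqrt (LINT x|lebn n. (norm (f x))\<^sup>2)"

definition partial :: "nat \<Rightarrow> (vec \<Rightarrow> complex) \<Rightarrow> vec \<Rightarrow> complex" where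
  "partial i f x = vector_derivative (\<lambda>s. f (x(i := s))) (at (x i))"

text \<open>A multi-index is given as the list of the variables of differentiation.\<close>

definition partials :: "nat list \<Rightarrow> (vec \<Rightarrow> complex) \<Rightarrow> vec \<Rightarrow> complex" where
  "partials js f = foldr partial js f"

section \<open>Tempered distributions\<close>

text \<open>Existence and boundedness of all iterated partial derivatives already make every one of them
  Lipschitz continuous, so no continuity needs to be required separately.\<close>

definition schwartz :: "nat \<Rightarrow> (vec \<Rightarrow> complex) set" where
  "schwartz n = {\<phi>. \<forall>js. set js \<subseteq> {..<n} \<longrightarrow>
     (\<forall>x\<in>space (lebn n). \<forall>i<n. (\<lambda>s. partials js \<phi> (x(i := s))) differentiable (at (x i))) \<and>
     (\<forall>k. \<exists>B. \<forall>x\<in>space (lebn n). (1 + euclid_norm n x) ^ k * norm (partials js \<phi> x) \<le> B)}"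

definition schwartz_norm :: "nat \<Rightarrow> nat \<Rightarrow> (vec \<Rightarrow> complex) \<Rightarrow> real" where
  "schwartz_norm n N \<phi> =
     (SUP (js, x) \<in> {js. set js \<subseteq> {..<n} \<and> length js \<le> N} \<times> space (lebn n).
        (1 + euclid_norm n x) ^ N * norm (partials js \<phi> x))"

text \<open>Only the values on \<open>schwartz n\<close> matter.\<close>

type_synonym distribution = "(vec \<Rightarrow> complex) \<Rightarrow> complex"

definition tempered :: "nat \<Rightarrow> distribution \<Rightarrow> bool" where
  "tempered n T \<longleftrightarrow>
     (\<forall>\<phi>\<in>schwartz n. \<forall>\<psi>\<in>schwartz n. T (\<lambda>x. \<phi> x + \<psi> x) = T \<phi> + T \<psi>) \<and>
     (\<forall>\<phi>\<in>schwartz n. \<forall>c. T (\<lambda>x. c * \<phi> x) = c * T \<phi>) \<and>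
     (\<exists>C N. \<forall>\<phi>\<in>schwartz n. norm (T \<phi>) \<le> C * schwartz_norm n N \<phi>)"

definition represents :: "nat \<Rightarrow> distribution \<Rightarrow> (vec \<Rightarrow> complex) \<Rightarrow> bool" where
  "represents n T g \<longleftrightarrow>
     g \<in> borel_measurable (lebn n) \<and>
     (\<forall>\<phi>\<in>schwartz n. integrable (lebn n) (\<lambda>x. g x * \<phi> x) \<and> T \<phi> = (LINT x|lebn n. g x * \<phi> x))"

text \<open>The representing function is unique up to a null set, so norms may be computed from any
  choice of it.\<close>

definition density_of :: "nat \<Rightarrow> distribution \<Rightarrow> vec \<Rightarrow> complex" where
  "density_of n T = (SOME g. represents n T g)"

text \<open>Unitary normalisation, which makes the norm of \<open>H\<^sup>0\<close> equal to the norm of \<open>L\<^sup>2\<close>.\<close>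

definition fourier :: "nat \<Rightarrow> (vec \<Rightarrow> complex) \<Rightarrow> vec \<Rightarrow> complex" where
  "fourier n f \<xi> =
     of_real ((2 * pi) powr (- real n / 2)) * (LINT x|lebn n. cis (- dot n x \<xi>) * f x)"

definition fourier_dist :: "nat \<Rightarrow> distribution \<Rightarrow> distribution" where
  "fourier_dist n T = (\<lambda>\<phi>. T (fourier n \<phi>))"

definition partial_dist :: "nat \<Rightarrow> distribution \<Rightarrow> distribution" where
  "partial_dist j T = (\<lambda>\<phi>. - T (partial j \<phi>))"

section \<open>The spaces \<open>L\<^sup>2\<close> and \<open>H\<^sup>s\<close>\<close>

definition L2 :: "nat \<Rightarrow> distribution set" where
  "L2 n = {T. tempered n T \<and> (\<exists>f. represents n T f \<and> square_integrable n f)}"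

definition L2_norm :: "nat \<Rightarrow> distribution \<Rightarrow> real" where
  "L2_norm n T = L2norm_fun n (density_of n T)"

definition sobolev_weight :: "nat \<Rightarrow> real \<Rightarrow> (vec \<Rightarrow> complex) \<Rightarrow> vec \<Rightarrow> complex" where
  "sobolev_weight n s g = (\<lambda>\<xi>. of_real ((1 + (euclid_norm n \<xi>)\<^sup>2) powr (s / 2)) * g \<xi>)"

definition sobolev :: "nat \<Rightarrow> real \<Rightarrow> distribution set" where
  "sobolev n s = {T. tempered n T \<and>
     (\<exists>g. represents n (fourier_dist n T) g \<and> square_integrable n (sobolev_weight n s g))}"

definition sobolev_norm :: "nat \<Rightarrow> real \<Rightarrow> distribution \<Rightarrow> real" where
  "sobolev_norm n s T = L2norm_fun n (sobolev_weight n s (density_of n (fourier_dist n T)))"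

definition grad_L2_norm :: "nat \<Rightarrow> distribution \<Rightarrow> real" where
  "grad_L2_norm n T = L2_set (\<lambda>j. L2_norm n (partial_dist j T)) {..<n}"

section \<open>The Cauchy problem\<close>

text \<open>\<open>u t\<close> is the distribution \<open>u(t, \<cdot>)\<close>.  The time derivative is taken in the sense of tempered
  distributions, one-sided at \<open>t = 0\<close>.\<close>

definition has_time_derivative :: "nat \<Rightarrow> (real \<Rightarrow> distribution) \<Rightarrow> distribution \<Rightarrow> real \<Rightarrow> bool" where
  "has_time_derivative n u T t \<longleftrightarrow>
     (\<forall>\<phi>\<in>schwartz n. ((\<lambda>s. u s \<phi>) has_vector_derivative T \<phi>) (at t within {0..}))"

text \<open>\<open>u\<close> solves \<open>u\<^sub>t\<^sub>t - \<Delta>u + 2 b(t) u\<^sub>t + q(t) u = 0\<close> for \<open>t \<ge> 0\<close> with data \<open>u0\<close>, \<open>u1\<close>: its partial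
  Fourier transform is, at each time, a function \<open>v t\<close>, and \<open>\<lambda>t. v t \<xi>\<close> solves the transformed
  equation for every frequency \<open>\<xi>\<close>.\<close>

definition cauchy_solution ::
  "nat \<Rightarrow> (real \<Rightarrow> real) \<Rightarrow> (real \<Rightarrow> real) \<Rightarrow> distribution \<Rightarrow> distribution \<Rightarrow> (real \<Rightarrow> distribution) \<Rightarrow> bool"
where
  "cauchy_solution n b q u0 u1 u \<longleftrightarrow>
     (\<forall>t\<ge>0. tempered n (u t)) \<and>
     (\<exists>v w0 w1.
        (\<forall>t\<ge>0. represents n (fourier_dist n (u t)) (v t)) \<and>
        represents n (fourier_dist n u0) w0 \<and>
        represents n (fourier_dist n u1) w1 \<and>
        (\<forall>\<xi>\<in>space (lebn n).
           caratheodory_solution b q ((euclid_norm n \<xi>)\<^sup>2) (w0 \<xi>) (w1 \<xi>) (\<lambda>t. v t \<xi>)))"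

end

theory Submission
  imports Defs "HOL-Probability.Probability"
begin

text \<open>At a frequency \<open>\<xi>\<close> put \<open>M = |\<xi>|\<^sup>2 + m0\<^sup>2\<close>. The energy \<open>E = |y'|\<^sup>2 + M |y|\<^sup>2\<close> is damped only
  through \<open>b |y'|\<^sup>2\<close>. Let \<open>\<psi>\<close> be a periodic \<open>C\<^sup>1\<close> cutoff supported where \<open>b\<close> is bounded below. Since
  \<open>(\<psi>\<^sup>2)'\<close> is \<open>O(\<psi>)\<close>, the functional \<open>F = E + 2 \<delta> \<psi>\<^sup>2 Re (y cnj y')\<close> with small \<open>\<delta>\<close> is
  comparable to \<open>E\<close> and satisfies \<open>F' \<le> (- c \<psi>\<^sup>2 + C \<epsilon>) F\<close> for almost every \<open>t\<close>, uniformly in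
  \<open>\<xi>\<close>. As \<open>\<psi>\<^sup>2\<close> has positive mean, \<open>F\<close> decays exponentially for small \<open>\<epsilon>\<close>.

  To pass from frequencies to Sobolev norms, only half of Plancherel's theorem is needed: the Fourier transform
  and its inverse do not increase the \<open>L\<^sup>2\<close> norm. This follows from Gaussian
  regularisation and Schur's test, without any density of the Schwartz space in \<open>L\<^sup>2\<close>.\<close>

section \<open>Monotonicity of functions with absolutely continuous increments\<close>

text \<open>As \<open>m1\<close> is only measurable, \<open>p\<close> is merely absolutely
  continuous and F is differentiable only almost everywhere. A sign of F' then yields monotonicity
  only because the increments of F are dominated by those of \<open>p\<close> and of time. Where b
  vanishes nothing can be absorbed, so the cross term must carry a factor \<psi>: Young's inequality
  splits it into \<open>\<psi>\<^sup>2 M |y|^2\<close>, controlled by the derivative of the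
  corrector, and a multiple of \<open>|y'|^2\<close>, controlled by the damping where b is at least
  b0. The frequency enters only through M, which is comparable to \<open>1 + |\<xi>|^2\<close>.
  Hence \<sigma> and C do not depend on n, and one pointwise inequality gives all three bounds:
  divide it by the weight for u itself, keep the weight for the gradient and the time derivative.
  Contractions suffice because the transforms of the data are bounded by the data, and the solution
  by its transform. Norms are computed from a representing function picked by \<open>SOME\<close>;
  uniqueness of that function calls for Schwartz functions that separate densities.\<close>

lemma sum_measure_division_le:
  assumes D: "D division_of S" and T: "T \<in> lmeasurable" "S \<subseteq> T"
  shows "(\<Sum>K\<in>D. measure lborel K) \<le> measure lebesgue (T :: real set)"
proof -
  have fin: "finite D" using D by (auto simp: division_of_def)
  have box: "\<exists>a b. K = cbox a b" if "K \<in> D" for K using that D by (auto simp: division_of_def)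
  have "(\<Sum>K\<in>D. measure lborel K) = (\<Sum>K\<in>D. measure lebesgue K)"
    using box by (intro sum.cong) (force simp: measure_completion)+
  also have "\<dots> = measure lebesgue (\<Union>D)"
  proof (rule measure_negligible_finite_Union[OF fin, symmetric])
    show "K \<in> lmeasurable" if "K \<in> D" for K using box[OF that] by auto
    show "pairwise (\<lambda>K L. negligible (K \<inter> L)) D"
    proof (rule pairwiseI)
      fix K L assume KL: "K \<in> D" "L \<in> D" "K \<noteq> L"
      then obtain a b c d where ab: "K = cbox a b" "L = cbox c d" using box by metis
      have int: "interior K \<inter> interior L = {}" using D KL by (auto simp: division_of_def)
      have "negligible (interior (K \<inter> L))" by (simp add: int)
      moreover have "\<exists>u v. K \<inter> L = cbox u v" unfolding ab Int_interval by blast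
      ultimately show "negligible (K \<inter> L)"
        by (metis content_eq_0_interior interior_Int int negligible_iff_measure0 lmeasurable_cbox measure_completion sets_lborel borel_closed closed_cbox)
    qed
  qed
  also have "\<dots> \<le> measure lebesgue T"
  proof (rule measure_mono_fmeasurable)
    show "\<Union>D \<subseteq> T" using D T by (auto simp: division_of_def)
    show "\<Union>D \<in> sets lebesgue" using box fin by (intro sets.finite_Union) force+
  qed (fact T)
  finally show ?thesis .
qed

text \<open>Gauge argument: over a fine tagged division the increments of G telescope to
  \<open>G c - G a\<close>. An interval tagged outside the null set gains at most e times its
  length, by the derivative at the tag. Those tagged inside it lie in an open set of small measure,
  where absolute continuity of \<open>f\<close> together with \<open>dom\<close> makes the total
  gain small.\<close>

theorem nonincreasing_if_dominated_abs_continuous: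
  fixes G :: "real \<Rightarrow> real"
  assumes ac: "abs_continuous_on a c f" and "a \<le> c" "0 \<le> A"
    and dom: "\<And>u v. \<lbrakk>a \<le> u; u \<le> v; v \<le> c\<rbrakk> \<Longrightarrow> \<bar>G v - G u\<bar> \<le> A * (norm (f v - f u) + (v - u))"
    and der: "AE t in lebesgue. a < t \<and> t < c \<longrightarrow> (\<exists>d\<le>0. (G has_real_derivative d) (at t))"
  shows "G c \<le> G a"
proof -
  obtain N where N: "N \<in> null_sets lebesgue"
    and dN: "\<And>t. t \<notin> N \<Longrightarrow> a < t \<Longrightarrow> t < c \<Longrightarrow> \<exists>d\<le>0. (G has_real_derivative d) (at t)"
    using der by (rule AE_E3) (auto 0 3)
  \<comment> \<open>The end points join the exceptional set because \<open>dN\<close> speaks of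
    interior points only.\<close>
  define N' where "N' = insert a (insert c N)"
  have N': "N' \<in> null_sets lebesgue"
  proof -
    have "{a, c} \<in> null_sets lebesgue"
      by (intro null_sets_completionI finite_imp_null_set_lborel) simp
    moreover have "N' = {a, c} \<union> N" by (auto simp: N'_def)
    ultimately show ?thesis using N by auto
  qed
  have "G c - G a \<le> e * (c - a) + 2 * A * e" if "e > 0" for e
  proof -
    obtain d where d: "d > 0" and dAC: "\<And>D. D division_of (\<Union>D) \<Longrightarrow> \<Union>D \<subseteq> {a..c} \<Longrightarrow>
        (\<Sum>K\<in>D. measure lborel K) < d \<Longrightarrow> (\<Sum>K\<in>D. norm (f (Sup K) - f (Inf K))) < e"
      using ac \<open>e > 0\<close> unfolding abs_continuous_on_def by metis
    have "min d e > 0" using d \<open>e > 0\<close> by simp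
    moreover have "N' \<in> sets lebesgue" using N' by (auto simp: null_sets_def)
    ultimately obtain U where U: "open U" "N' \<subseteq> U" "U - N' \<in> lmeasurable"
        "emeasure lebesgue (U - N') < ennreal (min d e)"
      using sets_lebesgue_outer_open by metis
    have Ulm: "U \<in> lmeasurable"
      using U N' by (metis Diff_partition fmeasurable.Un fmeasurableI_null_sets)
    have "measure lebesgue U = measure lebesgue (U - N')"
      using N' Ulm U(1) by (simp add: measure_Diff_null_set)
    also have "\<dots> < min d e"
      using U(3,4) \<open>min d e > 0\<close> by (simp add: emeasure_eq_measure2 ennreal_less_iff)
    finally have Um: "measure lebesgue U < d" "measure lebesgue U < e" by auto
    \<comment> \<open>Straddle estimate: u and v are compared with the tag x between them, so that a
      nonpositive derivative at x bounds the increment over the whole interval. Points of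
      \<open>N'\<close> only have to keep their ball inside U.\<close>
    have "\<exists>r>0. (x \<in> N' \<longrightarrow> ball x r \<subseteq> U) \<and> (x \<notin> N' \<and> a < x \<and> x < c \<longrightarrow>
        (\<forall>u v. u \<le> x \<and> x \<le> v \<and> u \<in> ball x r \<and> v \<in> ball x r \<longrightarrow> G v - G u \<le> e * (v - u)))" for x
    proof (cases "x \<in> N' \<or> \<not> (a < x \<and> x < c)")
      case True
      then show ?thesis
        using U(1,2) open_contains_ball zero_less_one by (metis subsetD)
    next
      case False
      then obtain D where D: "D \<le> 0" "(G has_real_derivative D) (at x)" using dN[of x] unfolding N'_def by blast
      have "(G has_derivative (\<lambda>h. D * h)) (at x)" using D(2) by (simp add: has_field_derivative_def)
      then obtain r where r: "r > 0" "\<And>y. norm (y - x) < r \<Longrightarrow> norm (G y - G x - D * (y - x)) \<le> e * norm (y - x)"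
        unfolding has_derivative_at_alt using \<open>e > 0\<close> by blast
      have "G v - G u \<le> e * (v - u)" if "u \<le> x" "x \<le> v" "u \<in> ball x r" "v \<in> ball x r" for u v
      proof -
        have "G v - G x - D * (v - x) \<le> e * (v - x)" "- (G u - G x - D * (u - x)) \<le> e * (x - u)"
          using r(2)[of v] r(2)[of u] that by (auto simp: dist_real_def abs_le_iff)
        moreover have "D * (v - x) \<le> 0" "D * (x - u) \<le> 0"
          using D(1) that by (auto intro: mult_nonpos_nonneg)
        ultimately show ?thesis by (simp add: algebra_simps)
      qed
      then show ?thesis using r(1) False by blast
    qed
    then obtain R where R: "\<And>x. R x > 0" "\<And>x. x \<in> N' \<Longrightarrow> ball x (R x) \<subseteq> U"
      "\<And>x u v. \<lbrakk>x \<notin> N'; a < x; x < c; u \<le> x; x \<le> v; u \<in> ball x (R x); v \<in> ball x (R x)\<rbrakk> \<Longrightarrow> G v - G u \<le> e * (v - u)"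
      by metis
    have "gauge (\<lambda>x. ball x (R x))" using R(1) by (simp add: gauge_def)
    then obtain p where p: "p tagged_division_of {a..c}" "(\<lambda>x. ball x (R x)) fine p"
      using fine_division_exists_real by blast
    have fin: "finite p" using p(1) by auto
    define P1 where "P1 = {xK \<in> p. fst xK \<in> N'}"
    define P2 where "P2 = p - P1"
    have pp: "p tagged_partial_division_of {a..c}" using p(1) by (simp add: tagged_division_of_def)
    have mem: "\<exists>u v. K = {u..v} \<and> u \<le> x \<and> x \<le> v \<and> a \<le> u \<and> v \<le> c \<and> u \<in> ball x (R x) \<and> v \<in> ball x (R x)"
      if xK: "(x, K) \<in> p" for x K
    proof -
      obtain u v where uv: "K = cbox u v" using tagged_division_ofD(4)[OF p(1) xK] by blast
      have x: "x \<in> K" "K \<subseteq> {a..c}" using tagged_division_ofD(2,3)[OF p(1) xK] by auto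
      have "K \<subseteq> ball x (R x)" using p(2) xK by (auto simp: fine_def)
      moreover have uvK: "u \<in> K" "v \<in> K" using uv x by auto
      ultimately have "u \<in> ball x (R x)" "v \<in> ball x (R x)" by blast+
      moreover have "u \<le> x" "x \<le> v" "a \<le> u" "v \<le> c" using uv x uvK by auto
      ultimately show ?thesis using uv by (intro exI[of _ u] exI[of _ v]) simp
    qed
    have P1p: "P1 tagged_partial_division_of {a..c}"
      using pp by (rule tagged_partial_division_subset) (auto simp: P1_def)
    have D1: "(snd ` P1) division_of \<Union>(snd ` P1)" by (rule partial_division_of_tagged_division[OF P1p])
    \<comment> \<open>The same interval can carry several tags only if it is degenerate, so summing
      over pairs and over intervals agrees as soon as \<open>h\<close> vanishes on single points.
      \<open>h'\<close> takes care of the empty interval.\<close>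
    have over: "(\<Sum>(x,K)\<in>P1. h K) = (\<Sum>K\<in>snd ` P1. h K)"
      if "\<And>u. h {u} = 0" for h :: "real set \<Rightarrow> real"
    proof -
      define h' where "h' = (\<lambda>K. if K = {} then 0 else h K)"
      have ne: "K \<noteq> {}" if "(x, K) \<in> P1" for x K using tagged_partial_division_ofD(2)[OF P1p that] by auto
      have "(\<Sum>(x,K)\<in>P1. h K) = (\<Sum>(x,K)\<in>P1. h' K)"
        using ne by (intro sum.cong) (auto simp: h'_def)
      also have "\<dots> = (\<Sum>K\<in>snd ` P1. h' K)"
      proof (rule sum.over_tagged_division_lemma[OF tagged_partial_division_of_Union_self[OF P1p]])
        fix u v :: real assume "box u v = {}"
        then show "h' (cbox u v) = 0"
          using that by (cases "u = v") (auto simp: h'_def box_eq_empty)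
      qed
      also have "\<dots> = (\<Sum>K\<in>snd ` P1. h K)"
        using ne by (intro sum.cong) (auto simp: h'_def)
      finally show ?thesis .
    qed
    have sub1: "\<Union>(snd ` P1) \<subseteq> {a..c}" "\<Union>(snd ` P1) \<subseteq> U"
    proof -
      show "\<Union>(snd ` P1) \<subseteq> {a..c}" using tagged_partial_division_ofD(3)[OF P1p] by fastforce
      have "K \<subseteq> U" if "(x, K) \<in> P1" for x K
        using that R(2)[of x] p(2) unfolding P1_def fine_def by fastforce
      then show "\<Union>(snd ` P1) \<subseteq> U" by fastforce
    qed
    have m1: "(\<Sum>K\<in>snd ` P1. measure lborel K) \<le> measure lebesgue U"
      by (rule sum_measure_division_le[OF D1 Ulm sub1(2)])
    have f1: "(\<Sum>K\<in>snd ` P1. norm (f (Sup K) - f (Inf K))) < e"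
      using dAC[OF D1 sub1(1)] m1 Um by linarith
    have "(\<Sum>(x,K)\<in>P1. G (Sup K) - G (Inf K)) \<le> (\<Sum>(x,K)\<in>P1. A * (norm (f (Sup K) - f (Inf K)) + measure lborel K))"
    proof (rule sum_mono, clarify)
      fix x K assume "(x, K) \<in> P1"
      then obtain u v where "K = {u..v}" "u \<le> v" "a \<le> u" "v \<le> c" using mem[of x K] by (auto simp: P1_def)
      then show "G (Sup K) - G (Inf K) \<le> A * (norm (f (Sup K) - f (Inf K)) + measure lborel K)"
        using dom[of u v] by simp
    qed
    also have "\<dots> = A * ((\<Sum>K\<in>snd ` P1. norm (f (Sup K) - f (Inf K))) + (\<Sum>K\<in>snd ` P1. measure lborel K))"
      by (subst over) (simp_all add: sum.distrib flip: sum_distrib_left)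
    also have "\<dots> \<le> A * (e + e)"
      using f1 m1 Um \<open>0 \<le> A\<close> by (intro mult_left_mono) auto
    finally have s1: "(\<Sum>(x,K)\<in>P1. G (Sup K) - G (Inf K)) \<le> A * (e + e)" .
    have "(\<Sum>(x,K)\<in>P2. G (Sup K) - G (Inf K)) \<le> (\<Sum>(x,K)\<in>P2. e * measure lborel K)"
    proof (rule sum_mono, clarify)
      fix x K assume xK: "(x, K) \<in> P2"
      then have "(x, K) \<in> p" "x \<notin> N'" by (auto simp: P1_def P2_def)
      moreover obtain u v where "K = {u..v}" "u \<le> x" "x \<le> v" "a \<le> u" "v \<le> c" "u \<in> ball x (R x)" "v \<in> ball x (R x)"
        using mem[of x K] xK by (auto simp: P2_def)
      moreover have "a < x" "x < c" using calculation by (auto simp: N'_def order.order_iff_strict)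
      ultimately show "G (Sup K) - G (Inf K) \<le> e * measure lborel K"
        using R(3)[of x u v] by simp
    qed
    also have "\<dots> \<le> (\<Sum>(x,K)\<in>p. e * measure lborel K)"
      using fin \<open>e > 0\<close> by (intro sum_mono2) (auto simp: P2_def)
    also have "\<dots> = e * (\<Sum>(x,K)\<in>p. measure lborel K)"
      by (simp add: sum_distrib_left case_prod_unfold)
    also have "(\<Sum>(x,K)\<in>p. measure lborel K) = c - a"
      using additive_content_tagged_division[of p a c] p(1) \<open>a \<le> c\<close> by simp
    finally have s2: "(\<Sum>(x,K)\<in>P2. G (Sup K) - G (Inf K)) \<le> e * (c - a)" .
    have "G c - G a = (\<Sum>(x,K)\<in>p. G (Sup K) - G (Inf K))"
      by (rule additive_tagged_division_1[OF \<open>a \<le> c\<close> p(1), symmetric])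
    also have "\<dots> = (\<Sum>(x,K)\<in>P2. G (Sup K) - G (Inf K)) + (\<Sum>(x,K)\<in>P1. G (Sup K) - G (Inf K))"
      unfolding P2_def using fin by (intro sum.subset_diff) (auto simp: P1_def)
    finally show ?thesis using s1 s2 by simp
  qed
  then have *: "G c - G a \<le> e * (c - a + 2 * A)" if "e > 0" for e
    using that by (force simp: algebra_simps)
  show ?thesis
  proof (rule ccontr)
    assume "\<not> G c \<le> G a"
    then have g: "G c - G a > 0" by simp
    have B: "c - a + 2 * A + 1 > 0" using \<open>a \<le> c\<close> \<open>0 \<le> A\<close> by simp
    have "G c - G a \<le> (G c - G a) / (c - a + 2 * A + 1) * (c - a + 2 * A)"
      using g B by (intro *) auto
    also have "\<dots> < G c - G a" using g B by (simp add: field_simps)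
    finally show False by simp
  qed
qed

section \<open>Calculus of dominated increments\<close>

lemma norm_diff_le_of_derivative_bound:
  fixes f :: "real \<Rightarrow> 'a::real_normed_vector"
  assumes "convex S" and der: "\<And>s. s \<in> S \<Longrightarrow> (f has_vector_derivative f' s) (at s within S)"
    and bd: "\<And>s. s \<in> S \<Longrightarrow> norm (f' s) \<le> B" and "s \<in> S" "t \<in> S"
  shows "norm (f s - f t) \<le> B * \<bar>s - t\<bar>"
proof -
  have "norm (f s - f t) \<le> B * norm (s - t)"
  proof (rule differentiable_bound[OF \<open>convex S\<close>, of f "\<lambda>t h. h *\<^sub>R f' t"])
    show "(f has_derivative (\<lambda>h. h *\<^sub>R f' x)) (at x within S)" if "x \<in> S" for x
      using der[OF that] by (simp add: has_vector_derivative_def)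
    show "onorm (\<lambda>h. h *\<^sub>R f' x) \<le> B" if "x \<in> S" for x
      using bd[OF that] norm_ge_zero[of "f' x"] by (auto intro!: onorm_le simp: mult.commute[of B] mult_left_mono)
  qed fact+
  then show ?thesis by simp
qed

text \<open>The increments of \<open>g\<close> are Lipschitz in those of \<open>f\<close> and of the
  variable. Boundedness belongs to the notion so that products preserve it. The Lyapunov functional,
  made of \<open>p\<close>, \<open>y\<close> and C1 functions of time by sums and products, then has
  the property with respect to \<open>p\<close>.\<close>

definition increments_dominated :: "real \<Rightarrow> real \<Rightarrow> (real \<Rightarrow> complex) \<Rightarrow> (real \<Rightarrow> 'a::real_normed_vector) \<Rightarrow> bool" where
  "increments_dominated a c f g \<longleftrightarrow> (\<exists>A\<ge>0. \<exists>B\<ge>0. (\<forall>t. a \<le> t \<longrightarrow> t \<le> c \<longrightarrow> norm (g t) \<le> B) \<and>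
     (\<forall>u v. a \<le> u \<longrightarrow> u \<le> v \<longrightarrow> v \<le> c \<longrightarrow> norm (g v - g u) \<le> A * (norm (f v - f u) + (v - u))))"

lemma increments_dominated_add:
  assumes "increments_dominated a c f g" "increments_dominated a c f h"
  shows "increments_dominated a c f (\<lambda>t. g t + h t)"
proof -
  obtain A B where A: "A \<ge> 0" "B \<ge> 0" "\<And>t. a \<le> t \<Longrightarrow> t \<le> c \<Longrightarrow> norm (g t) \<le> B"
    "\<And>u v. a \<le> u \<Longrightarrow> u \<le> v \<Longrightarrow> v \<le> c \<Longrightarrow> norm (g v - g u) \<le> A * (norm (f v - f u) + (v - u))"
    using assms(1) unfolding increments_dominated_def by metis
  obtain A' B' where A': "A' \<ge> 0" "B' \<ge> 0" "\<And>t. a \<le> t \<Longrightarrow> t \<le> c \<Longrightarrow> norm (h t) \<le> B'"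
    "\<And>u v. a \<le> u \<Longrightarrow> u \<le> v \<Longrightarrow> v \<le> c \<Longrightarrow> norm (h v - h u) \<le> A' * (norm (f v - f u) + (v - u))"
    using assms(2) unfolding increments_dominated_def by metis
  have "norm (g v + h v - (g u + h u)) \<le> (A + A') * (norm (f v - f u) + (v - u))"
    if "a \<le> u" "u \<le> v" "v \<le> c" for u v
    using A(4)[OF that] A'(4)[OF that] norm_triangle_ineq[of "g v - g u" "h v - h u"]
    by (simp add: algebra_simps)
  moreover have "norm (g t + h t) \<le> B + B'" if "a \<le> t" "t \<le> c" for t
    using A(3)[OF that] A'(3)[OF that] norm_triangle_ineq[of "g t" "h t"] by linarith
  ultimately show ?thesis unfolding increments_dominated_def using A A'
    by (intro exI[of _ "A + A'"] conjI exI[of _ "B + B'"]) auto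
qed

text \<open>Splits the increment as \<open>(g v - g u) h v + g u (h v - h u)\<close>. The bilinear
  form covers both multiplication and the inner product.\<close>

lemma (in bounded_bilinear) increments_dominated:
  assumes "increments_dominated a c f g" "increments_dominated a c f h"
  shows "increments_dominated a c f (\<lambda>t. prod (g t) (h t))"
proof -
  obtain A B where A: "A \<ge> 0" "B \<ge> 0" "\<And>t. a \<le> t \<Longrightarrow> t \<le> c \<Longrightarrow> norm (g t) \<le> B"
    "\<And>u v. a \<le> u \<Longrightarrow> u \<le> v \<Longrightarrow> v \<le> c \<Longrightarrow> norm (g v - g u) \<le> A * (norm (f v - f u) + (v - u))"
    using assms(1) unfolding increments_dominated_def by metis
  obtain A' B' where A': "A' \<ge> 0" "B' \<ge> 0" "\<And>t. a \<le> t \<Longrightarrow> t \<le> c \<Longrightarrow> norm (h t) \<le> B'"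
    "\<And>u v. a \<le> u \<Longrightarrow> u \<le> v \<Longrightarrow> v \<le> c \<Longrightarrow> norm (h v - h u) \<le> A' * (norm (f v - f u) + (v - u))"
    using assms(2) unfolding increments_dominated_def by metis
  obtain K where K: "K \<ge> 0" "\<And>x y. norm (prod x y) \<le> norm x * norm y * K"
    using nonneg_bounded by blast
  have "norm (prod (g v) (h v) - prod (g u) (h u)) \<le> (A * B' * K + B * A' * K) * (norm (f v - f u) + (v - u))"
    if "a \<le> u" "u \<le> v" "v \<le> c" for u v
  proof -
    let ?w = "norm (f v - f u) + (v - u)"
    have w: "?w \<ge> 0" using that by simp
    have "prod (g v) (h v) - prod (g u) (h u) = prod (g v - g u) (h v) + prod (g u) (h v - h u)"
      by (simp add: diff_left diff_right)
    also have "norm \<dots> \<le> norm (g v - g u) * norm (h v) * K + norm (g u) * norm (h v - h u) * K"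
      using K(2) norm_triangle_ineq add_mono order_trans by metis
    also have "\<dots> \<le> (A * ?w) * B' * K + B * (A' * ?w) * K"
      using A A' K w that by (intro add_mono mult_right_mono mult_mono) auto
    finally show ?thesis by (simp add: algebra_simps)
  qed
  moreover have "norm (prod (g t) (h t)) \<le> B * B' * K" if "a \<le> t" "t \<le> c" for t
  proof -
    have "norm (prod (g t) (h t)) \<le> norm (g t) * norm (h t) * K" by (rule K)
    also have "\<dots> \<le> B * B' * K"
      using A A' K that by (intro mult_right_mono mult_mono) auto
    finally show ?thesis .
  qed
  ultimately show ?thesis unfolding increments_dominated_def using A A' K
    by (intro exI[of _ "A * B' * K + B * A' * K"] conjI exI[of _ "B * B' * K"]) auto
qed

text \<open>By the mean value inequality the length term alone dominates. The derivative is relative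
  to the interval, which admits one-sided derivatives at time 0.\<close>

lemma increments_dominated_C1:
  fixes g :: "real \<Rightarrow> 'a::real_normed_vector"
  assumes der: "\<And>t. a \<le> t \<Longrightarrow> t \<le> c \<Longrightarrow> (g has_vector_derivative g' t) (at t within {a..c})"
    and bd: "\<And>t. a \<le> t \<Longrightarrow> t \<le> c \<Longrightarrow> norm (g' t) \<le> B"
  shows "increments_dominated a c f g"
proof (cases "a \<le> c")
  case True
  then have B: "B \<ge> 0" using bd[of a] norm_ge_zero order_trans by blast
  have lip: "norm (g v - g u) \<le> B * \<bar>v - u\<bar>" if "a \<le> u" "u \<le> c" "a \<le> v" "v \<le> c" for u v
    using norm_diff_le_of_derivative_bound[OF convex_real_interval(5), of a c g g' B v u] der bd that by simp
  have "norm (g t) \<le> norm (g a) + B * (c - a)" if "a \<le> t" "t \<le> c" for t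
  proof -
    have "norm (g t) \<le> norm (g a) + norm (g t - g a)" by (simp add: norm_triangle_sub)
    also have "norm (g t - g a) \<le> B * norm (t - a)" using lip[of a t] that by simp
    also have "\<dots> \<le> B * (c - a)" using B that by (intro mult_left_mono) auto
    finally show ?thesis by simp
  qed
  moreover have "norm (g v - g u) \<le> B * (norm (f v - f u) + (v - u))" if "a \<le> u" "u \<le> v" "v \<le> c" for u v
  proof -
    have "norm (g v - g u) \<le> B * \<bar>v - u\<bar>" using lip[of u v] that by linarith
    also have "\<dots> \<le> B * (norm (f v - f u) + (v - u))" using B that by (intro mult_left_mono) auto
    finally show ?thesis .
  qed
  ultimately show ?thesis unfolding increments_dominated_def using B True
    by (intro exI[of _ B] conjI exI[of _ "norm (g a) + B * (c - a)"]) auto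
next
  case False
  then show ?thesis unfolding increments_dominated_def by (intro exI[of _ 0]) auto
qed

lemma abs_continuous_on_imp_continuous_on:
  assumes "abs_continuous_on a c f"
  shows "continuous_on {a..c} f"
  unfolding continuous_on_iff
proof (intro ballI allI impI)
  fix x and e :: real assume x: "x \<in> {a..c}" and "e > 0"
  then obtain d where d: "d > 0" and dAC: "\<And>D. D division_of (\<Union>D) \<Longrightarrow> \<Union>D \<subseteq> {a..c} \<Longrightarrow>
      (\<Sum>K\<in>D. measure lborel K) < d \<Longrightarrow> (\<Sum>K\<in>D. norm (f (Sup K) - f (Inf K))) < e"
    using assms unfolding abs_continuous_on_def by metis
  have *: "norm (f v - f u) < e" if "a \<le> u" "u \<le> v" "v \<le> c" "v - u < d" for u v
  proof -
    have "{{u..v}} division_of (\<Union>{{u..v}})" using that by (auto simp: division_of_def intro!: exI[of _ u] exI[of _ v])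
    from dAC[OF this] show ?thesis using that by auto
  qed
  show "\<exists>d>0. \<forall>x'\<in>{a..c}. dist x' x < d \<longrightarrow> dist (f x') (f x) < e"
  proof (intro exI[of _ d] conjI ballI impI d)
    fix y assume y: "y \<in> {a..c}" "dist y x < d"
    show "dist (f y) (f x) < e"
      using *[of x y] *[of y x] x y by (cases "x \<le> y") (auto simp: dist_norm norm_minus_commute)
  qed
qed

lemma increments_dominated_self:
  assumes "abs_continuous_on a c f"
  shows "increments_dominated a c f f"
proof -
  have "compact (f ` {a..c})"
    by (intro compact_continuous_image abs_continuous_on_imp_continuous_on assms) simp
  then obtain B where "B > 0" "\<And>x. x \<in> {a..c} \<Longrightarrow> norm (f x) \<le> B"
    using compact_imp_bounded[THEN bounded_pos[THEN iffD1]] by (metis imageI)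
  then show ?thesis unfolding increments_dominated_def
    by (intro exI[of _ 1] conjI exI[of _ B]) auto
qed

section \<open>Uniform decay of a single frequency\<close>

text \<open>With \<rho> the derivative of \<Phi>, the hypothesis \<open>rate\<close> says F' +
  \<rho> F \<le> 0, with Z in the place of the second derivative of \<open>y\<close>. Asking it for
  all complex Y, P, Z tied by the equation separates the pointwise algebra from the regularity of
  the solution. The inner product is the real one on the complex plane, so
  \<open>y t \<bullet> p t\<close> is the real part of \<open>y\<close> times the conjugate of
  \<open>p\<close>.\<close>

lemma lyapunov_nonincreasing:
  fixes y p :: "real \<Rightarrow> complex"
  assumes y: "\<And>t. t \<ge> 0 \<Longrightarrow> (y has_vector_derivative p t) (at t within {0..})"
    and ac: "\<And>c. c > 0 \<Longrightarrow> abs_continuous_on 0 c p"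
    and ode: "AE t in lebesgue. 0 < t \<longrightarrow> (\<exists>z. (p has_vector_derivative z) (at t) \<and>
                  z + of_real \<mu> * y t + 2 * of_real (b t) * p t + of_real (q t) * y t = 0)"
    and theta: "\<And>t. (\<theta> has_real_derivative \<theta>' t) (at t)" "continuous_on UNIV \<theta>'"
    and Phi: "\<And>t. t \<ge> 0 \<Longrightarrow> (\<Phi> has_real_derivative \<rho> t) (at t within {0..})" "continuous_on {0..} \<rho>"
    and rate: "\<And>t Y P (Z::complex). 0 < t \<Longrightarrow> Z + of_real \<mu> * Y + 2 * of_real (b t) * P + of_real (q t) * Y = 0 \<Longrightarrow>
       \<rho> t * (P \<bullet> P + M * (Y \<bullet> Y) + \<theta> t * (Y \<bullet> P))
         + (2 * (P \<bullet> Z) + 2 * M * (Y \<bullet> P) + \<theta>' t * (Y \<bullet> P) + \<theta> t * (P \<bullet> P + Y \<bullet> Z)) \<le> 0"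
    and "0 \<le> t"
  defines "F \<equiv> \<lambda>t. p t \<bullet> p t + M * (y t \<bullet> y t) + \<theta> t * (y t \<bullet> p t)"
  shows "exp (\<Phi> t) * F t \<le> exp (\<Phi> 0) * F 0"
proof (cases "t = 0")
  case False
  define c where "c = t"
  have c: "c > 0" using False \<open>0 \<le> t\<close> by (simp add: c_def)
  define G where "G = (\<lambda>t. exp (\<Phi> t) * F t)"
  have acp: "abs_continuous_on 0 c p" using ac c .
  have bd: "\<exists>B. \<forall>t. 0 \<le> t \<longrightarrow> t \<le> c \<longrightarrow> norm (g t) \<le> B" if "continuous_on {0..c} g" for g :: "real \<Rightarrow> 'b::real_normed_vector"
  proof -
    have "bounded (g ` {0..c})" by (intro compact_imp_bounded compact_continuous_image that) simp
    then obtain B where "\<forall>x\<in>g ` {0..c}. norm x \<le> B" unfolding bounded_iff by blast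
    then show ?thesis by (intro exI[of _ B]) auto
  qed
  have idp: "increments_dominated 0 c p p" by (rule increments_dominated_self[OF acp])
  have idy: "increments_dominated 0 c p y"
  proof -
    obtain B where "\<forall>t. 0 \<le> t \<longrightarrow> t \<le> c \<longrightarrow> norm (p t) \<le> B"
      using bd[OF abs_continuous_on_imp_continuous_on[OF acp]] by blast
    then show ?thesis
      by (intro increments_dominated_C1[of _ _ _ p] has_vector_derivative_within_subset[OF y]) auto
  qed
  have idt: "increments_dominated 0 c p \<theta>"
  proof -
    obtain B where "\<forall>t. 0 \<le> t \<longrightarrow> t \<le> c \<longrightarrow> norm (\<theta>' t) \<le> B"
      using bd[OF continuous_on_subset[OF theta(2)]] by blast
    then show ?thesis
      using theta(1) by (intro increments_dominated_C1[of _ _ _ \<theta>'])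
        (auto simp: has_real_derivative_iff_has_vector_derivative[symmetric] intro: has_field_derivative_at_within)
  qed
  have cPhi: "continuous_on {0..c} \<Phi>"
    by (rule continuous_on_subset[of "{0..}"]) (auto intro!: DERIV_continuous_on Phi)
  have ide: "increments_dominated 0 c p (\<lambda>t. exp (\<Phi> t))"
  proof -
    have "continuous_on {0..c} (\<lambda>t. exp (\<Phi> t) * \<rho> t)"
      by (intro continuous_intros cPhi continuous_on_subset[OF Phi(2)]) auto
    then obtain B where B: "\<forall>t. 0 \<le> t \<longrightarrow> t \<le> c \<longrightarrow> norm (exp (\<Phi> t) * \<rho> t) \<le> B"
      using bd by blast
    have "((\<lambda>t. exp (\<Phi> t)) has_real_derivative exp (\<Phi> t) * \<rho> t) (at t within {0..c})" if "0 \<le> t" for t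
      using DERIV_subset[OF Phi(1)[OF that], of "{0..c}"] by (auto intro!: derivative_eq_intros)
    then show ?thesis
      using B by (intro increments_dominated_C1[of _ _ _ "\<lambda>t. exp (\<Phi> t) * \<rho> t"])
        (auto simp: has_real_derivative_iff_has_vector_derivative[symmetric])
  qed
  have idM: "increments_dominated 0 c p (\<lambda>t. M)"
    by (rule increments_dominated_C1[of _ _ _ "\<lambda>_. 0" 0]) (auto intro!: derivative_eq_intros)
  have "increments_dominated 0 c p G"
    unfolding G_def F_def
    by (intro bounded_bilinear.increments_dominated[OF bounded_bilinear_mult] increments_dominated_add
         bounded_bilinear.increments_dominated[OF bounded_bilinear_inner] idp idy idt ide idM)
  then obtain A where A: "A \<ge> 0" "\<And>u v. 0 \<le> u \<Longrightarrow> u \<le> v \<Longrightarrow> v \<le> c \<Longrightarrow> \<bar>G v - G u\<bar> \<le> A * (norm (p v - p u) + (v - u))"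
    unfolding increments_dominated_def by auto
  have "AE t in lebesgue. 0 < t \<and> t < c \<longrightarrow> (\<exists>d\<le>0. (G has_real_derivative d) (at t))"
    using ode
  proof eventually_elim
    case (elim t)
    show ?case
    proof
      assume t: "0 < t \<and> t < c"
      then obtain z where z: "(p has_vector_derivative z) (at t)"
        "z + of_real \<mu> * y t + 2 * of_real (b t) * p t + of_real (q t) * y t = 0" using elim by blast
      have at: "at t within {0..} = at t" using t by (intro at_within_interior) auto
      have y': "(y has_vector_derivative p t) (at t)" using y[of t] t at by simp
      have Phi': "(\<Phi> has_real_derivative \<rho> t) (at t)" using Phi(1)[of t] t at by simp
      note inn = bounded_bilinear.has_vector_derivative[OF bounded_bilinear_inner]
      have pp: "((\<lambda>t. p t \<bullet> p t) has_real_derivative (p t \<bullet> z + z \<bullet> p t)) (at t)"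
        and yy: "((\<lambda>t. y t \<bullet> y t) has_real_derivative (y t \<bullet> p t + p t \<bullet> y t)) (at t)"
        and yp: "((\<lambda>t. y t \<bullet> p t) has_real_derivative (y t \<bullet> z + p t \<bullet> p t)) (at t)"
        unfolding has_real_derivative_iff_has_vector_derivative
        by (intro inn z y')+
      have dF: "(F has_real_derivative ((p t \<bullet> z + z \<bullet> p t) + M * (y t \<bullet> p t + p t \<bullet> y t)
          + (\<theta>' t * (y t \<bullet> p t) + (y t \<bullet> z + p t \<bullet> p t) * \<theta> t))) (at t)"
        unfolding F_def
        by (rule DERIV_add[OF DERIV_add[OF pp DERIV_cmult[OF yy]] DERIV_mult[OF theta(1) yp]])
      have "(G has_real_derivative exp (\<Phi> t) * (\<rho> t * (p t \<bullet> p t + M * (y t \<bullet> y t) + \<theta> t * (y t \<bullet> p t))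
         + (2 * (p t \<bullet> z) + 2 * M * (y t \<bullet> p t) + \<theta>' t * (y t \<bullet> p t) + \<theta> t * (p t \<bullet> p t + y t \<bullet> z)))) (at t)"
        unfolding G_def
        by (rule DERIV_mult[OF DERIV_chain2[OF DERIV_exp Phi'] dF, THEN DERIV_cong])
          (simp add: F_def algebra_simps inner_commute)
      moreover have "exp (\<Phi> t) * (\<rho> t * (p t \<bullet> p t + M * (y t \<bullet> y t) + \<theta> t * (y t \<bullet> p t))
         + (2 * (p t \<bullet> z) + 2 * M * (y t \<bullet> p t) + \<theta>' t * (y t \<bullet> p t) + \<theta> t * (p t \<bullet> p t + y t \<bullet> z))) \<le> 0"
        using rate[OF _ z(2)] t by (intro mult_nonneg_nonpos) auto
      ultimately show "\<exists>d\<le>0. (G has_real_derivative d) (at t)" by blast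
    qed
  qed
  from nonincreasing_if_dominated_abs_continuous[OF acp _ A this] c show ?thesis
    by (simp add: G_def c_def)
qed simp

text \<open>Eliminating Z leaves \<open>- 4 b |P|^2\<close>, the corrector's
  \<open>2 \<delta> \<psi>\<^sup>2 (|P|^2 - M |Y|^2)\<close>, a cross term with a factor \<psi>, and
  terms of size \<epsilon>. The second bound on \<delta> lets the damping absorb everything positive
  in \<open>|P|^2\<close>. The third keeps \<open>?F\<close> between E/2 and 3E/2, and this
  comparison produces the factors 2/3 and 2 in the rate.\<close>

lemma lyapunov_rate:
  fixes Y P Z :: complex
  assumes Z: "Z + of_real \<mu> * Y + 2 * of_real b * P + of_real (m + \<epsilon> * g) * Y = 0"
    and b: "0 \<le> b" "b \<le> B" "\<psi> > 0 \<longrightarrow> b0 \<le> b" and \<psi>: "0 \<le> \<psi>" "\<psi> \<le> 1"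
    and \<mu>: "\<mu> \<ge> 0" and m: "m > 0" and g: "\<bar>g\<bar> \<le> 1" and \<epsilon>: "\<epsilon> \<ge> 0" and L: "\<bar>\<psi>'\<bar> \<le> L"
    and \<delta>: "\<delta> > 0" "\<delta> * (3 + (2 * L + 2 * B)\<^sup>2 / m) \<le> 4 * b0" "\<delta> \<le> sqrt m / 2"
    and M: "M = \<mu> + m"
  shows "(2 / 3 * \<delta> * \<psi>\<^sup>2 - 2 * \<epsilon> * (1 / sqrt m + 2 * \<delta> / m)) * (P \<bullet> P + M * (Y \<bullet> Y) + 2 * \<delta> * \<psi>\<^sup>2 * (Y \<bullet> P))
     + (2 * (P \<bullet> Z) + 2 * M * (Y \<bullet> P) + 2 * \<delta> * (2 * \<psi> * \<psi>') * (Y \<bullet> P) + 2 * \<delta> * \<psi>\<^sup>2 * (P \<bullet> P + Y \<bullet> Z)) \<le> 0"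
    (is "?rate * ?F + ?D \<le> 0")
proof -
  define s where "s = Y \<bullet> P"
  define X where "X = norm Y"
  define Q where "Q = norm P"
  define E where "E = Q\<^sup>2 + M * X\<^sup>2"
  have Mm: "M \<ge> m" "M > 0" using M \<mu> m by auto
  have X0: "X \<ge> 0" "Q \<ge> 0" by (simp_all add: X_def Q_def)
  have s: "\<bar>s\<bar> \<le> X * Q" unfolding s_def X_def Q_def by (rule Cauchy_Schwarz_ineq2)
  have YY: "Y \<bullet> Y = X\<^sup>2" "P \<bullet> P = Q\<^sup>2" by (simp_all add: X_def Q_def dot_square_norm)
  have Zeq: "Z = - ((M + \<epsilon> * g) *\<^sub>R Y) - (2 * b) *\<^sub>R P"
    using Z unfolding M scaleR_conv_of_real by (simp add: algebra_simps eq_neg_iff_add_eq_0)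
  have PZ: "P \<bullet> Z = - (M + \<epsilon> * g) * s - 2 * b * Q\<^sup>2"
    unfolding Zeq s_def by (simp add: inner_diff_right inner_commute YY algebra_simps)
  have YZ: "Y \<bullet> Z = - (M + \<epsilon> * g) * X\<^sup>2 - 2 * b * s"
    unfolding Zeq s_def by (simp add: inner_diff_right YY algebra_simps)
  have D: "?D = - 4 * b * Q\<^sup>2 + 2 * \<delta> * \<psi>\<^sup>2 * Q\<^sup>2 - 2 * \<delta> * \<psi>\<^sup>2 * (M * X\<^sup>2)
      + 2 * \<delta> * \<psi> * ((2 * \<psi>' - 2 * \<psi> * b) * s) - 2 * \<epsilon> * (g * s) - 2 * \<delta> * \<epsilon> * (\<psi>\<^sup>2 * (g * X\<^sup>2))"
    unfolding PZ YZ YY s_def[symmetric] by (simp add: algebra_simps power2_eq_square)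
  have sm: "sqrt m > 0" "sqrt m * sqrt m = m" using m by simp_all
  have XQ: "2 * sqrt m * (X * Q) \<le> E"
  proof -
    have "0 \<le> (Q - sqrt m * X)\<^sup>2" by simp
    also have "\<dots> = Q\<^sup>2 + m * X\<^sup>2 - 2 * sqrt m * (X * Q)" using sm by (simp add: power2_eq_square algebra_simps)
    also have "m * X\<^sup>2 \<le> M * X\<^sup>2" using Mm by (intro mult_right_mono) auto
    finally show ?thesis by (simp add: E_def)
  qed
  have E0: "E \<ge> 0" using Mm by (simp add: E_def)
  have gs: "- (g * s) \<le> X * Q"
  proof -
    have "- (g * s) \<le> \<bar>g\<bar> * \<bar>s\<bar>" by (simp add: abs_mult[symmetric] abs_le_D2)
    also have "\<dots> \<le> 1 * (X * Q)" using g s by (intro mult_mono) auto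
    finally show ?thesis by simp
  qed
  have gX: "- (\<psi>\<^sup>2 * (g * X\<^sup>2)) \<le> X\<^sup>2"
  proof -
    have "- (\<psi>\<^sup>2 * (g * X\<^sup>2)) = \<psi>\<^sup>2 * ((- g) * X\<^sup>2)" by simp
    also have "\<dots> \<le> 1 * (1 * X\<^sup>2)"
    proof -
      have "\<psi>\<^sup>2 * ((- g) * X\<^sup>2) \<le> \<psi>\<^sup>2 * (1 * X\<^sup>2)"
        using g by (intro mult_left_mono mult_right_mono) auto
      also have "\<dots> \<le> 1 * (1 * X\<^sup>2)" using \<psi> by (intro mult_right_mono) (auto simp: power_le_one)
      finally show ?thesis .
    qed
    finally show ?thesis by simp
  qed
  \<comment> \<open>The two summands of the coefficient come from
    \<open>X * Q \<le> E / (2 * sqrt m)\<close> and \<open>X\<^sup>2 \<le> E / m\<close>; of the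
    perturbation only |g| \<le> 1 is used.\<close>
  have eps: "- 2 * \<epsilon> * (g * s) - 2 * \<delta> * \<epsilon> * (\<psi>\<^sup>2 * (g * X\<^sup>2)) \<le> \<epsilon> * (1 / sqrt m + 2 * \<delta> / m) * E"
  proof -
    have "sqrt m * - (g * s) \<le> sqrt m * (X * Q)" using gs sm by (intro mult_left_mono) auto
    then have "- 2 * (g * s) \<le> E / sqrt m" using XQ sm by (simp add: field_simps)
    moreover have "X\<^sup>2 \<le> E / m"
    proof -
      have "m * X\<^sup>2 \<le> M * X\<^sup>2" using Mm by (intro mult_right_mono) auto
      then show ?thesis using m by (simp add: E_def field_simps)
        (metis add_increasing zero_le_power2)
    qed
    then have "2 * \<delta> * - (\<psi>\<^sup>2 * (g * X\<^sup>2)) \<le> 2 * \<delta> * (E / m)"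
      using gX \<delta>(1) by (intro mult_left_mono) auto
    ultimately have "\<epsilon> * (- 2 * (g * s) + 2 * \<delta> * - (\<psi>\<^sup>2 * (g * X\<^sup>2))) \<le> \<epsilon> * (E / sqrt m + 2 * \<delta> * (E / m))"
      using \<epsilon> by (intro mult_left_mono) auto
    then show ?thesis by (simp add: algebra_simps)
  qed
  have main: "- 4 * b * Q\<^sup>2 + 2 * \<delta> * \<psi>\<^sup>2 * Q\<^sup>2 - 2 * \<delta> * \<psi>\<^sup>2 * (M * X\<^sup>2)
      + 2 * \<delta> * \<psi> * ((2 * \<psi>' - 2 * \<psi> * b) * s) \<le> - \<delta> * \<psi>\<^sup>2 * E"
  proof (cases "\<psi> = 0")
    case True
    then show ?thesis using b by simp
  next
    case False
    then have \<psi>0: "\<psi> > 0" using \<psi> by simp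
    \<comment> \<open>R bounds the coefficient \<open>2 * \<psi>' - 2 * \<psi> * b\<close> of the
      cross term: one part arises from differentiating \<open>\<psi>\<^sup>2\<close>, the other from
      the damping term inside \<open>Y \<bullet> Z\<close>.\<close>
    define R where "R = 2 * L + 2 * B"
    have LB: "L \<ge> 0" "B \<ge> 0" using L b by linarith+
    have "\<bar>2 * \<psi>' - 2 * \<psi> * b\<bar> \<le> R"
    proof -
      have "\<psi> * b \<le> 1 * B" using \<psi> b LB by (intro mult_mono) auto
      moreover have "\<psi> * b \<ge> 0" using \<psi> b by simp
      ultimately show ?thesis using L by (simp add: R_def abs_if split: if_splits)
    qed
    then have "\<bar>(2 * \<psi>' - 2 * \<psi> * b) * s\<bar> \<le> R * (X * Q)"
      unfolding abs_mult using s LB by (intro mult_mono) (auto simp: R_def)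
    then have c1: "2 * \<delta> * \<psi> * ((2 * \<psi>' - 2 * \<psi> * b) * s) \<le> 2 * \<delta> * \<psi> * (R * (X * Q))"
      using \<delta>(1) \<psi> by (intro mult_left_mono) auto
    have c2: "2 * \<psi> * (R * (X * Q)) \<le> \<psi>\<^sup>2 * (M * X\<^sup>2) + R\<^sup>2 / m * Q\<^sup>2"
    proof -
      have "0 \<le> (\<psi> * sqrt m * X - R / sqrt m * Q)\<^sup>2" by simp
      also have "\<dots> = \<psi>\<^sup>2 * (m * X\<^sup>2) + R\<^sup>2 / m * Q\<^sup>2 - 2 * \<psi> * (R * (X * Q))"
        using sm m by (simp add: power2_eq_square field_simps)
      also have "\<psi>\<^sup>2 * (m * X\<^sup>2) \<le> \<psi>\<^sup>2 * (M * X\<^sup>2)"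
        using Mm by (intro mult_left_mono mult_right_mono) auto
      finally show ?thesis by simp
    qed
    have c3: "\<delta> * (2 * \<psi> * (R * (X * Q))) \<le> \<delta> * (\<psi>\<^sup>2 * (M * X\<^sup>2) + R\<^sup>2 / m * Q\<^sup>2)"
      using c2 \<delta>(1) by (intro mult_left_mono) auto
    \<comment> \<open>The 3 is 2 from the corrector's positive part plus 1 from the target
      \<open>- \<delta> * \<psi>\<^sup>2 * E\<close>; the second term is the remainder of Young's
      inequality. Positivity of \<psi> is what makes b \<ge> b0 available.\<close>
    have "3 * \<delta> * \<psi>\<^sup>2 + \<delta> * R\<^sup>2 / m \<le> 4 * b"
    proof -
      have "\<delta> * \<psi>\<^sup>2 \<le> \<delta>" using \<delta>(1) \<psi> by (simp add: power_le_one)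
      moreover have "4 * b0 \<le> 4 * b" using b \<psi>0 by simp
      ultimately show ?thesis using \<delta>(2) unfolding R_def[symmetric] by (simp add: algebra_simps)
    qed
    then have "(3 * \<delta> * \<psi>\<^sup>2 + \<delta> * R\<^sup>2 / m) * Q\<^sup>2 \<le> 4 * b * Q\<^sup>2" by (intro mult_right_mono) auto
    then show ?thesis using c1 c3 by (simp add: E_def algebra_simps)
  qed
  have dE: "?D \<le> - \<delta> * \<psi>\<^sup>2 * E + \<epsilon> * (1 / sqrt m + 2 * \<delta> / m) * E"
    unfolding D using main eps by linarith
  have F: "?F = E + 2 * \<delta> * \<psi>\<^sup>2 * s" by (simp add: E_def YY s_def)
  have ds: "\<bar>2 * \<delta> * \<psi>\<^sup>2 * s\<bar> \<le> E / 2"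
  proof -
    have "\<bar>2 * \<delta> * \<psi>\<^sup>2 * s\<bar> = 2 * \<delta> * (\<psi>\<^sup>2 * \<bar>s\<bar>)" using \<delta>(1) by (simp add: abs_mult)
    also have "\<dots> \<le> 2 * (sqrt m / 2) * (1 * (X * Q))"
      using \<delta> s \<psi> sm by (intro mult_mono) (auto simp: power_le_one)
    also have "\<dots> \<le> E / 2" using XQ by simp
    finally show ?thesis .
  qed
  have "2 / 3 * \<delta> * \<psi>\<^sup>2 * ?F \<le> 2 / 3 * \<delta> * \<psi>\<^sup>2 * (3 / 2 * E)"
    unfolding F using ds \<delta>(1) by (intro mult_left_mono) (auto simp: abs_le_iff)
  moreover have "2 * (\<epsilon> * (1 / sqrt m + 2 * \<delta> / m)) * (E / 2) \<le> 2 * (\<epsilon> * (1 / sqrt m + 2 * \<delta> / m)) * ?F"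
    unfolding F using ds \<delta>(1) \<epsilon> m by (intro mult_left_mono) (auto simp: abs_le_iff)
  ultimately have "?rate * ?F \<le> \<delta> * \<psi>\<^sup>2 * E - \<epsilon> * (1 / sqrt m + 2 * \<delta> / m) * E"
    unfolding left_diff_distrib by (simp add: algebra_simps)
  with dE show ?thesis by linarith
qed

section \<open>Periodic functions: the cutoff and the growth of its integral\<close>

lemma periodic_add_int:
  fixes f :: "real \<Rightarrow> 'a"
  assumes "\<And>t. f (t + T) = f t"
  shows "f (t + of_int k * T) = f t"
proof -
  have nat: "f (t + of_nat j * T) = f t" for t j
  proof (induction j)
    case (Suc j)
    have "f (t + real (Suc j) * T) = f (t + real j * T + T)" by (simp add: algebra_simps)
    then show ?case using assms Suc by simp
  qed simp
  show ?thesis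
  proof (cases "k \<ge> 0")
    case True
    then show ?thesis using nat[of t "nat k"] by simp
  next
    case False
    then show ?thesis using nat[of "t + of_int k * T" "nat (- k)"] by simp
  qed
qed

text \<open>Rounding \<open>x / (2 * pi)\<close> moves x into [-pi, pi], where cos is even and
  decreases with the absolute value.\<close>

lemma cos_gt_imp_near_period:
  assumes "0 \<le> \<eta>" "\<eta> \<le> pi" "cos x > cos \<eta>"
  shows "\<exists>k::int. \<bar>x - of_int k * (2 * pi)\<bar> < \<eta>"
proof -
  define k where "k = round (x / (2 * pi))"
  define r where "r = x - of_int k * (2 * pi)"
  have "\<bar>of_int k - x / (2 * pi)\<bar> \<le> 1 / 2" unfolding k_def by (rule of_int_round_abs_le)
  then have "\<bar>of_int k - x / (2 * pi)\<bar> * (2 * pi) \<le> 1 / 2 * (2 * pi)" by (intro mult_right_mono) auto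
  then have "\<bar>(of_int k - x / (2 * pi)) * (2 * pi)\<bar> \<le> pi" by (simp add: abs_mult)
  then have r: "\<bar>r\<bar> \<le> pi" by (simp add: r_def algebra_simps abs_minus_commute)
  have "cos x = cos r"
    using periodic_add_int[of cos "2 * pi" x "- k"] by (simp add: r_def)
  then have "cos \<bar>r\<bar> > cos \<eta>" using assms by simp
  then have "\<bar>r\<bar> < \<eta>" using cos_mono_less_eq[of \<eta> "\<bar>r\<bar>"] r assms by auto
  then show ?thesis unfolding r_def by blast
qed

text \<open>\<psi> is the positive part of a lowered cosine centred at t0. It has corners, but the
  square of a positive part is C1; therefore only \<open>\<psi>\<^sup>2\<close> is differentiated.
  In the formula \<open>2 * \<psi> t * \<psi>' t\<close> the second function is the derivative of
  the cosine itself, which is harmless off the support because there \<psi> vanishes.\<close>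

lemma periodic_cutoff:
  assumes "T > 0" and b: "continuous_on UNIV b" "\<And>t. b (t + T) = b t" and "(b t0 :: real) > 0"
  obtains \<psi> \<psi>' L b0 :: _ where "b0 > 0" "\<And>t. 0 \<le> \<psi> t" "\<And>t. \<psi> t \<le> 1" "\<And>t. \<psi> (t + T) = \<psi> t" "continuous_on UNIV \<psi>"
    "\<psi> t0 > 0" "\<And>t. \<psi> t > 0 \<longrightarrow> b0 \<le> b t" "\<And>t. \<bar>\<psi>' t\<bar> \<le> L"
    "\<And>t. ((\<lambda>t. (\<psi> t)\<^sup>2) has_real_derivative 2 * \<psi> t * \<psi>' t) (at t)" "continuous_on UNIV (\<psi>' :: real \<Rightarrow> real)"
proof -
  define b0 where "b0 = b t0 / 2"
  have "isCont b t0" using b(1) by (simp add: continuous_on_eq_continuous_at)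
  then have "\<forall>\<^sub>F t in nhds t0. b t > b0"
    using \<open>b t0 > 0\<close> order_tendstoD(1)[of b "b t0" "nhds t0" b0] unfolding b0_def
    by (simp add: isCont_def tendsto_at_iff_tendsto_nhds)
  then obtain d where d: "d > 0" "\<And>t. dist t t0 < d \<Longrightarrow> b t > b0" unfolding eventually_nhds_metric by blast
  define w where "w = 2 * pi / T"
  have w: "w > 0" "w * T = 2 * pi" using \<open>T > 0\<close> by (simp_all add: w_def)
  \<comment> \<open>The bound \<open>pi / 2\<close> makes \<open>cos \<eta>\<close> nonnegative and
    hence \<psi> \<le> 1; the bound \<open>w * d\<close> confines the support to the translates of
    the d-neighbourhood of t0 by multiples of T.\<close>
  define \<eta> where "\<eta> = min (pi / 2) (w * d)"
  have \<eta>: "0 < \<eta>" "\<eta> \<le> pi / 2" "\<eta> \<le> w * d" using w d by (auto simp: \<eta>_def)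
  have c0: "cos \<eta> \<ge> 0" using \<eta> by (intro cos_ge_zero) auto
  have c1: "cos \<eta> < 1" using cos_monotone_0_pi[of 0 \<eta>] \<eta> by simp
  define \<psi> where "\<psi> = (\<lambda>t. max 0 (cos (w * (t - t0)) - cos \<eta>))"
  define \<psi>' where "\<psi>' = (\<lambda>t. - w * sin (w * (t - t0)))"
  have der: "((\<lambda>x::real. (max 0 x)\<^sup>2) has_real_derivative 2 * max 0 x) (at x)" for x
  proof (cases x "0::real" rule: linorder_cases)
    case less
    then have "((\<lambda>x. 0) has_real_derivative 2 * max 0 x) (at x)" by (auto intro!: derivative_eq_intros)
    then show ?thesis
      by (rule has_field_derivative_transform_within_open[of _ _ _ "{..<0}"]) (use less in auto)
  next
    case greater
    then have "((\<lambda>x. x\<^sup>2) has_real_derivative 2 * max 0 x) (at x)" by (auto intro!: derivative_eq_intros)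
    then show ?thesis
      by (rule has_field_derivative_transform_within_open[of _ _ _ "{0<..}"]) (use greater in auto)
  next
    case equal
    have "((\<lambda>h::real. (max 0 h)\<^sup>2 / h) \<longlongrightarrow> 0) (at 0)"
    proof (rule Lim_null_comparison)
      show "\<forall>\<^sub>F h in at (0::real). norm ((max 0 h)\<^sup>2 / h) \<le> \<bar>h\<bar>"
        by (intro always_eventually) (auto simp: max_def power2_eq_square)
      show "((\<lambda>h. \<bar>h\<bar>) \<longlongrightarrow> 0) (at (0::real))" by (auto intro!: tendsto_eq_intros)
    qed
    then show ?thesis unfolding equal DERIV_def by simp
  qed
  show thesis
  proof (rule that[of b0 \<psi> \<psi>' w])
    show "b0 > 0" using \<open>b t0 > 0\<close> by (simp add: b0_def)
    show "0 \<le> \<psi> t" for t by (simp add: \<psi>_def)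
    show "\<psi> t \<le> 1" for t
    proof -
      have "cos (w * (t - t0)) \<le> 1 + cos \<eta>" using cos_le_one[of "w * (t - t0)"] c0 by linarith
      then show ?thesis by (simp add: \<psi>_def)
    qed
    show "\<psi> (t + T) = \<psi> t" for t
    proof -
      have "w * (t + T - t0) = w * (t - t0) + 2 * pi" using w by (simp add: algebra_simps)
      then show ?thesis by (simp add: \<psi>_def)
    qed
    show "continuous_on UNIV \<psi>" unfolding \<psi>_def by (intro continuous_intros)
    show "continuous_on UNIV \<psi>'" unfolding \<psi>'_def by (intro continuous_intros)
    show "\<psi> t0 > 0" using c1 by (simp add: \<psi>_def)
    show "\<bar>\<psi>' t\<bar> \<le> w" for t
      using w mult_left_mono[OF abs_sin_le_one[of "w * (t - t0)"], of w] by (simp add: \<psi>'_def abs_mult)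
    show "\<psi> t > 0 \<longrightarrow> b0 \<le> b t" for t
    proof
      assume "\<psi> t > 0"
      then have "cos (w * (t - t0)) > cos \<eta>" by (simp add: \<psi>_def max_def split: if_splits)
      then obtain k :: int where "\<bar>w * (t - t0) - of_int k * (2 * pi)\<bar> < \<eta>"
        using cos_gt_imp_near_period[of \<eta> "w * (t - t0)"] \<eta> pi_gt_zero by fastforce
      then have "\<bar>w * (t - t0 - of_int k * T)\<bar> < w * d" 
        using \<eta>(3) w(2) by (simp add: right_diff_distrib mult.left_commute[of w])
      then have "\<bar>t - t0 - of_int k * T\<bar> < d" using w by (simp add: abs_mult)
      then have "dist (t + of_int (- k) * T) t0 < d" by (simp add: dist_real_def algebra_simps)
      then show "b0 \<le> b t" using d(2) periodic_add_int[of b T t "- k", OF b(2)] by fastforce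
    qed
    show "((\<lambda>t. (\<psi> t)\<^sup>2) has_real_derivative 2 * \<psi> t * \<psi>' t) (at t)" for t
      unfolding \<psi>_def \<psi>'_def
      by (rule DERIV_chain2[OF der, THEN DERIV_cong]) (auto intro!: derivative_eq_intros)
  qed
qed

lemma int_multiple_shift_into_period:
  assumes "T > 0"
  obtains k :: int where "t - of_int k * T \<in> {0..T :: real}"
proof -
  define k where "k = \<lfloor>t / T\<rfloor>"
  have "of_int k \<le> t / T" "t / T \<le> of_int k + 1"
    unfolding k_def by (rule of_int_floor_le real_of_int_floor_add_one_ge)+
  then show thesis using assms by (intro that[of k]) (simp add: field_simps)
qed

lemma periodic_bounded:
  fixes b :: "real \<Rightarrow> real"
  assumes "T > 0" "continuous_on UNIV b" and per: "\<And>t. b (t + T) = b t"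
  obtains B where "\<And>t. \<bar>b t\<bar> \<le> B"
proof -
  have "bounded (b ` {0..T})"
    by (intro compact_imp_bounded compact_continuous_image continuous_on_subset[OF assms(2)]) auto
  then obtain B where "\<forall>x\<in>b ` {0..T}. norm x \<le> B" unfolding bounded_iff by blast
  then have B: "\<bar>b t\<bar> \<le> B" if "t \<in> {0..T}" for t using that by auto
  have "\<bar>b t\<bar> \<le> B" for t
  proof -
    obtain k :: int where "t - of_int k * T \<in> {0..T}"
      by (rule int_multiple_shift_into_period[OF \<open>T > 0\<close>])
    then show ?thesis using B[of "t - of_int k * T"] periodic_add_int[of b T t "- k", OF per] by simp
  qed
  then show thesis by (rule that)
qed

text \<open>Every full period contributes the same amount \<open>c0\<close>, and rounding t down to
  whole periods loses at most one of them, so that \<open>c0\<close> also serves as the offset. It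
  is positive because a continuous nonnegative function with zero integral over a period vanishes on
  it.\<close>

lemma periodic_integral_growth:
  fixes f :: "real \<Rightarrow> real"
  assumes "T > 0" and f: "continuous_on UNIV f" "\<And>t. f (t + T) = f t" "\<And>t. f t \<ge> 0" and "f t0 > 0"
  obtains I c C where "c > 0" "\<And>t. t \<ge> 0 \<Longrightarrow> (I has_real_derivative f t) (at t within {0..})"
    "I 0 = 0" "\<And>t. t \<ge> 0 \<Longrightarrow> I t \<ge> c * t - C"
proof -
  define I where "I = (\<lambda>t. integral {0..t} f)"
  have fc: "continuous_on A f" for A using f(1) continuous_on_subset by blast
  have int: "f integrable_on {x..y}" for x y by (intro integrable_continuous_interval fc)
  have I': "(I has_real_derivative f t) (at t within {0..})" if "t \<ge> 0" for t
  proof -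
    have "(I has_real_derivative f t) (at t within {0..t + 1})"
      unfolding I_def has_real_derivative_iff_has_vector_derivative
      by (rule integral_has_vector_derivative[OF fc]) (use that in auto)
    moreover have "at t within {0..t + 1} = at t within {0..}"
      by (rule at_within_nhd[of _ "{..<t + 1}"]) auto
    ultimately show ?thesis by simp
  qed
  define c0 where "c0 = integral {0..T} f"
  have shift: "I (t + T) = I t + c0" if "t \<ge> 0" for t
  proof -
    have "I (t + T) = integral {0..T} f + integral {T..t + T} f"
      unfolding I_def using that \<open>T > 0\<close> int by (intro Henstock_Kurzweil_Integration.integral_combine[symmetric]) auto
    also have "integral {T..t + T} f = integral {0..t} (\<lambda>x. f (x + T))"
      using integral_shift[where a = 0 and b = t and c = T and f = f] fc unfolding o_def by simp
    finally show ?thesis using f(2) by (simp add: I_def c0_def)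
  qed
  have mono: "I s \<le> I t" if "0 \<le> s" "s \<le> t" for s t
    unfolding I_def using that f(3) int by (intro integral_subset_le) auto
  have "c0 > 0"
  proof -
    obtain k :: int where m: "t0 - of_int k * T \<in> {0..T}"
      by (rule int_multiple_shift_into_period[OF \<open>T > 0\<close>])
    have "f (t0 - of_int k * T) > 0" using periodic_add_int[of f T t0 "- k", OF f(2)] \<open>f t0 > 0\<close> by simp
    moreover have "c0 \<ge> 0" unfolding c0_def by (intro integral_nonneg int) (use f in auto)
    moreover have "c0 \<noteq> 0"
      unfolding c0_def using integral_eq_0_iff[of 0 T f, OF fc \<open>T > 0\<close>] f(3) m calculation(1) by force
    ultimately show ?thesis by simp
  qed
  have nat: "I (real k * T) = real k * c0" for k
  proof (induction k)
    case (Suc k)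
    have "I (real (Suc k) * T) = I (real k * T + T)" by (simp add: algebra_simps)
    then show ?case using shift[of "real k * T"] Suc \<open>T > 0\<close> by (simp add: algebra_simps)
  qed (simp add: I_def)
  have low: "I t \<ge> (c0 / T) * t - c0" if "t \<ge> 0" for t
  proof -
    define k where "k = nat \<lfloor>t / T\<rfloor>"
    have k: "real k \<le> t / T" "t / T - 1 \<le> real k" unfolding k_def using that \<open>T > 0\<close> real_of_int_floor_add_one_ge[of "t / T"] by (simp_all add: of_nat_floor)
    have "(c0 / T) * t - c0 = (t / T - 1) * c0" by (simp add: algebra_simps)
    also have "\<dots> \<le> real k * c0" using k \<open>c0 > 0\<close> by (intro mult_right_mono) auto
    also have "\<dots> = I (real k * T)" by (simp add: nat)
    also have "\<dots> \<le> I t" using k \<open>T > 0\<close> by (intro mono) (auto simp: field_simps)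
    finally show ?thesis .
  qed
  show thesis
    by (rule that[of "c0 / T" I c0]) (use \<open>c0 > 0\<close> \<open>T > 0\<close> I' low in \<open>auto simp: I_def\<close>)
qed

text \<open>The rate exponent \<open>2 / 3 * \<delta> * I t - 2 * \<epsilon> * \<kappa> * t\<close>
  grows linearly once \<epsilon> is small, since I grows at the mean rate c. The energy is stated
  with the weight \<open>1 + \<mu>\<close> of the Sobolev norms instead of
  \<open>\<mu> + m0\<^sup>2\<close>. All constants are fixed before the frequency and the
  solution.\<close>

theorem uniform_exponential_decay:
  fixes T m0 :: real and b m1 :: "real \<Rightarrow> real"
  assumes T: "T > 0" and b: "continuous_on UNIV b" "\<And>t. b t \<ge> 0" "\<And>t. b (t + T) = b t" "b t0 \<noteq> 0"
    and "m0 \<noteq> 0" and m1: "\<And>t. \<bar>m1 t\<bar> \<le> 1"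
  obtains \<epsilon> \<sigma> C :: real where "\<epsilon> > 0" "\<sigma> > 0" "C > 0" "\<And>t. m0\<^sup>2 + \<epsilon> * m1 t > 0"
    "\<forall>\<mu> y p t. \<mu> \<ge> 0 \<longrightarrow> (\<forall>t\<ge>0. (y has_vector_derivative p t) (at t within {0..})) \<longrightarrow>
       (\<forall>c>0. abs_continuous_on 0 c p) \<longrightarrow>
       (AE t in lebesgue. 0 < t \<longrightarrow> (\<exists>z. (p has_vector_derivative z) (at t) \<and>
         z + of_real \<mu> * y t + 2 * of_real (b t) * p t + of_real (m0\<^sup>2 + \<epsilon> * m1 t) * y t = 0)) \<longrightarrow> t \<ge> 0 \<longrightarrow>
      (1 + \<mu>) * (norm (y t))\<^sup>2 + (norm (p t))\<^sup>2 \<le> C * exp (- 2 * \<sigma> * t) * ((1 + \<mu>) * (norm (y 0))\<^sup>2 + (norm (p 0))\<^sup>2)"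
proof -
  define m where "m = m0\<^sup>2"
  have m: "m > 0" using \<open>m0 \<noteq> 0\<close> by (simp add: m_def)
  obtain B where B: "\<And>t. \<bar>b t\<bar> \<le> B" using periodic_bounded[OF T b(1,3)] by blast
  have bt0: "b t0 > 0" using b(2)[of t0] b(4) by simp
  obtain \<psi> \<psi>' L b0 where b0: "b0 > 0" and \<psi>: "\<And>t. 0 \<le> \<psi> t" "\<And>t. \<psi> t \<le> 1" "\<And>t. \<psi> (t + T) = \<psi> t"
    "continuous_on UNIV \<psi>" "\<psi> t0 > 0" "\<And>t. \<psi> t > 0 \<longrightarrow> b0 \<le> b t" "\<And>t. \<bar>\<psi>' t\<bar> \<le> (L::real)"
    "\<And>t. ((\<lambda>t. (\<psi> t)\<^sup>2) has_real_derivative 2 * \<psi> t * \<psi>' t) (at t)" "continuous_on UNIV \<psi>'"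
    by (rule periodic_cutoff[OF T b(1,3) bt0]) (rule that)
  obtain I c C0 where I: "c > 0" "\<And>t. t \<ge> 0 \<Longrightarrow> (I has_real_derivative (\<psi> t)\<^sup>2) (at t within {0..})"
    "I 0 = 0" "\<And>t. t \<ge> 0 \<Longrightarrow> I t \<ge> c * t - C0"
    by (rule periodic_integral_growth[OF T, of "\<lambda>t. (\<psi> t)\<^sup>2" t0]) (use \<psi> in \<open>auto intro!: continuous_intros\<close>)
  define K where "K = 3 + (2 * L + 2 * B)\<^sup>2 / m"
  have K: "K > 0" using m by (simp add: K_def add_pos_nonneg)
  \<comment> \<open>Both bounds are those required by \<open>lyapunov_rate\<close>. Neither involves
    \<epsilon>, which can therefore be chosen afterwards.\<close>
  define \<delta> where "\<delta> = min (4 * b0 / K) (sqrt m / 2)"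
  have \<delta>: "\<delta> > 0" "\<delta> * K \<le> 4 * b0" "\<delta> \<le> sqrt m / 2"
  proof -
    show "\<delta> > 0" using b0 K m by (simp add: \<delta>_def)
    have "\<delta> \<le> 4 * b0 / K" by (simp add: \<delta>_def)
    then show "\<delta> * K \<le> 4 * b0" using K by (simp add: field_simps)
  qed (simp add: \<delta>_def)
  define \<kappa> where "\<kappa> = 1 / sqrt m + 2 * \<delta> / m"
  have \<kappa>: "\<kappa> > 0" using m \<delta> by (simp add: \<kappa>_def add_pos_pos)
  \<comment> \<open>The bound \<open>m / 2\<close> keeps the mass positive. The other one lets the
    perturbation consume at most half of the mean gain \<open>2 / 3 * \<delta> * c\<close>; what
    remains, \<open>\<delta> * c / 3\<close>, is \<open>2 * \<sigma>\<close>.\<close>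
  define \<epsilon> where "\<epsilon> = min (m / 2) (\<delta> * c / (6 * \<kappa>))"
  have \<epsilon>: "\<epsilon> > 0" "\<epsilon> \<le> m / 2" "2 * \<epsilon> * \<kappa> \<le> \<delta> * c / 3"
  proof -
    show "\<epsilon> > 0" using m \<delta> I \<kappa> by (simp add: \<epsilon>_def)
    have "\<epsilon> \<le> \<delta> * c / (6 * \<kappa>)" by (simp add: \<epsilon>_def)
    then show "2 * \<epsilon> * \<kappa> \<le> \<delta> * c / 3" using \<kappa> by (simp add: field_simps)
  qed (simp add: \<epsilon>_def)
  define \<sigma> where "\<sigma> = \<delta> * c / 6"
  have \<sigma>: "\<sigma> > 0" using \<delta> I by (simp add: \<sigma>_def)
  \<comment> \<open>A is the loss in exchanging the weights \<open>\<mu> + m\<close> and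
    \<open>1 + \<mu>\<close> at both times. In C, the 3 is the ratio of the constants 3/2 and 1/2
    comparing F with E, and the exponential pays for the offset \<open>C0\<close>.\<close>
  define A where "A = max 1 m / min 1 m"
  define C where "C = 3 * exp (2 / 3 * \<delta> * C0) * A"
  have C: "C > 0" using m by (simp add: C_def A_def)
  show thesis
  proof (rule that[of \<epsilon> \<sigma> C])
    show "m0\<^sup>2 + \<epsilon> * m1 t > 0" for t
    proof -
      have "\<epsilon> * - m1 t \<le> \<epsilon> * 1" using m1[of t] \<epsilon> by (intro mult_left_mono) auto
      then show ?thesis using \<epsilon> m by (simp add: m_def)
    qed
  next
    have "(1 + \<mu>) * (norm (y t))\<^sup>2 + (norm (p t))\<^sup>2 \<le> C * exp (- 2 * \<sigma> * t) * ((1 + \<mu>) * (norm (y 0))\<^sup>2 + (norm (p 0))\<^sup>2)"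
      if \<mu>: "\<mu> \<ge> 0" and y: "\<And>t. t \<ge> 0 \<Longrightarrow> (y has_vector_derivative p t) (at t within {0..})"
      and ac: "\<And>c. c > 0 \<Longrightarrow> abs_continuous_on 0 c p"
      and ode: "AE t in lebesgue. 0 < t \<longrightarrow> (\<exists>z. (p has_vector_derivative z) (at t) \<and>
         z + of_real \<mu> * y t + 2 * of_real (b t) * p t + of_real (m0\<^sup>2 + \<epsilon> * m1 t) * y t = 0)" and t: "t \<ge> 0"
      for \<mu> t :: real and y p :: "real \<Rightarrow> complex"
    proof -
      define M where "M = \<mu> + m"
      have Mm: "M \<ge> m" "M > 0" using \<mu> m by (auto simp: M_def)
      define \<Phi> where "\<Phi> = (\<lambda>t. 2 / 3 * \<delta> * I t - 2 * \<epsilon> * \<kappa> * t)"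
      define F where "F = (\<lambda>t. p t \<bullet> p t + M * (y t \<bullet> y t) + 2 * \<delta> * (\<psi> t)\<^sup>2 * (y t \<bullet> p t))"
      define E where "E = (\<lambda>t. (norm (p t))\<^sup>2 + M * (norm (y t))\<^sup>2)"
      have FE: "E t / 2 \<le> F t" "F t \<le> 3 / 2 * E t" for t
      proof -
        have "\<bar>2 * \<delta> * (\<psi> t)\<^sup>2 * (y t \<bullet> p t)\<bar> = 2 * \<delta> * ((\<psi> t)\<^sup>2 * \<bar>y t \<bullet> p t\<bar>)"
          using \<delta> by (simp add: abs_mult)
        also have "\<dots> \<le> 2 * (sqrt m / 2) * (1 * (norm (y t) * norm (p t)))"
          using \<delta> \<psi> m Cauchy_Schwarz_ineq2[of "y t" "p t"] by (intro mult_mono) (auto simp: power_le_one)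
        also have "\<dots> \<le> E t / 2"
        proof -
          have "0 \<le> (norm (p t) - sqrt m * norm (y t))\<^sup>2" by simp
          also have "\<dots> = (norm (p t))\<^sup>2 + m * (norm (y t))\<^sup>2 - 2 * sqrt m * (norm (y t) * norm (p t))"
            using m by (simp add: power2_diff power_mult_distrib mult.commute mult.left_commute)
          also have "m * (norm (y t))\<^sup>2 \<le> M * (norm (y t))\<^sup>2" using Mm by (intro mult_right_mono) auto
          finally show ?thesis by (simp add: E_def)
        qed
        finally have "\<bar>2 * \<delta> * (\<psi> t)\<^sup>2 * (y t \<bullet> p t)\<bar> \<le> E t / 2" .
        moreover have "F t = E t + 2 * \<delta> * (\<psi> t)\<^sup>2 * (y t \<bullet> p t)" by (simp add: F_def E_def dot_square_norm)
        ultimately show "E t / 2 \<le> F t" "F t \<le> 3 / 2 * E t" by (auto simp: abs_le_iff)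
      qed
      have dec: "exp (\<Phi> t) * F t \<le> exp (\<Phi> 0) * F 0"
        unfolding F_def
      proof (rule lyapunov_nonincreasing[OF y ac ode, where \<theta>' = "\<lambda>t. 2 * \<delta> * (2 * \<psi> t * \<psi>' t)"
            and \<rho> = "\<lambda>t. 2 / 3 * \<delta> * (\<psi> t)\<^sup>2 - 2 * \<epsilon> * \<kappa>"])
        show "((\<lambda>t. 2 * \<delta> * (\<psi> t)\<^sup>2) has_real_derivative 2 * \<delta> * (2 * \<psi> t * \<psi>' t)) (at t)" for t
          by (rule DERIV_cmult[OF \<psi>(8)])
        show "continuous_on UNIV (\<lambda>t. 2 * \<delta> * (2 * \<psi> t * \<psi>' t))" by (intro continuous_intros \<psi>)
        show "continuous_on {0..} (\<lambda>t. 2 / 3 * \<delta> * (\<psi> t)\<^sup>2 - 2 * \<epsilon> * \<kappa>)"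
          by (intro continuous_intros continuous_on_subset[OF \<psi>(4)]) auto
        show "(\<Phi> has_real_derivative 2 / 3 * \<delta> * (\<psi> t)\<^sup>2 - 2 * \<epsilon> * \<kappa>) (at t within {0..})" if "t \<ge> 0" for t
          unfolding \<Phi>_def by (rule DERIV_diff[OF DERIV_cmult[OF I(2)[OF that]] DERIV_cmult_Id])
        fix t :: real and Y P Z :: complex
        assume "Z + of_real \<mu> * Y + 2 * of_real (b t) * P + of_real (m0\<^sup>2 + \<epsilon> * m1 t) * Y = 0"
        from lyapunov_rate[OF this, of B "\<psi> t" b0 "\<psi>' t" L \<delta> M]
        show "(2 / 3 * \<delta> * (\<psi> t)\<^sup>2 - 2 * \<epsilon> * \<kappa>) * (P \<bullet> P + M * (Y \<bullet> Y) + 2 * \<delta> * (\<psi> t)\<^sup>2 * (Y \<bullet> P))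
           + (2 * (P \<bullet> Z) + 2 * M * (Y \<bullet> P) + 2 * \<delta> * (2 * \<psi> t * \<psi>' t) * (Y \<bullet> P) + 2 * \<delta> * (\<psi> t)\<^sup>2 * (P \<bullet> P + Y \<bullet> Z)) \<le> 0"
          using b(2)[of t] B[of t] \<psi> \<mu> m m1[of t] \<epsilon> \<delta> M_def K_def unfolding \<kappa>_def m_def by force
      qed (use t in auto)
      have "\<Phi> t \<ge> 2 * \<sigma> * t - 2 / 3 * \<delta> * C0"
      proof -
        have "2 / 3 * \<delta> * I t \<ge> 2 / 3 * \<delta> * (c * t - C0)"
          using I(4)[OF t] \<delta> by (intro mult_left_mono) auto
        moreover have "2 * \<epsilon> * \<kappa> * t \<le> \<delta> * c / 3 * t" using \<epsilon> t by (intro mult_right_mono) auto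
        ultimately show ?thesis by (simp add: \<Phi>_def \<sigma>_def algebra_simps)
      qed
      then have "exp (2 * \<sigma> * t - 2 / 3 * \<delta> * C0) * (E t / 2) \<le> exp (\<Phi> t) * F t"
        using FE(1)[of t] Mm by (intro mult_mono) (auto simp: E_def)
      also have "\<dots> \<le> 3 / 2 * E 0" using dec FE(2)[of 0] I(3) by (simp add: \<Phi>_def)
      finally have "exp (2 * \<sigma> * t - 2 / 3 * \<delta> * C0) * E t \<le> 3 * E 0" by simp
      then have "E t \<le> exp (- (2 * \<sigma> * t - 2 / 3 * \<delta> * C0)) * (3 * E 0)"
        by (simp add: exp_minus field_simps)
      also have "exp (- (2 * \<sigma> * t - 2 / 3 * \<delta> * C0)) = exp (2 / 3 * \<delta> * C0) * exp (- 2 * \<sigma> * t)"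
        by (simp flip: exp_add)
      finally have E: "E t \<le> 3 * exp (2 / 3 * \<delta> * C0) * exp (- 2 * \<sigma> * t) * E 0"
        by (simp add: mult_ac)
      have M1: "min 1 m * (1 + \<mu>) \<le> M" "M \<le> max 1 m * (1 + \<mu>)"
      proof -
        have "min 1 m * \<mu> \<le> 1 * \<mu>" "1 * \<mu> \<le> max 1 m * \<mu>" using \<mu> by (intro mult_right_mono; simp)+
        then show "min 1 m * (1 + \<mu>) \<le> M" "M \<le> max 1 m * (1 + \<mu>)"
          unfolding M_def distrib_left by linarith+
      qed
      define H where "H = (\<lambda>t. (1 + \<mu>) * (norm (y t))\<^sup>2 + (norm (p t))\<^sup>2)"
      have H1: "min 1 m * H t \<le> E t" for t
      proof -
        have "min 1 m * (1 + \<mu>) * (norm (y t))\<^sup>2 \<le> M * (norm (y t))\<^sup>2" using M1 by (intro mult_right_mono) auto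
        moreover have "min 1 m * (norm (p t))\<^sup>2 \<le> 1 * (norm (p t))\<^sup>2" by (intro mult_right_mono) auto
        moreover have "min 1 m * H t = min 1 m * (1 + \<mu>) * (norm (y t))\<^sup>2 + min 1 m * (norm (p t))\<^sup>2"
          by (simp add: H_def algebra_simps)
        ultimately show ?thesis unfolding E_def by linarith
      qed
      have H2: "E t \<le> max 1 m * H t" for t
      proof -
        have "M * (norm (y t))\<^sup>2 \<le> max 1 m * (1 + \<mu>) * (norm (y t))\<^sup>2" using M1 by (intro mult_right_mono) auto
        moreover have "1 * (norm (p t))\<^sup>2 \<le> max 1 m * (norm (p t))\<^sup>2" by (intro mult_right_mono) auto
        moreover have "max 1 m * H t = max 1 m * (1 + \<mu>) * (norm (y t))\<^sup>2 + max 1 m * (norm (p t))\<^sup>2"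
          by (simp add: H_def algebra_simps)
        ultimately show ?thesis unfolding E_def by linarith
      qed
      have "3 * exp (2 / 3 * \<delta> * C0) * exp (- 2 * \<sigma> * t) * E 0
          \<le> 3 * exp (2 / 3 * \<delta> * C0) * exp (- 2 * \<sigma> * t) * (max 1 m * H 0)"
        by (intro mult_left_mono H2) simp
      then have "min 1 m * H t \<le> 3 * exp (2 / 3 * \<delta> * C0) * exp (- 2 * \<sigma> * t) * (max 1 m * H 0)"
        using H1[of t] E by linarith
      then have "H t \<le> C * exp (- 2 * \<sigma> * t) * H 0"
        using m by (simp add: C_def A_def field_simps)
      then show ?thesis by (simp add: H_def)
    qed
    then show "\<forall>\<mu> y p t. \<mu> \<ge> 0 \<longrightarrow> (\<forall>t\<ge>0. (y has_vector_derivative p t) (at t within {0..})) \<longrightarrow>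
       (\<forall>c>0. abs_continuous_on 0 c p) \<longrightarrow>
       (AE t in lebesgue. 0 < t \<longrightarrow> (\<exists>z. (p has_vector_derivative z) (at t) \<and>
         z + of_real \<mu> * y t + 2 * of_real (b t) * p t + of_real (m0\<^sup>2 + \<epsilon> * m1 t) * y t = 0)) \<longrightarrow> t \<ge> 0 \<longrightarrow>
      (1 + \<mu>) * (norm (y t))\<^sup>2 + (norm (p t))\<^sup>2 \<le> C * exp (- 2 * \<sigma> * t) * ((1 + \<mu>) * (norm (y 0))\<^sup>2 + (norm (p 0))\<^sup>2)"
      by (intro allI impI) simp
  qed (fact \<epsilon>(1) \<sigma> C)+
qed

section \<open>Schwartz functions\<close>

text \<open>Dominated convergence for the remainder quotients along sequences; the mean value
  inequality on the convex set bounds them by \<open>2 * g x\<close>. Derivatives relative to S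
  allow the one-sided time derivative at 0.\<close>

lemma has_vector_derivative_integral:
  fixes f :: "real \<Rightarrow> 'a \<Rightarrow> 'b::{banach, second_countable_topology}"
  assumes S: "convex S" "t \<in> S"
    and int: "\<And>s. s \<in> S \<Longrightarrow> integrable M (f s)"
    and der: "\<And>s x. \<lbrakk>s \<in> S; x \<in> space M\<rbrakk> \<Longrightarrow> ((\<lambda>s. f s x) has_vector_derivative f' s x) (at s within S)"
    and bd: "\<And>s x. \<lbrakk>s \<in> S; x \<in> space M\<rbrakk> \<Longrightarrow> norm (f' s x) \<le> g x" and g: "integrable M g"
    and meas: "f' t \<in> borel_measurable M"
  shows "((\<lambda>s. LINT x|M. f s x) has_vector_derivative (LINT x|M. f' t x)) (at t within S)"
proof -
  have int': "integrable M (f' t)"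
    by (rule Bochner_Integration.integrable_bound[OF g meas]) (use bd S in \<open>fastforce intro: order_trans[OF _ abs_ge_self]\<close>)
  define Q where "Q = (\<lambda>s x. (1 / norm (s - t)) *\<^sub>R (f s x - (f t x + (s - t) *\<^sub>R f' t x)))"
  have Qint: "integrable M (Q s)" if "s \<in> S" for s
    unfolding Q_def using int int' S that by auto
  have Q: "(LINT x|M. Q s x) = (1 / norm (s - t)) *\<^sub>R ((LINT x|M. f s x) - ((LINT x|M. f t x) + (s - t) *\<^sub>R (LINT x|M. f' t x)))"
    if "s \<in> S" for s
    unfolding Q_def using int int' S that by simp
  have lim: "((\<lambda>s. LINT x|M. Q s x) \<longlongrightarrow> 0) (at t within S)"
    unfolding tendsto_at_iff_sequentially
  proof (intro allI impI)
    fix X :: "nat \<Rightarrow> real" assume X: "\<forall>i. X i \<in> S - {t}" "X \<longlonglongrightarrow> t"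
    have "(\<lambda>i. LINT x|M. Q (X i) x) \<longlonglongrightarrow> (LINT x|M. 0)"
    proof (rule integral_dominated_convergence[where w = "\<lambda>x. 2 * g x"])
      show "AE x in M. norm (Q (X i) x) \<le> 2 * g x" for i
      proof (rule AE_I2)
        fix x assume x: "x \<in> space M"
        have Xi: "X i \<in> S" "X i \<noteq> t" using X by auto
        have "norm (f (X i) x - f t x) \<le> g x * \<bar>X i - t\<bar>"
          by (rule norm_diff_le_of_derivative_bound[OF S(1), of "\<lambda>s. f s x"]) (use der bd x Xi S in auto)
        moreover have "norm ((X i - t) *\<^sub>R f' t x) \<le> g x * \<bar>X i - t\<bar>"
          using mult_right_mono[OF bd[OF S(2) x], of "\<bar>X i - t\<bar>"] by (simp add: mult.commute)
        ultimately have "norm (f (X i) x - (f t x + (X i - t) *\<^sub>R f' t x)) \<le> 2 * g x * \<bar>X i - t\<bar>"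
          using norm_triangle_ineq4[of "f (X i) x - f t x" "(X i - t) *\<^sub>R f' t x"] by (simp add: algebra_simps)
        then show "norm (Q (X i) x) \<le> 2 * g x" using Xi by (simp add: Q_def divide_le_eq)
      qed
      show "AE x in M. (\<lambda>i. Q (X i) x) \<longlonglongrightarrow> 0"
      proof (rule AE_I2)
        fix x assume x: "x \<in> space M"
        have "((\<lambda>s. Q s x) \<longlongrightarrow> 0) (at t within S)"
          using der[OF S(2) x] unfolding has_vector_derivative_def has_derivative_within Q_def by simp
        then have "((\<lambda>s. Q s x) \<circ> X) \<longlonglongrightarrow> 0" unfolding tendsto_at_iff_sequentially using X by blast
        then show "(\<lambda>i. Q (X i) x) \<longlonglongrightarrow> 0" by (simp add: o_def)
      qed
      show "integrable M (\<lambda>x. 2 * g x)" using g by simp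
      show "Q (X i) \<in> borel_measurable M" for i
        using borel_measurable_integrable[OF Qint] X by auto
    qed auto
    then show "((\<lambda>s. LINT x|M. Q s x) \<circ> X) \<longlonglongrightarrow> 0" by (simp add: o_def)
  qed
  have "((\<lambda>s. (1 / norm (s - t)) *\<^sub>R ((LINT x|M. f s x) - ((LINT x|M. f t x) + (s - t) *\<^sub>R (LINT x|M. f' t x)))) \<longlongrightarrow> 0) (at t within S)"
  proof (rule Lim_transform_eventually[OF lim])
    show "\<forall>\<^sub>F s in at t within S. (LINT x|M. Q s x) = (1 / norm (s - t)) *\<^sub>R ((LINT x|M. f s x) - ((LINT x|M. f t x) + (s - t) *\<^sub>R (LINT x|M. f' t x)))"
      unfolding eventually_at_filter using Q by auto
  qed
  then show ?thesis
    unfolding has_vector_derivative_def has_derivative_within by (simp add: bounded_linear_scaleR_left)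
qed

section \<open>Lebesgue measure on extensional vectors\<close>

interpretation lborel_product: product_sigma_finite "\<lambda>_::nat. lborel :: real measure" ..

interpretation lebn: sigma_finite_measure "lebn n" for n
  unfolding lebn_def by (rule lborel_product.sigma_finite) simp

interpretation lebn_pair: pair_sigma_finite "lebn n" "lebn n" for n ..

lemma space_lebn: "space (lebn n) = extensional {..<n}"
  by (auto simp: lebn_def space_PiM PiE_def)

lemma upd_in_space_lebn [simp]: "x \<in> space (lebn n) \<Longrightarrow> i < n \<Longrightarrow> x(i := s) \<in> space (lebn n)"
  by (auto simp: space_lebn extensional_def)

lemma measurable_component_lebn [measurable]: "i < n \<Longrightarrow> (\<lambda>x. x i) \<in> borel_measurable (lebn n)"
  unfolding lebn_def using measurable_component_singleton[of i "{..<n}" "\<lambda>_. lborel"] by simp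

lemma euclid_norm_measurable [measurable]: "euclid_norm n \<in> borel_measurable (lebn n)"
  unfolding euclid_norm_def[abs_def] L2_set_def by measurable

lemma dot_measurable [measurable]: "(\<lambda>x. dot n x \<xi>) \<in> borel_measurable (lebn n)"
  unfolding dot_def by measurable

lemma dot_measurable_pair [measurable]: "(\<lambda>(x, y). dot n x y) \<in> borel_measurable (lebn n \<Otimes>\<^sub>M lebn n)"
  unfolding dot_def case_prod_beta
  by (intro borel_measurable_sum borel_measurable_times measurable_compose[OF measurable_fst measurable_component_lebn]
      measurable_compose[OF measurable_snd measurable_component_lebn]) auto

lemma dot_commute: "dot n x y = dot n y x" by (simp add: dot_def mult.commute)

lemma euclid_norm_nonneg [simp]: "0 \<le> euclid_norm n x"
  by (simp add: euclid_norm_def)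

lemma power2_euclid_norm: "(euclid_norm n x)\<^sup>2 = (\<Sum>i<n. (x i)\<^sup>2)"
  by (simp add: euclid_norm_def L2_set_def sum_nonneg)

lemma abs_component_le_euclid_norm: "i < n \<Longrightarrow> \<bar>x i\<bar> \<le> euclid_norm n x"
  unfolding euclid_norm_def L2_set_def
  using member_le_sum[of i "{..<n}" "\<lambda>i. (x i)\<^sup>2"] by (intro real_le_rsqrt) auto

lemma euclid_norm_le_sum_abs: "euclid_norm n x \<le> (\<Sum>i<n. \<bar>x i\<bar>)"
  unfolding euclid_norm_def by (rule L2_set_le_sum_abs)

lemma one_plus_sum_le_prod:
  fixes a :: "nat \<Rightarrow> real"
  assumes "\<And>i. a i \<ge> 0"
  shows "1 + (\<Sum>i<n. a i) \<le> (\<Prod>i<n. 1 + a i)"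
proof (induction n)
  case (Suc n)
  have "1 \<le> (\<Prod>i<n. 1 + a i)" using assms by (intro prod_ge_1) auto
  then have "a n \<le> (\<Prod>i<n. 1 + a i) * a n" using assms[of n] by (simp add: mult_le_cancel_right1)
  then show ?case using Suc by (simp add: algebra_simps)
qed simp

text \<open>The exponent \<open>2 * n\<close> permits comparison with an integrable product of
  functions of one variable: each of the n factors \<open>1 + (x i)\<^sup>2\<close> is at most the
  square of \<open>1 + euclid_norm n x\<close>.\<close>

lemma integrable_inverse_one_plus_euclid_norm: "integrable (lebn n) (\<lambda>x. 1 / (1 + euclid_norm n x) ^ (2 * n))"
proof (rule Bochner_Integration.integrable_bound)
  have "integrable lborel (\<lambda>x::real. inverse (1 + x\<^sup>2))"
    using integrable_inverse_1_plus_square by (simp add: set_integrable_def)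
  then show "integrable (lebn n) (\<lambda>x. \<Prod>i<n. inverse (1 + (x i)\<^sup>2))"
    unfolding lebn_def by (intro lborel_product.product_integrable_prod) auto
  show "AE x in lebn n. norm (1 / (1 + euclid_norm n x) ^ (2 * n)) \<le> norm (\<Prod>i<n. inverse (1 + (x i)\<^sup>2))"
  proof (rule AE_I2)
    fix x
    have "(\<Prod>i<n. 1 + (x i)\<^sup>2) \<le> (\<Prod>i<n. (1 + euclid_norm n x)\<^sup>2)"
    proof (rule prod_mono)
      fix i assume "i \<in> {..<n}"
      then have "\<bar>x i\<bar>\<^sup>2 \<le> (euclid_norm n x)\<^sup>2" using abs_component_le_euclid_norm[of i n x] by (intro power_mono) auto
      then show "0 \<le> 1 + (x i)\<^sup>2 \<and> 1 + (x i)\<^sup>2 \<le> (1 + euclid_norm n x)\<^sup>2"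
        using add_increasing2[of "2 * euclid_norm n x" "(x i)\<^sup>2" "(euclid_norm n x)\<^sup>2"] by (simp add: power2_sum)
    qed
    also have "\<dots> = (1 + euclid_norm n x) ^ (2 * n)" by (simp add: power_mult)
    finally have *: "(\<Prod>i<n. 1 + (x i)\<^sup>2) \<le> (1 + euclid_norm n x) ^ (2 * n)" .
    have "0 < (\<Prod>i<n. 1 + (x i)\<^sup>2)" by (intro prod_pos) (auto simp: add_pos_nonneg)
    then have "inverse ((1 + euclid_norm n x) ^ (2 * n)) \<le> inverse (\<Prod>i<n. 1 + (x i)\<^sup>2)"
      using * by (intro le_imp_inverse_le) auto
    then show "norm (1 / (1 + euclid_norm n x) ^ (2 * n)) \<le> norm (\<Prod>i<n. inverse (1 + (x i)\<^sup>2))"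
      using \<open>0 < _\<close> prod_inversef[of "\<lambda>i. 1 + (x i)\<^sup>2" "{..<n}"]
      by (simp add: inverse_eq_divide o_def)
  qed
qed measurable

section \<open>Closure properties of the Schwartz space\<close>

lemma partials_Nil [simp]: "partials [] f = f"
  and partials_Cons: "partials (j # js) f = partial j (partials js f)"
  and partials_snoc: "partials (js @ [j]) f = partials js (partial j f)"
  by (simp_all add: partials_def)

text \<open>The Schwartz space is the largest set of rapidly decaying functions closed under partial
  derivatives, so membership amounts to finding an invariant set S. Agreement on
  \<open>space (lebn n)\<close> is enough, because the lines along which \<open>partial\<close>
  differentiates stay inside it.\<close>

lemma schwartz_coinduct [consumes 1, case_names derivative decay]:
  assumes "f \<in> S"
    and der: "\<And>f i. \<lbrakk>f \<in> S; i < n\<rbrakk> \<Longrightarrow> \<exists>g\<in>S. \<forall>x\<in>space (lebn n). ((\<lambda>s. f (x(i := s))) has_vector_derivative g x) (at (x i))"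
    and decay: "\<And>f k. f \<in> S \<Longrightarrow> \<exists>B. \<forall>x\<in>space (lebn n). (1 + euclid_norm n x) ^ k * norm (f x) \<le> B"
  shows "f \<in> schwartz n"
proof -
  have *: "\<exists>g\<in>S. \<forall>x\<in>space (lebn n). partials js f x = g x" if "set js \<subseteq> {..<n}" for js
    using that
  proof (induction js)
    case Nil
    then show ?case using \<open>f \<in> S\<close> by auto
  next
    case (Cons j js)
    then obtain g where g: "g \<in> S" "\<forall>x\<in>space (lebn n). partials js f x = g x" by auto
    have j: "j < n" using Cons.prems by simp
    obtain h where h: "h \<in> S" "\<forall>x\<in>space (lebn n). ((\<lambda>s. g (x(j := s))) has_vector_derivative h x) (at (x j))"
      using der[OF g(1) j] by blast
    have "partials (j # js) f x = h x" if x: "x \<in> space (lebn n)" for x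
    proof -
      have "(\<lambda>s. partials js f (x(j := s))) = (\<lambda>s. g (x(j := s)))" using g(2) x j by auto
      then show ?thesis using h(2) x by (simp add: partials_Cons partial_def vector_derivative_at)
    qed
    then show ?case using h(1) by blast
  qed
  show ?thesis unfolding schwartz_def
  proof (intro CollectI allI impI conjI ballI)
    fix js :: "nat list" and x i assume js: "set js \<subseteq> {..<n}" and x: "x \<in> space (lebn n)" and i: "i < n"
    obtain g where g: "g \<in> S" "\<forall>x\<in>space (lebn n). partials js f x = g x" using *[OF js] by blast
    have "(\<lambda>s. partials js f (x(i := s))) = (\<lambda>s. g (x(i := s)))" using g(2) x i by auto
    then show "(\<lambda>s. partials js f (x(i := s))) differentiable (at (x i))"
      using der[OF g(1) i] x by (metis differentiableI_vector)
  next
    fix js :: "nat list" and k assume js: "set js \<subseteq> {..<n}"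
    obtain g where g: "g \<in> S" "\<forall>x\<in>space (lebn n). partials js f x = g x" using *[OF js] by blast
    then show "\<exists>B. \<forall>x\<in>space (lebn n). (1 + euclid_norm n x) ^ k * norm (partials js f x) \<le> B"
      using decay[OF g(1), of k] by auto
  qed
qed

lemma schwartz_decay:
  assumes "\<phi> \<in> schwartz n"
  obtains B where "\<And>x. x \<in> space (lebn n) \<Longrightarrow> (1 + euclid_norm n x) ^ k * norm (\<phi> x) \<le> B"
proof -
  have "\<exists>B. \<forall>x\<in>space (lebn n). (1 + euclid_norm n x) ^ k * norm (partials [] \<phi> x) \<le> B"
    using assms by (simp only: schwartz_def mem_Collect_eq) (metis empty_set empty_subsetI)
  then show thesis using that by auto
qed

lemma schwartz_partial:
  assumes "\<phi> \<in> schwartz n" "i < n"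
  shows "partial i \<phi> \<in> schwartz n"
proof -
  have "set (js @ [i]) \<subseteq> {..<n}" if "set js \<subseteq> {..<n}" for js using that assms(2) by auto
  then show ?thesis using assms(1) unfolding schwartz_def mem_Collect_eq partials_snoc[symmetric] by blast
qed

lemma schwartz_has_partial:
  assumes "\<phi> \<in> schwartz n" "i < n" "x \<in> space (lebn n)"
  shows "((\<lambda>s. \<phi> (x(i := s))) has_vector_derivative partial i \<phi> (x(i := t))) (at t)"
proof -
  have x': "x(i := t) \<in> space (lebn n)" using assms by simp
  have "(\<lambda>s. partials [] \<phi> ((x(i := t))(i := s))) differentiable (at ((x(i := t)) i))"
    using assms x' unfolding schwartz_def mem_Collect_eq by (metis empty_set empty_subsetI)
  then have d: "(\<lambda>s. \<phi> (x(i := s))) differentiable (at t)" by simp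
  have "partial i \<phi> (x(i := t)) = vector_derivative (\<lambda>s. \<phi> (x(i := s))) (at t)"
    by (simp add: partial_def)
  then show ?thesis using d by (simp add: vector_derivative_works)
qed

lemma schwartz_has_partial_at:
  assumes "\<phi> \<in> schwartz n" "i < n" "x \<in> space (lebn n)"
  shows "((\<lambda>s. \<phi> (x(i := s))) has_vector_derivative partial i \<phi> x) (at (x i))"
  using schwartz_has_partial[OF assms, of "x i"] by simp

lemma schwartz_cong:
  assumes "\<phi> \<in> schwartz n" "\<And>x. x \<in> space (lebn n) \<Longrightarrow> \<psi> x = \<phi> x"
  shows "\<psi> \<in> schwartz n"
proof -
  have "\<psi> \<in> {\<psi>. \<exists>\<phi>\<in>schwartz n. \<forall>x\<in>space (lebn n). \<psi> x = \<phi> x}" using assms by blast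
  then show ?thesis
  proof (coinduct rule: schwartz_coinduct)
    case (derivative f i)
    then obtain \<phi> where \<phi>: "\<phi> \<in> schwartz n" "\<forall>x\<in>space (lebn n). f x = \<phi> x" by blast
    have "((\<lambda>s. f (x(i := s))) has_vector_derivative partial i \<phi> x) (at (x i))" if "x \<in> space (lebn n)" for x
    proof -
      have "(\<lambda>s. f (x(i := s))) = (\<lambda>s. \<phi> (x(i := s)))" using \<phi>(2) that derivative by auto
      then show ?thesis using schwartz_has_partial_at[OF \<phi>(1) derivative(2) that] by simp
    qed
    then show ?case using schwartz_partial[OF \<phi>(1) derivative(2)] by blast
  next
    case (decay f k)
    then obtain \<phi> where \<phi>: "\<phi> \<in> schwartz n" "\<forall>x\<in>space (lebn n). f x = \<phi> x" by blast
    then show ?case using schwartz_decay[OF \<phi>(1), of k] by metis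
  qed
qed

lemma schwartz_add:
  assumes "\<phi> \<in> schwartz n" "\<psi> \<in> schwartz n"
  shows "(\<lambda>x. \<phi> x + \<psi> x) \<in> schwartz n"
proof -
  have "(\<lambda>x. \<phi> x + \<psi> x) \<in> {\<lambda>x. \<phi> x + \<psi> x | \<phi> \<psi>. \<phi> \<in> schwartz n \<and> \<psi> \<in> schwartz n}" using assms by blast
  then show ?thesis
  proof (coinduct rule: schwartz_coinduct)
    case (derivative f i)
    then obtain \<phi> \<psi> where f: "f = (\<lambda>x. \<phi> x + \<psi> x)" and S: "\<phi> \<in> schwartz n" "\<psi> \<in> schwartz n" by blast
    show ?case unfolding f using S derivative(2)
      by (intro bexI[of _ "\<lambda>x. partial i \<phi> x + partial i \<psi> x"] ballI has_vector_derivative_add schwartz_has_partial_at)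
         (auto intro: schwartz_partial)
  next
    case (decay f k)
    then obtain \<phi> \<psi> where f: "f = (\<lambda>x. \<phi> x + \<psi> x)" and S: "\<phi> \<in> schwartz n" "\<psi> \<in> schwartz n" by blast
    obtain B where B: "\<And>x. x \<in> space (lebn n) \<Longrightarrow> (1 + euclid_norm n x) ^ k * norm (\<phi> x) \<le> B"
      using schwartz_decay[OF S(1)] by blast
    obtain B' where B': "\<And>x. x \<in> space (lebn n) \<Longrightarrow> (1 + euclid_norm n x) ^ k * norm (\<psi> x) \<le> B'"
      using schwartz_decay[OF S(2)] by blast
    have "(1 + euclid_norm n x) ^ k * norm (f x) \<le> B + B'" if "x \<in> space (lebn n)" for x
    proof -
      have "(1 + euclid_norm n x) ^ k * norm (f x) \<le> (1 + euclid_norm n x) ^ k * (norm (\<phi> x) + norm (\<psi> x))"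
        unfolding f by (intro mult_left_mono norm_triangle_ineq) auto
      then show ?thesis using B[OF that] B'[OF that] by (simp add: distrib_left)
    qed
    then show ?case by blast
  qed
qed

lemma schwartz_bounded_linear:
  assumes "bounded_linear (h :: complex \<Rightarrow> complex)" "\<phi> \<in> schwartz n"
  shows "(\<lambda>x. h (\<phi> x)) \<in> schwartz n"
proof -
  interpret bounded_linear h by fact
  have "(\<lambda>x. h (\<phi> x)) \<in> {\<lambda>x. h (\<phi> x) | \<phi>. \<phi> \<in> schwartz n}" using assms by blast
  then show ?thesis
  proof (coinduct rule: schwartz_coinduct)
    case (derivative f i)
    then obtain \<phi> where f: "f = (\<lambda>x. h (\<phi> x))" and S: "\<phi> \<in> schwartz n" by blast
    have "((\<lambda>s. f (x(i := s))) has_vector_derivative h (partial i \<phi> x)) (at (x i))" if "x \<in> space (lebn n)" for x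
      unfolding f by (rule has_vector_derivative[OF schwartz_has_partial_at[OF S derivative(2) that]])
    then show ?case
      using schwartz_partial[OF S derivative(2)] by (intro bexI[of _ "\<lambda>x. h (partial i \<phi> x)"]) auto
  next
    case (decay f k)
    then obtain \<phi> where f: "f = (\<lambda>x. h (\<phi> x))" and S: "\<phi> \<in> schwartz n" by blast
    obtain B where B: "\<And>x. x \<in> space (lebn n) \<Longrightarrow> (1 + euclid_norm n x) ^ k * norm (\<phi> x) \<le> B"
      using schwartz_decay[OF S] by blast
    obtain K where K: "K \<ge> 0" "\<And>x. norm (h x) \<le> norm x * K" using nonneg_bounded by blast
    have "(1 + euclid_norm n x) ^ k * norm (f x) \<le> B * K" if "x \<in> space (lebn n)" for x
    proof -
      have "(1 + euclid_norm n x) ^ k * norm (f x) \<le> (1 + euclid_norm n x) ^ k * (norm (\<phi> x) * K)"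
        unfolding f by (intro mult_left_mono K) auto
      also have "\<dots> = (1 + euclid_norm n x) ^ k * norm (\<phi> x) * K" by simp
      also have "\<dots> \<le> B * K" using B[OF that] K by (intro mult_right_mono) auto
      finally show ?thesis .
    qed
    then show ?case by blast
  qed
qed

lemmas schwartz_cmult = schwartz_bounded_linear[OF bounded_linear_mult_right]
lemmas schwartz_cnj = schwartz_bounded_linear[OF bounded_linear_cnj]

text \<open>Multiples by \<open>x j\<close> alone are not closed under differentiation, since the
  product rule leaves an undifferentiated \<phi>. The invariant set therefore consists of sums of
  such a multiple and a Schwartz function. The factor \<open>x j\<close> costs one power of
  decay.\<close>

lemma schwartz_mult_component:
  assumes "\<phi> \<in> schwartz n" "j < n"
  shows "(\<lambda>x. of_real (x j) * \<phi> x) \<in> schwartz n"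
proof -
  have z: "(\<lambda>x. 0 * \<phi> x) \<in> schwartz n" by (rule schwartz_cmult[OF assms(1)])
  have "(\<lambda>x. of_real (x j) * \<phi> x) = (\<lambda>x. of_real (x j) * \<phi> x + 0 * \<phi> x)" by simp
  then have "(\<lambda>x. of_real (x j) * \<phi> x) \<in> {\<lambda>x. of_real (x j) * \<phi> x + \<psi> x | \<phi> \<psi>. \<phi> \<in> schwartz n \<and> \<psi> \<in> schwartz n}"
    using assms(1) z by (intro CollectI exI[of _ \<phi>] exI[of _ "\<lambda>x. 0 * \<phi> x"]) auto
  then show ?thesis
  proof (coinduct rule: schwartz_coinduct)
    case (derivative f i)
    then obtain \<phi> \<psi> where f: "f = (\<lambda>x. of_real (x j) * \<phi> x + \<psi> x)" and S: "\<phi> \<in> schwartz n" "\<psi> \<in> schwartz n" by blast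
    let ?\<chi> = "\<lambda>x. (if i = j then 1 else 0) * \<phi> x + partial i \<psi> x"
    have "?\<chi> \<in> schwartz n"
      by (intro schwartz_add schwartz_cmult schwartz_partial S derivative)
    moreover have "((\<lambda>s. f (x(i := s))) has_vector_derivative of_real (x j) * partial i \<phi> x + ?\<chi> x) (at (x i))"
      if x: "x \<in> space (lebn n)" for x
    proof -
      have 1: "((\<lambda>s. complex_of_real ((x(i := s)) j)) has_vector_derivative (if i = j then 1 else 0)) (at (x i))"
        by (auto intro!: derivative_eq_intros)
      have "((\<lambda>s. f (x(i := s))) has_vector_derivative
          ((of_real ((x(i := x i)) j) * partial i \<phi> x + (if i = j then 1 else 0) * \<phi> (x(i := x i))) + partial i \<psi> x)) (at (x i))"
        unfolding f
        by (intro has_vector_derivative_add bounded_bilinear.has_vector_derivative[OF bounded_bilinear_mult] 1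
            schwartz_has_partial_at[OF S(1)] schwartz_has_partial_at[OF S(2)] derivative x)
      then show ?thesis by (simp add: add.assoc)
    qed
    ultimately show ?case
      using schwartz_partial[OF S(1) derivative(2)]
      by (intro bexI[of _ "\<lambda>x. of_real (x j) * partial i \<phi> x + ?\<chi> x"] ballI CollectI
          exI[of _ "partial i \<phi>"] exI[of _ ?\<chi>]) auto
  next
    case (decay f k)
    then obtain \<phi> \<psi> where f: "f = (\<lambda>x. of_real (x j) * \<phi> x + \<psi> x)" and S: "\<phi> \<in> schwartz n" "\<psi> \<in> schwartz n" by blast
    obtain B where B: "\<And>x. x \<in> space (lebn n) \<Longrightarrow> (1 + euclid_norm n x) ^ Suc k * norm (\<phi> x) \<le> B"
      using schwartz_decay[OF S(1)] by blast
    obtain B' where B': "\<And>x. x \<in> space (lebn n) \<Longrightarrow> (1 + euclid_norm n x) ^ k * norm (\<psi> x) \<le> B'"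
      using schwartz_decay[OF S(2)] by blast
    have "(1 + euclid_norm n x) ^ k * norm (f x) \<le> B + B'" if "x \<in> space (lebn n)" for x
    proof -
      have "norm (f x) \<le> \<bar>x j\<bar> * norm (\<phi> x) + norm (\<psi> x)"
        unfolding f by (metis norm_triangle_ineq norm_mult norm_of_real)
      also have "\<dots> \<le> (1 + euclid_norm n x) * norm (\<phi> x) + norm (\<psi> x)"
        using abs_component_le_euclid_norm[OF assms(2), of x] by (intro add_mono mult_right_mono) auto
      finally have "(1 + euclid_norm n x) ^ k * norm (f x) \<le> (1 + euclid_norm n x) ^ k * ((1 + euclid_norm n x) * norm (\<phi> x) + norm (\<psi> x))"
        by (intro mult_left_mono) auto
      then show ?thesis using B[OF that] B'[OF that] by (simp add: distrib_left[of "(1 + euclid_norm n x) ^ k"] mult_ac)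
    qed
    then show ?case by blast
  qed
qed

text \<open>The coordinates are changed one at a time; every step is controlled by a bounded partial
  derivative. This quantitative continuity serves both measurability and the convergence of
  mollified functions.\<close>

lemma schwartz_lipschitz:
  assumes "\<phi> \<in> schwartz n"
  obtains B where "B \<ge> 0" "\<And>x y. \<lbrakk>x \<in> space (lebn n); y \<in> space (lebn n)\<rbrakk> \<Longrightarrow> norm (\<phi> x - \<phi> y) \<le> B * (\<Sum>i<n. \<bar>x i - y i\<bar>)"
proof -
  have "\<exists>B. \<forall>x\<in>space (lebn n). norm (partial i \<phi> x) \<le> B" if "i < n" for i
    by (rule schwartz_decay[OF schwartz_partial[OF assms that], of 0]) auto
  then obtain C where C: "\<And>i x. i < n \<Longrightarrow> x \<in> space (lebn n) \<Longrightarrow> norm (partial i \<phi> x) \<le> C i" by metis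
  define B where "B = (\<Sum>i<n. \<bar>C i\<bar>)"
  have B: "B \<ge> 0" by (simp add: B_def sum_nonneg)
  have CB: "C i \<le> B" if "i < n" for i
    using member_le_sum[of i "{..<n}" "\<lambda>i. \<bar>C i\<bar>"] that by (auto simp: B_def)
  have *: "norm (\<phi> x - \<phi> y) \<le> B * (\<Sum>i<n. \<bar>x i - y i\<bar>)" if x: "x \<in> space (lebn n)" and y: "y \<in> space (lebn n)" for x y
  proof -
    define z where "z = (\<lambda>m i. if i < m then x i else y i)"
    have z: "z m \<in> space (lebn n)" for m using x y by (auto simp: z_def space_lebn extensional_def)
    have step: "norm (\<phi> (z (Suc m)) - \<phi> (z m)) \<le> B * \<bar>x m - y m\<bar>" if "m < n" for m
    proof -
      have "norm (\<phi> ((z m)(m := x m)) - \<phi> ((z m)(m := y m))) \<le> B * \<bar>x m - y m\<bar>"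
      proof (rule norm_diff_le_of_derivative_bound[of UNIV "\<lambda>s. \<phi> ((z m)(m := s))" "\<lambda>s. partial m \<phi> ((z m)(m := s))"])
        show "norm (partial m \<phi> ((z m)(m := s))) \<le> B" for s
          using C[OF that, of "(z m)(m := s)"] CB[OF that] z that by simp
      qed (use schwartz_has_partial[OF assms that z] in auto)
      moreover have "(z m)(m := x m) = z (Suc m)" "(z m)(m := y m) = z m" by (auto simp: z_def less_Suc_eq)
      ultimately show ?thesis by simp
    qed
    have "norm (\<phi> (z m) - \<phi> (z 0)) \<le> B * (\<Sum>i<m. \<bar>x i - y i\<bar>)" if "m \<le> n" for m
      using that
    proof (induction m)
      case (Suc m)
      have "norm (\<phi> (z (Suc m)) - \<phi> (z 0)) \<le> norm (\<phi> (z (Suc m)) - \<phi> (z m)) + norm (\<phi> (z m) - \<phi> (z 0))"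
        using norm_triangle_ineq[of "\<phi> (z (Suc m)) - \<phi> (z m)" "\<phi> (z m) - \<phi> (z 0)"] by simp
      then show ?case using Suc step[of m] by (simp add: algebra_simps)
    qed simp
    moreover have "z n = x" "z 0 = y" using x y by (auto simp: z_def space_lebn extensional_def)
    ultimately show ?thesis by force
  qed
  show thesis by (rule that[OF B *])
qed

text \<open>Points of \<open>space (lebn n)\<close> are extensional, whereas continuity is available
  on the product of all coordinate lines. Composition with \<open>restrict\<close> gives a
  continuous function there, and padding with zeros maps \<open>lebn n\<close> measurably into that
  product.\<close>

lemma schwartz_measurable [measurable_dest]:
  assumes "\<phi> \<in> schwartz n"
  shows "\<phi> \<in> borel_measurable (lebn n)"
proof -
  obtain B where B: "B \<ge> 0" "\<And>x y. \<lbrakk>x \<in> space (lebn n); y \<in> space (lebn n)\<rbrakk> \<Longrightarrow> norm (\<phi> x - \<phi> y) \<le> B * (\<Sum>i<n. \<bar>x i - y i\<bar>)"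
    by (rule schwartz_lipschitz[OF assms]) (rule that)
  define \<psi> where "\<psi> = (\<lambda>x. \<phi> (restrict x {..<n}))"
  have "continuous_on UNIV \<psi>"
    unfolding continuous_on_def
  proof (intro ballI)
    fix x :: vec
    have "((\<lambda>y. \<psi> y - \<psi> x) \<longlongrightarrow> 0) (at x)"
    proof (rule Lim_null_comparison)
      show "\<forall>\<^sub>F y in at x. norm (\<psi> y - \<psi> x) \<le> B * (\<Sum>i<n. \<bar>y i - x i\<bar>)"
      proof (intro always_eventually allI)
        fix y :: vec
        have "norm (\<psi> y - \<psi> x) \<le> B * (\<Sum>i<n. \<bar>restrict y {..<n} i - restrict x {..<n} i\<bar>)"
          unfolding \<psi>_def by (rule B(2)) (auto simp: space_lebn)
        then show "norm (\<psi> y - \<psi> x) \<le> B * (\<Sum>i<n. \<bar>y i - x i\<bar>)" by simp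
      qed
      have "((\<lambda>y. y i) \<longlongrightarrow> x i) (at x)" for i
        using continuous_on_product_coordinates[of i] by (auto simp: continuous_on_def)
      then have "((\<lambda>y. B * (\<Sum>i<n. \<bar>y i - x i\<bar>)) \<longlongrightarrow> B * (\<Sum>i<n. \<bar>x i - x i\<bar>)) (at x)"
        by (intro tendsto_intros)
      then show "((\<lambda>y. B * (\<Sum>i<n. \<bar>y i - x i\<bar>)) \<longlongrightarrow> 0) (at x)" by simp
    qed
    then show "(\<psi> \<longlongrightarrow> \<psi> x) (at x within UNIV)" by (simp add: LIM_zero_iff)
  qed
  then have "\<psi> \<in> borel_measurable borel" by (rule borel_measurable_continuous_onI)
  then have 1: "\<psi> \<in> borel_measurable (Pi\<^sub>M UNIV (\<lambda>_::nat. borel :: real measure))"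
    by (simp add: measurable_cong_sets[OF sets_PiM_equal_borel])
  have 2: "(\<lambda>x i. if i < n then x i else 0) \<in> measurable (lebn n) (Pi\<^sub>M UNIV (\<lambda>_::nat. borel :: real measure))"
  proof (rule measurable_PiM_single')
    show "(\<lambda>x. if i < n then x i else 0) \<in> borel_measurable (lebn n)" for i
      by (cases "i < n") simp_all
  qed auto
  have "(\<lambda>x. \<psi> (\<lambda>i. if i < n then x i else 0)) \<in> borel_measurable (lebn n)"
    using measurable_compose[OF 2 1] .
  then show ?thesis
  proof (rule measurable_cong[THEN iffD1, rotated])
    fix x assume "x \<in> space (lebn n)"
    then have "restrict (\<lambda>i. if i < n then x i else 0) {..<n} = x" by (auto simp: space_lebn extensional_def)
    then show "\<psi> (\<lambda>i. if i < n then x i else 0) = \<phi> x" by (simp add: \<psi>_def)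
  qed
qed

lemma schwartz_integrable:
  assumes "\<phi> \<in> schwartz n"
  shows "integrable (lebn n) \<phi>"
proof -
  obtain B where B: "\<And>x. x \<in> space (lebn n) \<Longrightarrow> (1 + euclid_norm n x) ^ (2 * n) * norm (\<phi> x) \<le> B"
    using schwartz_decay[OF assms] by blast
  show ?thesis
  proof (rule Bochner_Integration.integrable_bound)
    show "integrable (lebn n) (\<lambda>x. B * (1 / (1 + euclid_norm n x) ^ (2 * n)))"
      by (intro integrable_mult_right integrable_inverse_one_plus_euclid_norm)
    show "AE x in lebn n. norm (\<phi> x) \<le> norm (B * (1 / (1 + euclid_norm n x) ^ (2 * n)))"
    proof (rule AE_I2)
      fix x assume "x \<in> space (lebn n)"
      moreover have "(1 + euclid_norm n x) ^ (2 * n) > 0" by (intro zero_less_power) (simp add: add_pos_nonneg)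
      ultimately have "norm (\<phi> x) \<le> B * (1 / (1 + euclid_norm n x) ^ (2 * n))"
        using B[of x] by (simp add: field_simps)
      then show "norm (\<phi> x) \<le> norm (B * (1 / (1 + euclid_norm n x) ^ (2 * n)))"
        unfolding real_norm_def by (rule order_trans[OF _ abs_ge_self])
    qed
  qed (use assms in measurable)
qed

lemma schwartz_square_integrable:
  assumes "\<phi> \<in> schwartz n"
  shows "square_integrable n \<phi>"
proof -
  obtain B where B: "\<And>x. x \<in> space (lebn n) \<Longrightarrow> norm (\<phi> x) \<le> B"
    by (rule schwartz_decay[OF assms, of 0]) auto
  have "integrable (lebn n) (\<lambda>x. (norm (\<phi> x))\<^sup>2)"
  proof (rule Bochner_Integration.integrable_bound)
    show "integrable (lebn n) (\<lambda>x. B * norm (\<phi> x))"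
      by (intro integrable_mult_right integrable_norm schwartz_integrable assms)
    show "AE x in lebn n. norm ((norm (\<phi> x))\<^sup>2) \<le> norm (B * norm (\<phi> x))"
    proof (rule AE_I2)
      fix x assume "x \<in> space (lebn n)"
      then have "norm (\<phi> x) * norm (\<phi> x) \<le> B * norm (\<phi> x)" using B by (intro mult_right_mono) auto
      then show "norm ((norm (\<phi> x))\<^sup>2) \<le> norm (B * norm (\<phi> x))" by (simp add: power2_eq_square abs_le_iff)
    qed
  qed (use assms in measurable)
  then show ?thesis using assms by (simp add: square_integrable_def schwartz_measurable)
qed

section \<open>The Fourier transform on Schwartz functions\<close>

text \<open>Conjugating the input and the output reverses the sign of the phase; in this form the
  properties of \<open>fourier\<close> carry over directly.\<close>

definition inverse_fourier :: "nat \<Rightarrow> (vec \<Rightarrow> complex) \<Rightarrow> vec \<Rightarrow> complex" where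
  "inverse_fourier n f \<xi> = cnj (fourier n (\<lambda>x. cnj (f x)) \<xi>)"

lemma dot_upd: "i < n \<Longrightarrow> dot n x (\<xi>(i := s)) = dot n x \<xi> + x i * (s - \<xi> i)"
  unfolding dot_def
  by (subst (1 2) sum.remove[of _ i]) (auto simp: algebra_simps intro!: sum.cong)

lemma cis_dot_measurable [measurable]: "(\<lambda>x. cis (- dot n x \<xi>)) \<in> borel_measurable (lebn n)"
  by (rule measurable_compose[of "\<lambda>x. - dot n x \<xi>" _ borel cis])
    (auto intro!: borel_measurable_continuous_onI continuous_intros)

lemma fourier_kernel_integrable:
  assumes "integrable (lebn n) f"
  shows "integrable (lebn n) (\<lambda>x. cis (- dot n x \<xi>) * f x)"
proof (rule Bochner_Integration.integrable_bound[OF assms])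
  have [measurable]: "f \<in> borel_measurable (lebn n)" using assms by simp
  show "(\<lambda>x. cis (- dot n x \<xi>) * f x) \<in> borel_measurable (lebn n)" by measurable
qed (simp add: norm_mult)

lemma norm_fourier_le:
  assumes "integrable (lebn n) f"
  shows "norm (fourier n f \<xi>) \<le> (2 * pi) powr (- real n / 2) * (LINT x|lebn n. norm (f x))"
proof -
  have "norm (LINT x|lebn n. cis (- dot n x \<xi>) * f x) \<le> (LINT x|lebn n. norm (cis (- dot n x \<xi>) * f x))"
    by (rule integral_norm_bound)
  then have "norm (LINT x|lebn n. cis (- dot n x \<xi>) * f x) \<le> (LINT x|lebn n. norm (f x))"
    by (simp add: norm_mult)
  then show ?thesis by (simp add: fourier_def norm_mult mult_left_mono)
qed

lemma fourier_measurable [measurable]: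
  assumes [measurable]: "f \<in> borel_measurable (lebn n)"
  shows "fourier n f \<in> borel_measurable (lebn n)"
proof -
  have [measurable]: "(\<lambda>(\<xi>, x). cis (- dot n x \<xi>)) \<in> borel_measurable (lebn n \<Otimes>\<^sub>M lebn n)"
    unfolding case_prod_beta
    by (rule measurable_compose[of "\<lambda>z. - dot n (snd z) (fst z)" _ borel cis])
      (use dot_measurable_pair[of n] in \<open>auto intro!: borel_measurable_continuous_onI continuous_intros
        simp: case_prod_beta dot_commute[of n "snd _"]\<close>)
  have "(\<lambda>\<xi>. LINT x|lebn n. cis (- dot n x \<xi>) * f x) \<in> borel_measurable (lebn n)"
    by measurable
  then show ?thesis unfolding fourier_def[abs_def] by measurable
qed

lemma fourier_cong:
  assumes "\<And>x. x \<in> space (lebn n) \<Longrightarrow> f x = g x"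
  shows "fourier n f \<xi> = fourier n g \<xi>"
  unfolding fourier_def using assms by (simp cong: Bochner_Integration.integral_cong)

lemma fourier_diff:
  assumes "integrable (lebn n) f" "integrable (lebn n) g"
  shows "fourier n (\<lambda>x. f x - g x) \<xi> = fourier n f \<xi> - fourier n g \<xi>"
  unfolding fourier_def using assms[THEN fourier_kernel_integrable]
  by (simp add: right_diff_distrib)

text \<open>Differentiation under the integral. The dominating function
  \<open>|x i| |\<phi> x|\<close> is integrable because multiplication by a coordinate stays in the
  Schwartz space.\<close>

lemma fourier_has_partial:
  assumes \<phi>: "\<phi> \<in> schwartz n" and "i < n"
  shows "((\<lambda>s. fourier n \<phi> (\<xi>(i := s))) has_vector_derivative
           fourier n (\<lambda>x. - \<i> * (of_real (x i) * \<phi> x)) \<xi>) (at (\<xi> i))"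
proof -
  note \<phi>i = schwartz_mult_component[OF assms]
  have [measurable]: "(\<lambda>x. of_real (x i) * \<phi> x) \<in> borel_measurable (lebn n)" using \<phi>i by (rule schwartz_measurable)
  define f where "f = (\<lambda>s x. cis (- dot n x (\<xi>(i := s))) * \<phi> x)"
  define f' where "f' = (\<lambda>s x. cis (- dot n x (\<xi>(i := s))) * (- \<i> * (of_real (x i) * \<phi> x)))"
  have "((\<lambda>s. LINT x|lebn n. f s x) has_vector_derivative (LINT x|lebn n. f' (\<xi> i) x)) (at (\<xi> i) within UNIV)"
  proof (rule has_vector_derivative_integral)
    show "integrable (lebn n) (f s)" for s
      unfolding f_def by (intro fourier_kernel_integrable schwartz_integrable \<phi>)
    show "((\<lambda>s. f s x) has_vector_derivative f' s x) (at s within UNIV)" for s x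
      unfolding f_def f'_def dot_upd[OF \<open>i < n\<close>] has_vector_derivative_def
      by (rule derivative_eq_intros refl)+ (simp add: fun_eq_iff scaleR_conv_of_real mult_ac)
    show "norm (f' s x) \<le> norm (of_real (x i) * \<phi> x)" for s x
      by (simp add: f'_def norm_mult)
    show "integrable (lebn n) (\<lambda>x. norm (of_real (x i) * \<phi> x))"
      by (intro integrable_norm schwartz_integrable \<phi>i)
    show "f' (\<xi> i) \<in> borel_measurable (lebn n)" unfolding f'_def by measurable
  qed auto
  then show ?thesis unfolding fourier_def f_def f'_def
    by (intro bounded_linear.has_vector_derivative[OF bounded_linear_mult_right]) simp
qed

lemma LBINT_derivative_eq_0:
  fixes F f :: "real \<Rightarrow> complex"
  assumes F: "\<And>x. (F has_vector_derivative f x) (at x)" and "\<And>x. isCont f x"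
    and f: "integrable lborel f" and "(F \<longlongrightarrow> 0) at_top" "(F \<longlongrightarrow> 0) at_bot"
  shows "(LBINT x. f x) = 0"
proof -
  have "(LBINT x=-\<infinity>..\<infinity>. f x) = 0 - 0"
    by (rule interval_integral_FTC_integrable[where F = F])
      (use assms in \<open>auto simp: set_integrable_def ereal_tendsto_simps\<close>)
  then show ?thesis by (simp add: interval_integral_to_infinity_eq interval_lebesgue_integral_def set_lebesgue_integral_def)
qed

lemma schwartz_section_bound:
  assumes \<phi>: "\<phi> \<in> schwartz n" and "i < n" and x: "x \<in> space (lebn n)"
  obtains B where "\<And>s. norm (\<phi> (x(i := s))) \<le> B * inverse (1 + s\<^sup>2)"
proof -
  obtain B where B: "\<And>x. x \<in> space (lebn n) \<Longrightarrow> (1 + euclid_norm n x) ^ 2 * norm (\<phi> x) \<le> B"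
    using schwartz_decay[OF \<phi>] by blast
  have "norm (\<phi> (x(i := s))) \<le> B * inverse (1 + s\<^sup>2)" for s
  proof -
    have "\<bar>s\<bar> \<le> euclid_norm n (x(i := s))"
      using abs_component_le_euclid_norm[OF \<open>i < n\<close>, of "x(i := s)"] by simp
    then have "\<bar>s\<bar>\<^sup>2 \<le> (euclid_norm n (x(i := s)))\<^sup>2" by (intro power_mono) auto
    then have "1 + s\<^sup>2 \<le> (1 + euclid_norm n (x(i := s)))\<^sup>2"
      using euclid_norm_nonneg[of n "x(i := s)"] unfolding power2_sum by (simp del: euclid_norm_nonneg)
    then have "(1 + s\<^sup>2) * norm (\<phi> (x(i := s))) \<le> B"
      using B[of "x(i := s)"] x \<open>i < n\<close> by (meson mult_right_mono norm_ge_zero order_trans upd_in_space_lebn)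
    then show ?thesis by (simp add: field_simps add_pos_nonneg)
  qed
  then show thesis by (rule that)
qed

text \<open>Integration by parts in the i-th variable: \<open>h\<close> is the derivative of
  \<open>E x * \<phi> x\<close> in that variable, so its integral along every line vanishes by
  decay, and Fubini does the rest.\<close>

lemma fourier_partial:
  assumes \<phi>: "\<phi> \<in> schwartz n" and i: "i < n"
  shows "fourier n (partial i \<phi>) \<xi> = \<i> * of_real (\<xi> i) * fourier n \<phi> \<xi>"
proof -
  define E where "E = (\<lambda>x. cis (- dot n x \<xi>))"
  define h where "h = (\<lambda>x. E x * (partial i \<phi> x - \<i> * of_real (\<xi> i) * \<phi> x))"
  note \<phi>' = schwartz_partial[OF \<phi> i]
  have int: "integrable (lebn n) (\<lambda>x. E x * partial i \<phi> x)" "integrable (lebn n) (\<lambda>x. E x * \<phi> x)"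
    unfolding E_def by (intro fourier_kernel_integrable schwartz_integrable \<phi> \<phi>')+
  have h: "h = (\<lambda>x. E x * partial i \<phi> x - \<i> * of_real (\<xi> i) * (E x * \<phi> x))"
    by (auto simp: h_def algebra_simps)
  have hint: "integrable (lebn n) h" unfolding h using int by auto
  define I where "I = {..<n} - {i}"
  have I: "{..<n} = insert i I" "finite I" "i \<notin> I" using i by (auto simp: I_def)
  have inner: "(LBINT s. h (x(i := s))) = 0" if x: "x \<in> extensional I" for x
  proof -
    have x': "x(i := s) \<in> space (lebn n)" for s using x i unfolding space_lebn I_def extensional_def by auto
    have upd: "x(i := t, i := s) = x(i := s)" for t s by simp
    have E1: "((\<lambda>s. E (x(i := s))) has_vector_derivative - \<i> * of_real (\<xi> i) * E (x(i := s))) (at s)" for s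
      unfolding E_def dot_commute[of n _ \<xi>] dot_upd[OF i] has_vector_derivative_def
      by (rule derivative_eq_intros refl)+ (simp add: fun_eq_iff scaleR_conv_of_real mult_ac)
    have \<phi>1: "((\<lambda>s. \<phi> (x(i := s))) has_vector_derivative partial i \<phi> (x(i := s))) (at s)" for s
      using schwartz_has_partial[OF \<phi> i x'] by simp
    have \<phi>2: "((\<lambda>s. partial i \<phi> (x(i := s))) has_vector_derivative partial i (partial i \<phi>) (x(i := s))) (at s)" for s
      using schwartz_has_partial[OF \<phi>' i x'] by simp
    obtain B where B: "\<And>s. norm (\<phi> (x(i := s))) \<le> B * inverse (1 + s\<^sup>2)"
      using schwartz_section_bound[OF \<phi> i x'] by simp blast
    obtain B' where B': "\<And>s. norm (partial i \<phi> (x(i := s))) \<le> B' * inverse (1 + s\<^sup>2)"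
      using schwartz_section_bound[OF \<phi>' i x'] by simp blast
    have cont: "isCont (\<lambda>s. h (x(i := s))) s" for s
      unfolding h_def
      by (intro continuous_intros has_vector_derivative_continuous[OF E1]
          has_vector_derivative_continuous[OF \<phi>1] has_vector_derivative_continuous[OF \<phi>2])
    show ?thesis
    proof (rule LBINT_derivative_eq_0[where F = "\<lambda>s. E (x(i := s)) * \<phi> (x(i := s))"])
      show "((\<lambda>s. E (x(i := s)) * \<phi> (x(i := s))) has_vector_derivative h (x(i := s))) (at s)" for s
        using has_vector_derivative_mult[OF E1[of s] \<phi>1[of s]]
        by (simp add: h_def algebra_simps)
      show "isCont (\<lambda>s. h (x(i := s))) s" for s by (rule cont)
      show "integrable lborel (\<lambda>s. h (x(i := s)))"
      proof (rule Bochner_Integration.integrable_bound)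
        have "integrable lborel (\<lambda>x::real. inverse (1 + x\<^sup>2))"
          using integrable_inverse_1_plus_square by (simp add: set_integrable_def)
        then show "integrable lborel (\<lambda>s::real. (B' + \<bar>\<xi> i\<bar> * B) * inverse (1 + s\<^sup>2))" by simp
        show "AE s in lborel. norm (h (x(i := s))) \<le> norm ((B' + \<bar>\<xi> i\<bar> * B) * inverse (1 + s\<^sup>2))"
        proof (rule AE_I2)
          fix s
          have "norm (h (x(i := s))) \<le> norm (partial i \<phi> (x(i := s))) + \<bar>\<xi> i\<bar> * norm (\<phi> (x(i := s)))"
            unfolding h_def E_def using norm_triangle_ineq4[of "partial i \<phi> (x(i := s))" "\<i> * of_real (\<xi> i) * \<phi> (x(i := s))"]
            by (simp add: norm_mult)
          also have "\<dots> \<le> B' * inverse (1 + s\<^sup>2) + \<bar>\<xi> i\<bar> * (B * inverse (1 + s\<^sup>2))"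
            by (intro add_mono B' mult_left_mono B) auto
          also have "\<dots> = (B' + \<bar>\<xi> i\<bar> * B) * inverse (1 + s\<^sup>2)" by (simp add: algebra_simps)
          finally show "norm (h (x(i := s))) \<le> norm ((B' + \<bar>\<xi> i\<bar> * B) * inverse (1 + s\<^sup>2))"
            unfolding real_norm_def by (rule order_trans[OF _ abs_ge_self])
        qed
        show "(\<lambda>s. h (x(i := s))) \<in> borel_measurable lborel"
          using cont by (simp add: borel_measurable_continuous_onI continuous_on_eq_continuous_at)
      qed
      have lim: "((\<lambda>s. B * inverse (1 + s\<^sup>2)) \<longlongrightarrow> 0) at_top" "((\<lambda>s. B * inverse (1 + s\<^sup>2)) \<longlongrightarrow> 0) at_bot" by real_asymp+
      show "((\<lambda>s. E (x(i := s)) * \<phi> (x(i := s))) \<longlongrightarrow> 0) at_top" "((\<lambda>s. E (x(i := s)) * \<phi> (x(i := s))) \<longlongrightarrow> 0) at_bot"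
        by (rule Lim_null_comparison[OF _ lim(1)] Lim_null_comparison[OF _ lim(2)], use B in \<open>simp add: norm_mult E_def\<close>)+
    qed
  qed
  have "(LINT x|lebn n. h x) = (LINT x|Pi\<^sub>M I (\<lambda>_. lborel). (LBINT s. h (x(i := s))))"
    using hint unfolding lebn_def I(1) by (intro lborel_product.product_integral_insert I)
  also have "\<dots> = (LINT x|Pi\<^sub>M I (\<lambda>_. lborel :: real measure). 0)"
    by (intro Bochner_Integration.integral_cong inner) (auto simp: space_PiM PiE_def)
  finally have "(LINT x|lebn n. h x) = 0" by simp
  then have "(LINT x|lebn n. E x * partial i \<phi> x) = \<i> * of_real (\<xi> i) * (LINT x|lebn n. E x * \<phi> x)"
    unfolding h using int by simp
  then show ?thesis by (simp add: fourier_def E_def)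
qed

text \<open>A factor \<open>\<bar>\<xi> i\<bar>\<close> is traded for a partial derivative of
  \<phi>, which is why \<phi> is arbitrary in the induction. The weight is a sum of absolute values
  since it splits additively into such factors.\<close>

lemma fourier_decay:
  assumes "\<phi> \<in> schwartz n"
  shows "\<exists>B. \<forall>\<xi>. (1 + (\<Sum>i<n. \<bar>\<xi> i\<bar>)) ^ k * norm (fourier n \<phi> \<xi>) \<le> B"
  using assms
proof (induction k arbitrary: \<phi>)
  case 0
  then show ?case using norm_fourier_le[OF schwartz_integrable[OF 0]] by auto
next
  case (Suc k)
  obtain B where B: "\<And>\<xi>. (1 + (\<Sum>i<n. \<bar>\<xi> i\<bar>)) ^ k * norm (fourier n \<phi> \<xi>) \<le> B"
    using Suc by blast
  have "\<exists>C. \<forall>\<xi>. (1 + (\<Sum>i<n. \<bar>\<xi> i\<bar>)) ^ k * norm (fourier n (partial i \<phi>) \<xi>) \<le> C" if "i < n" for i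
    using Suc.IH[OF schwartz_partial[OF Suc.prems that]] .
  then obtain C where C: "\<And>i \<xi>. i < n \<Longrightarrow> (1 + (\<Sum>i<n. \<bar>\<xi> i\<bar>)) ^ k * norm (fourier n (partial i \<phi>) \<xi>) \<le> C i"
    by metis
  have "(1 + (\<Sum>i<n. \<bar>\<xi> i\<bar>)) ^ Suc k * norm (fourier n \<phi> \<xi>) \<le> B + (\<Sum>i<n. C i)" for \<xi> :: vec
  proof -
    let ?w = "1 + (\<Sum>i<n. \<bar>\<xi> i\<bar>)"
    have "?w ^ Suc k * norm (fourier n \<phi> \<xi>) = ?w * (?w ^ k * norm (fourier n \<phi> \<xi>))" by simp
    also have "\<dots> = ?w ^ k * norm (fourier n \<phi> \<xi>) + (\<Sum>i<n. \<bar>\<xi> i\<bar> * (?w ^ k * norm (fourier n \<phi> \<xi>)))"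
      by (simp only: distrib_right[of 1] sum_distrib_right mult_1)
    also have "\<dots> \<le> B + (\<Sum>i<n. C i)"
    proof (intro add_mono B sum_mono)
      fix i assume "i \<in> {..<n}"
      then show "\<bar>\<xi> i\<bar> * (?w ^ k * norm (fourier n \<phi> \<xi>)) \<le> C i"
        using C[of i \<xi>] fourier_partial[OF Suc.prems, of i \<xi>] by (simp add: norm_mult mult_ac)
    qed
    finally show ?thesis .
  qed
  then show ?case by blast
qed

text \<open>The image of the Schwartz space serves as the invariant set: a derivative of a transform
  is the transform of \<open>- \<i>\<close> times a coordinate multiple of \<phi>.\<close>

theorem fourier_schwartz:
  assumes "\<phi> \<in> schwartz n"
  shows "fourier n \<phi> \<in> schwartz n"
proof -
  have "fourier n \<phi> \<in> fourier n ` schwartz n" using assms by blast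
  then show ?thesis
  proof (coinduct rule: schwartz_coinduct)
    case (derivative f i)
    then obtain \<phi> where f: "f = fourier n \<phi>" and \<phi>: "\<phi> \<in> schwartz n" by blast
    have "(\<lambda>x. - \<i> * (of_real (x i) * \<phi> x)) \<in> schwartz n"
      by (intro schwartz_cmult schwartz_mult_component \<phi> derivative)
    then show ?case unfolding f using fourier_has_partial[OF \<phi> derivative(2)] by blast
  next
    case (decay f k)
    then obtain \<phi> where f: "f = fourier n \<phi>" and \<phi>: "\<phi> \<in> schwartz n" by blast
    obtain B where B: "\<And>\<xi>. (1 + (\<Sum>i<n. \<bar>\<xi> i\<bar>)) ^ k * norm (fourier n \<phi> \<xi>) \<le> B"
      using fourier_decay[OF \<phi>] by blast
    have "(1 + euclid_norm n \<xi>) ^ k * norm (f \<xi>) \<le> B" for \<xi>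
    proof -
      have "(1 + euclid_norm n \<xi>) ^ k * norm (f \<xi>) \<le> (1 + (\<Sum>i<n. \<bar>\<xi> i\<bar>)) ^ k * norm (f \<xi>)"
        using euclid_norm_le_sum_abs[of n \<xi>] by (intro mult_right_mono power_mono) auto
      then show ?thesis using B[of \<xi>] by (simp add: f)
    qed
    then show ?case by blast
  qed
qed

lemma inverse_fourier_schwartz:
  assumes "\<phi> \<in> schwartz n"
  shows "inverse_fourier n \<phi> \<in> schwartz n"
  unfolding inverse_fourier_def[abs_def] by (intro schwartz_cnj fourier_schwartz assms)

lemma inverse_fourier_partial:
  assumes "\<phi> \<in> schwartz n" and i: "i < n" and \<xi>: "\<xi> \<in> space (lebn n)"
  shows "inverse_fourier n (partial i \<phi>) \<xi> = - \<i> * of_real (\<xi> i) * inverse_fourier n \<phi> \<xi>"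
proof -
  have "partial i (\<lambda>x. cnj (\<phi> x)) x = cnj (partial i \<phi> x)" if "x \<in> space (lebn n)" for x
    using bounded_linear.has_vector_derivative[OF bounded_linear_cnj schwartz_has_partial_at[OF assms(1) i that]]
    by (simp add: partial_def vector_derivative_at)
  then have "fourier n (\<lambda>x. cnj (partial i \<phi> x)) \<xi> = fourier n (partial i (\<lambda>x. cnj (\<phi> x))) \<xi>"
    by (intro fourier_cong) simp
  then show ?thesis
    using fourier_partial[OF schwartz_cnj[OF assms(1)] i, of \<xi>] by (simp add: inverse_fourier_def)
qed

section \<open>Gaussian regularisation and Fourier inversion\<close>

text \<open>The weight is \<open>exp (- \<sigma>\<^sup>2 * |\<xi>|^2 / 2)\<close>, and up to
  constants \<open>gauss_kernel\<close> is its Fourier transform, the density of a normal vector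
  with mean x and standard deviation \<sigma>. The product form reduces integrals to one
  variable.\<close>

definition gauss_weight :: "nat \<Rightarrow> real \<Rightarrow> vec \<Rightarrow> real" where
  "gauss_weight n \<sigma> \<xi> = (\<Prod>i<n. exp (- (\<sigma> * \<xi> i)\<^sup>2 / 2))"

definition gauss_kernel :: "nat \<Rightarrow> real \<Rightarrow> vec \<Rightarrow> vec \<Rightarrow> real" where
  "gauss_kernel n \<sigma> x y = (\<Prod>i<n. normal_density (x i) \<sigma> (y i))"

lemma gauss_weight_bounds: "0 \<le> gauss_weight n \<sigma> \<xi>" "gauss_weight n \<sigma> \<xi> \<le> 1"
  unfolding gauss_weight_def by (auto intro!: prod_nonneg prod_le_1)

lemma gauss_kernel_nonneg [simp]: "0 \<le> gauss_kernel n \<sigma> x y"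
  unfolding gauss_kernel_def by (intro prod_nonneg) auto

lemma gauss_kernel_commute: "gauss_kernel n \<sigma> x y = gauss_kernel n \<sigma> y x"
  by (simp add: gauss_kernel_def normal_density_def power2_commute)

lemma gauss_weight_measurable [measurable]: "gauss_weight n \<sigma> \<in> borel_measurable (lebn n)"
  unfolding gauss_weight_def[abs_def] by measurable

lemma gauss_kernel_measurable [measurable]:
  "(\<lambda>(x, y). gauss_kernel n \<sigma> x y) \<in> borel_measurable (lebn n \<Otimes>\<^sub>M lebn n)"
proof -
  have [measurable]: "(\<lambda>z. fst z i) \<in> borel_measurable (lebn n \<Otimes>\<^sub>M lebn n)"
    "(\<lambda>z. snd z i) \<in> borel_measurable (lebn n \<Otimes>\<^sub>M lebn n)" if "i < n" for i
    using that by (auto intro!: measurable_compose[OF measurable_fst] measurable_compose[OF measurable_snd])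
  show ?thesis unfolding gauss_kernel_def normal_density_def case_prod_beta by measurable
qed

lemma borel_measurable_cnj [measurable]:
  "f \<in> borel_measurable M \<Longrightarrow> (\<lambda>x. cnj (f x)) \<in> borel_measurable M"
  by (rule borel_measurable_continuous_on[of cnj]) (intro continuous_intros)

lemma cis_sum: "cis (\<Sum>i<n. f i) = (\<Prod>i<n. cis (f i))" for n :: nat
  by (induction n) (simp_all add: cis_mult[symmetric])

text \<open>A rescaling of the characteristic function of the standard normal distribution:
  substituting \<open>\<sigma> * \<xi>\<close> turns the frequency a into
  \<open>a / \<sigma>\<close>.\<close>

lemma gauss_fourier_line:
  fixes a \<sigma> :: real
  assumes "\<sigma> > 0"
  shows "integrable lborel (\<lambda>\<xi>. cis (a * \<xi>) * of_real (exp (- (\<sigma> * \<xi>)\<^sup>2 / 2)))" (is ?int)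
    and "(LBINT \<xi>. cis (a * \<xi>) * of_real (exp (- (\<sigma> * \<xi>)\<^sup>2 / 2))) = of_real (2 * pi * normal_density 0 \<sigma> a)" (is ?eq)
proof -
  define f where "f = (\<lambda>x::real. std_normal_density x *\<^sub>R iexp (a / \<sigma> * x))"
  have "integrable lborel (\<lambda>x. std_normal_density x)" by simp
  then have f: "integrable lborel f"
    by (rule Bochner_Integration.integrable_bound) (auto simp: f_def norm_mult)
  have "char std_normal_distribution (a / \<sigma>) = (LBINT x. f x)"
    unfolding char_def f_def by (subst integral_density) auto
  then have intf: "(LBINT x. f x) = of_real (exp (- (a / \<sigma>)\<^sup>2 / 2))"
    by (simp add: char_std_normal_distribution)
  have eq: "f (0 + \<sigma> * \<xi>) = of_real (1 / sqrt (2 * pi)) * (cis (a * \<xi>) * of_real (exp (- (\<sigma> * \<xi>)\<^sup>2 / 2)))" for \<xi>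
    using assms by (simp add: f_def std_normal_density_def scaleR_conv_of_real cis_conv_exp)
  have "integrable lborel (\<lambda>\<xi>. f (0 + \<sigma> * \<xi>))"
    using lborel_integrable_real_affine[OF f, of \<sigma> 0] assms by simp
  then have "integrable lborel (\<lambda>\<xi>. of_real (sqrt (2 * pi)) * f (0 + \<sigma> * \<xi>))" by simp
  moreover have "(\<lambda>\<xi>. of_real (sqrt (2 * pi)) * f (0 + \<sigma> * \<xi>)) = (\<lambda>\<xi>. cis (a * \<xi>) * of_real (exp (- (\<sigma> * \<xi>)\<^sup>2 / 2)))"
    unfolding eq by (simp add: fun_eq_iff)
  ultimately show ?int by simp
  have "(LBINT x. f x) = \<sigma> *\<^sub>R (LBINT \<xi>. f (0 + \<sigma> * \<xi>))"
    using lborel_integral_real_affine[of \<sigma> f 0] assms by simp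
  then have "of_real (exp (- (a / \<sigma>)\<^sup>2 / 2))
      = of_real (\<sigma> / sqrt (2 * pi)) * (LBINT \<xi>. cis (a * \<xi>) * of_real (exp (- (\<sigma> * \<xi>)\<^sup>2 / 2)))"
    unfolding intf eq by (simp add: scaleR_conv_of_real)
  then have "(LBINT \<xi>. cis (a * \<xi>) * of_real (exp (- (\<sigma> * \<xi>)\<^sup>2 / 2))) = of_real (sqrt (2 * pi) / \<sigma> * exp (- (a / \<sigma>)\<^sup>2 / 2))"
    using assms by (simp add: field_simps)
  also have "sqrt (2 * pi) / \<sigma> * exp (- (a / \<sigma>)\<^sup>2 / 2) = 2 * pi * normal_density 0 \<sigma> a"
  proof -
    have "sqrt (2 * pi) * sqrt (2 * pi) = 2 * pi" by simp
    then show ?thesis using assms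
      by (simp add: normal_density_def real_sqrt_mult power_divide field_simps del: real_sqrt_mult_self)
  qed
  finally show ?eq .
qed

lemma gauss_weight_fourier:
  assumes "\<sigma> > 0"
  shows "integrable (lebn n) (\<lambda>\<xi>. of_real (gauss_weight n \<sigma> \<xi>) :: complex)" (is ?int)
    and "(LINT \<xi>|lebn n. cis (dot n y \<xi> - dot n x \<xi>) * of_real (gauss_weight n \<sigma> \<xi>))
          = of_real ((2 * pi) ^ n * gauss_kernel n \<sigma> x y)" (is ?eq)
proof -
  have eq: "of_real (gauss_weight n \<sigma> \<xi>) = (\<Prod>i<n. cis (0 * \<xi> i) * of_real (exp (- (\<sigma> * \<xi> i)\<^sup>2 / 2)))" for \<xi>
    by (simp add: gauss_weight_def)
  show ?int unfolding lebn_def eq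
    by (intro lborel_product.product_integrable_prod gauss_fourier_line assms) simp
  have *: "cis (dot n y \<xi> - dot n x \<xi>) * of_real (gauss_weight n \<sigma> \<xi>)
      = (\<Prod>i<n. cis ((y i - x i) * \<xi> i) * of_real (exp (- (\<sigma> * \<xi> i)\<^sup>2 / 2)))" for \<xi>
    by (simp add: gauss_weight_def prod.distrib cis_sum[symmetric] dot_def left_diff_distrib sum_subtractf)
  have "(LINT \<xi>|lebn n. cis (dot n y \<xi> - dot n x \<xi>) * of_real (gauss_weight n \<sigma> \<xi>))
      = (\<Prod>i<n. LBINT \<xi>. cis ((y i - x i) * \<xi>) * of_real (exp (- (\<sigma> * \<xi>)\<^sup>2 / 2)))"
    unfolding * lebn_def by (intro lborel_product.product_integral_prod gauss_fourier_line assms) simp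
  also have "\<dots> = (\<Prod>i<n. of_real (2 * pi * normal_density 0 \<sigma> (y i - x i)))"
    by (simp only: gauss_fourier_line(2)[OF assms])
  also have "\<dots> = of_real ((2 * pi) ^ n * gauss_kernel n \<sigma> x y)"
  proof -
    have "normal_density 0 \<sigma> (y i - x i) = normal_density (x i) \<sigma> (y i)" for i by (simp add: normal_density_def)
    then show ?thesis
      by (simp only: of_real_prod[symmetric] prod.distrib prod_constant card_lessThan gauss_kernel_def power_mult_distrib)
  qed
  finally show ?eq .
qed

text \<open>Supplies the absolute integrability for the uses of Fubini below; the oscillating
  kernels there have modulus 1.\<close>

lemma integrable_pair_kernel:
  fixes f g :: "vec \<Rightarrow> complex"
  assumes f: "integrable (lebn n) f" and g: "integrable (lebn n) g"
    and [measurable]: "(\<lambda>(x, y). k x y) \<in> borel_measurable (lebn n \<Otimes>\<^sub>M lebn n)" and k: "\<And>x y. norm (k x y) \<le> 1"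
  shows "integrable (lebn n \<Otimes>\<^sub>M lebn n) (\<lambda>(x, y). k x y * (f x * g y))"
proof -
  have [measurable]: "f \<in> borel_measurable (lebn n)" "g \<in> borel_measurable (lebn n)" using f g by auto
  have *: "integrable (lebn n \<Otimes>\<^sub>M lebn n) (\<lambda>(x, y). f x * g y)"
  proof (rule lebn_pair.Fubini_integrable)
    show "(\<lambda>(x, y). f x * g y) \<in> borel_measurable (lebn n \<Otimes>\<^sub>M lebn n)" by measurable
    show "integrable (lebn n) (\<lambda>x. LINT y|lebn n. norm (case (x, y) of (x, y) \<Rightarrow> f x * g y))"
      using f by (simp add: norm_mult)
  qed (use g in auto)
  show ?thesis
  proof (rule Bochner_Integration.integrable_bound[OF *])
    show "(\<lambda>(x, y). k x y * (f x * g y)) \<in> borel_measurable (lebn n \<Otimes>\<^sub>M lebn n)"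
      unfolding case_prod_beta
      by (intro borel_measurable_times) (use assms(3) in \<open>simp_all add: case_prod_beta\<close>)
    show "AE z in lebn n \<Otimes>\<^sub>M lebn n. norm (case z of (x, y) \<Rightarrow> k x y * (f x * g y)) \<le> norm (case z of (x, y) \<Rightarrow> f x * g y)"
      using k by (intro AE_I2) (auto simp: norm_mult mult_left_le_one_le split: prod.split)
  qed
qed

lemma cis_dot_pair_measurable: "(\<lambda>(x, y). cis (- dot n x y)) \<in> borel_measurable (lebn n \<Otimes>\<^sub>M lebn n)"
  unfolding case_prod_beta
  by (rule measurable_compose[of "\<lambda>z. - dot n (fst z) (snd z)" _ borel cis])
    (use dot_measurable_pair[of n] in \<open>auto intro!: borel_measurable_continuous_onI continuous_intros simp: case_prod_beta\<close>)

lemma fourier_multiplication: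
  assumes f: "integrable (lebn n) f" and g: "integrable (lebn n) g"
  shows "(LINT x|lebn n. fourier n f x * g x) = (LINT x|lebn n. f x * fourier n g x)"
proof -
  have "integrable (lebn n \<Otimes>\<^sub>M lebn n) (\<lambda>(x, y). cis (- dot n x y) * (f x * g y))"
    by (rule integrable_pair_kernel[OF f g cis_dot_pair_measurable]) simp
  from lebn_pair.Fubini_integral[OF this]
  have *: "(LINT y|lebn n. LINT x|lebn n. cis (- dot n x y) * (f x * g y))
      = (LINT x|lebn n. LINT y|lebn n. cis (- dot n x y) * (f x * g y))" .
  have "(LINT x|lebn n. cis (- dot n x y) * (f x * g y)) = (LINT x|lebn n. cis (- dot n x y) * f x) * g y" for y
    by (simp add: mult.assoc[symmetric])
  moreover have "(LINT y|lebn n. cis (- dot n x y) * (f x * g y)) = f x * (LINT y|lebn n. cis (- dot n y x) * g y)" for x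
    by (simp add: mult.left_commute[of _ "f x"] dot_commute[of n x])
  ultimately have **: "(LINT y|lebn n. (LINT x|lebn n. cis (- dot n x y) * f x) * g y)
      = (LINT x|lebn n. f x * (LINT y|lebn n. cis (- dot n y x) * g y))" using * by simp
  define c where "c = complex_of_real ((2 * pi) powr (- real n / 2))"
  have "(LINT x|lebn n. fourier n f x * g x) = c * (LINT y|lebn n. (LINT x|lebn n. cis (- dot n x y) * f x) * g y)"
    unfolding fourier_def c_def[symmetric] by (simp only: mult.assoc integral_mult_right_zero)
  also have "\<dots> = (LINT x|lebn n. f x * fourier n g x)"
    unfolding ** fourier_def c_def[symmetric]
    by (simp only: mult.left_commute[of "f _" c] integral_mult_right_zero)
  finally show ?thesis .
qed

lemma inverse_fourier_eq: "inverse_fourier n f \<xi> = of_real ((2 * pi) powr (- real n / 2)) * (LINT x|lebn n. cis (dot n x \<xi>) * f x)"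
proof -
  have "cnj (LINT x|lebn n. cis (- dot n x \<xi>) * cnj (f x)) = (LINT x|lebn n. cnj (cis (- dot n x \<xi>) * cnj (f x)))"
    by (rule Bochner_Integration.integral_cnj[symmetric])
  then show ?thesis by (simp add: inverse_fourier_def fourier_def cis_cnj)
qed

lemma inverse_fourier_measurable [measurable]:
  assumes [measurable]: "f \<in> borel_measurable (lebn n)"
  shows "inverse_fourier n f \<in> borel_measurable (lebn n)"
  unfolding inverse_fourier_def[abs_def] by measurable

lemma gauss_weight_mult_integrable:
  assumes [measurable]: "h \<in> borel_measurable (lebn n)" and h: "\<And>\<xi>. norm (h \<xi>) \<le> B" and "\<sigma> > 0"
  shows "integrable (lebn n) (\<lambda>\<xi>. of_real (gauss_weight n \<sigma> \<xi>) * h \<xi> :: complex)"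
proof (rule Bochner_Integration.integrable_bound)
  show "integrable (lebn n) (\<lambda>\<xi>. of_real B * of_real (gauss_weight n \<sigma> \<xi>) :: complex)"
    using gauss_weight_fourier(1)[OF \<open>\<sigma> > 0\<close>] by simp
  show "AE \<xi> in lebn n. norm (of_real (gauss_weight n \<sigma> \<xi>) * h \<xi>) \<le> norm (of_real B * of_real (gauss_weight n \<sigma> \<xi>) :: complex)"
    using order_trans[OF h abs_ge_self] gauss_weight_bounds(1)[of n \<sigma>]
    by (intro AE_I2) (auto simp: norm_mult mult.commute[of "\<bar>B\<bar>"] intro!: mult_left_mono)
qed measurable

text \<open>Fourier inversion with Gaussian damping. The weight makes the double integral converge
  absolutely although the transform of \<open>g\<close> need not be integrable. Exchanging the
  integrals leaves the transform of the weight, which is the Gaussian kernel.\<close>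

lemma fourier_gauss_weight_inverse_fourier:
  assumes g: "integrable (lebn n) g" and "\<sigma> > 0"
  shows "fourier n (\<lambda>\<xi>. of_real (gauss_weight n \<sigma> \<xi>) * inverse_fourier n g \<xi>) x
       = (LINT y|lebn n. of_real (gauss_kernel n \<sigma> x y) * g y)"
proof -
  define c where "c = (2 * pi) powr (- real n / 2)"
  \<comment> \<open>The normalisations of the two transforms cancel the factor
    \<open>(2 * pi) ^ n\<close> of the Gaussian integral.\<close>
  have c: "c * c * (2 * pi) ^ n = 1"
  proof -
    have "(2 * pi) ^ n = (2 * pi) powr real n" by (simp add: powr_realpow)
    then have "c * c * (2 * pi) ^ n = (2 * pi) powr (- real n / 2 + - real n / 2 + real n)"
      by (simp only: c_def powr_add)
    then show ?thesis by simp
  qed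
  define w where "w = (\<lambda>\<xi>. complex_of_real (gauss_weight n \<sigma> \<xi>))"
  have w: "integrable (lebn n) w" unfolding w_def by (rule gauss_weight_fourier(1)[OF \<open>\<sigma> > 0\<close>])
  have km: "(\<lambda>(\<xi>, y). cis (dot n y \<xi> - dot n x \<xi>)) \<in> borel_measurable (lebn n \<Otimes>\<^sub>M lebn n)"
    unfolding case_prod_beta
    by (rule measurable_compose[of "\<lambda>z. dot n (snd z) (fst z) - dot n x (fst z)" _ borel cis])
      (use dot_measurable_pair[of n] dot_measurable[of n x] in
        \<open>auto intro!: borel_measurable_continuous_onI continuous_intros borel_measurable_diff measurable_compose[OF measurable_fst]
         simp: case_prod_beta dot_commute[of n x] dot_commute[of n "snd _"]\<close>)
  have "integrable (lebn n \<Otimes>\<^sub>M lebn n) (\<lambda>(\<xi>, y). cis (dot n y \<xi> - dot n x \<xi>) * (w \<xi> * g y))"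
    by (rule integrable_pair_kernel[OF w g km]) simp
  from lebn_pair.Fubini_integral[OF this]
  have *: "(LINT y|lebn n. LINT \<xi>|lebn n. cis (dot n y \<xi> - dot n x \<xi>) * (w \<xi> * g y))
      = (LINT \<xi>|lebn n. LINT y|lebn n. cis (dot n y \<xi> - dot n x \<xi>) * (w \<xi> * g y))" .
  have "(LINT y|lebn n. cis (dot n y \<xi> - dot n x \<xi>) * (w \<xi> * g y))
      = cis (- dot n \<xi> x) * (w \<xi> * (LINT y|lebn n. cis (dot n y \<xi>) * g y))" for \<xi>
  proof -
    have "cis (dot n y \<xi> - dot n x \<xi>) * (w \<xi> * g y) = (cis (- dot n \<xi> x) * w \<xi>) * (cis (dot n y \<xi>) * g y)" for y
      using cis_mult[of "- dot n \<xi> x" "dot n y \<xi>"] by (simp add: dot_commute[of n x] mult_ac)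
    then show ?thesis by (simp only: integral_mult_right_zero mult.assoc)
  qed
  then have "fourier n (\<lambda>\<xi>. w \<xi> * inverse_fourier n g \<xi>) x
      = of_real (c * c) * (LINT \<xi>|lebn n. LINT y|lebn n. cis (dot n y \<xi> - dot n x \<xi>) * (w \<xi> * g y))"
  proof -
    have *: "cis (- dot n \<xi> x) * (w \<xi> * (of_real c * (LINT y|lebn n. cis (dot n y \<xi>) * g y)))
        = of_real c * (LINT y|lebn n. cis (dot n y \<xi> - dot n x \<xi>) * (w \<xi> * g y))" for \<xi>
      by (simp add: \<open>\<And>\<xi>. (LINT y|lebn n. cis (dot n y \<xi> - dot n x \<xi>) * (w \<xi> * g y)) = _\<close>)
    show ?thesis
      unfolding fourier_def inverse_fourier_eq c_def[symmetric] * by (simp add: mult.assoc)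
  qed
  also have "\<dots> = of_real (c * c) * (LINT y|lebn n. of_real ((2 * pi) ^ n * gauss_kernel n \<sigma> x y) * g y)"
  proof -
    have "(LINT \<xi>|lebn n. cis (dot n y \<xi> - dot n x \<xi>) * (w \<xi> * g y)) = of_real ((2 * pi) ^ n * gauss_kernel n \<sigma> x y) * g y" for y
      using gauss_weight_fourier(2)[OF \<open>\<sigma> > 0\<close>, of n y x] by (simp add: w_def mult.assoc[symmetric])
    then show ?thesis unfolding *[symmetric] by simp
  qed
  also have "\<dots> = of_real (c * c * (2 * pi) ^ n) * (LINT y|lebn n. of_real (gauss_kernel n \<sigma> x y) * g y)"
    by (simp add: mult.assoc)
  finally show ?thesis by (simp only: c w_def of_real_1 mult_1)
qed

lemma gauss_kernel_integrals:
  assumes "\<sigma> > 0"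
  shows integrable_gauss_kernel: "integrable (lebn n) (gauss_kernel n \<sigma> x)"
    and integral_gauss_kernel: "(LINT y|lebn n. gauss_kernel n \<sigma> x y) = 1"
    and integrable_gauss_kernel_abs_moment: "i < n \<Longrightarrow> integrable (lebn n) (\<lambda>y. gauss_kernel n \<sigma> x y * \<bar>y i - x i\<bar>)"
    and integral_gauss_kernel_abs_moment: "i < n \<Longrightarrow> (LINT y|lebn n. gauss_kernel n \<sigma> x y * \<bar>y i - x i\<bar>) = \<sigma> * sqrt (2 / pi)"
proof -
  note nd = integrable_normal_density[OF assms]
  show "integrable (lebn n) (gauss_kernel n \<sigma> x)"
    unfolding gauss_kernel_def[abs_def] lebn_def by (intro lborel_product.product_integrable_prod nd) simp
  show "(LINT y|lebn n. gauss_kernel n \<sigma> x y) = 1"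
    unfolding gauss_kernel_def[abs_def] lebn_def
    by (subst lborel_product.product_integral_prod) (simp_all add: nd assms)
  assume i: "i < n"
  define f where "f = (\<lambda>j t. normal_density (x j) \<sigma> t * (if j = i then \<bar>t - x i\<bar> else 1))"
  have mom: "has_bochner_integral lborel (\<lambda>t. normal_density (x i) \<sigma> t * \<bar>t - x i\<bar>) (\<sigma> * sqrt (2 / pi))"
    using normal_moment_abs_odd[OF assms, of "x i" 0] by simp
  have f: "integrable lborel (f j)" for j
    unfolding f_def using assms integrable.intros[OF mom] by (cases "j = i") auto
  have eq: "gauss_kernel n \<sigma> x y * \<bar>y i - x i\<bar> = (\<Prod>j<n. f j (y j))" for y
    using i by (simp add: gauss_kernel_def f_def prod.distrib prod.delta)
  show "integrable (lebn n) (\<lambda>y. gauss_kernel n \<sigma> x y * \<bar>y i - x i\<bar>)"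
    unfolding eq lebn_def by (intro lborel_product.product_integrable_prod f) simp
  have "(LINT y|lebn n. gauss_kernel n \<sigma> x y * \<bar>y i - x i\<bar>) = (\<Prod>j<n. integral\<^sup>L lborel (f j))"
    unfolding eq lebn_def by (intro lborel_product.product_integral_prod f) simp
  also have "\<dots> = (\<Prod>j<n. if j = i then \<sigma> * sqrt (2 / pi) else 1)"
    using assms has_bochner_integral_integral_eq[OF mom] by (intro prod.cong) (auto simp: f_def)
  also have "\<dots> = \<sigma> * sqrt (2 / pi)" using i by (simp add: prod.delta)
  finally show "(LINT y|lebn n. gauss_kernel n \<sigma> x y * \<bar>y i - x i\<bar>) = \<sigma> * sqrt (2 / pi)" .
qed

lemma gauss_kernel_measurable_snd [measurable]: "gauss_kernel n \<sigma> x \<in> borel_measurable (lebn n)"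
  unfolding gauss_kernel_def[abs_def] by measurable

text \<open>The kernel has mass 1, so the Lipschitz bound reduces the error to its first absolute
  moments, which are proportional to \<sigma>.\<close>

lemma gauss_kernel_mollify_schwartz:
  assumes \<phi>: "\<phi> \<in> schwartz n" and x: "x \<in> space (lebn n)"
  shows "(\<lambda>k. LINT y|lebn n. of_real (gauss_kernel n (1 / Suc k) x y) * \<phi> y) \<longlonglongrightarrow> \<phi> x"
proof -
  have [measurable]: "\<phi> \<in> borel_measurable (lebn n)" using \<phi> by (rule schwartz_measurable)
  obtain B where B: "B \<ge> 0" "\<And>x y. \<lbrakk>x \<in> space (lebn n); y \<in> space (lebn n)\<rbrakk> \<Longrightarrow> norm (\<phi> x - \<phi> y) \<le> B * (\<Sum>i<n. \<bar>x i - y i\<bar>)"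
    by (rule schwartz_lipschitz[OF \<phi>]) (rule that)
  obtain D where D: "\<And>x. x \<in> space (lebn n) \<Longrightarrow> norm (\<phi> x) \<le> D"
    by (rule schwartz_decay[OF \<phi>, of 0]) auto
  have est: "norm ((LINT y|lebn n. of_real (gauss_kernel n \<sigma> x y) * \<phi> y) - \<phi> x) \<le> B * (real n * (\<sigma> * sqrt (2 / pi)))"
    if "\<sigma> > 0" for \<sigma>
  proof -
    let ?G = "\<lambda>y. complex_of_real (gauss_kernel n \<sigma> x y)"
    have G: "integrable (lebn n) ?G"
      using integrable_gauss_kernel[OF that] by (rule integrable_of_real)
    have G\<phi>: "integrable (lebn n) (\<lambda>y. ?G y * \<phi> y)"
    proof (rule Bochner_Integration.integrable_bound)
      show "integrable (lebn n) (\<lambda>y. D * gauss_kernel n \<sigma> x y)"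
        using integrable_gauss_kernel[OF that] by (rule integrable_mult_right)
      show "AE y in lebn n. norm (?G y * \<phi> y) \<le> norm (D * gauss_kernel n \<sigma> x y)"
        using order_trans[OF D abs_ge_self]
        by (intro AE_I2) (auto simp: norm_mult abs_mult mult.commute[of "\<bar>D\<bar>"] intro!: mult_left_mono)
    qed measurable
    have "(LINT y|lebn n. ?G y * \<phi> y) - \<phi> x = (LINT y|lebn n. ?G y * \<phi> y) - (LINT y|lebn n. ?G y) * \<phi> x"
      by (simp add: integral_gauss_kernel[OF that])
    also have "\<dots> = (LINT y|lebn n. ?G y * (\<phi> y - \<phi> x))"
      using G G\<phi> by (simp add: right_diff_distrib)
    finally have "norm ((LINT y|lebn n. ?G y * \<phi> y) - \<phi> x) \<le> (LINT y|lebn n. norm (?G y * (\<phi> y - \<phi> x)))"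
      by simp
    also have "\<dots> \<le> (LINT y|lebn n. B * (\<Sum>i<n. gauss_kernel n \<sigma> x y * \<bar>y i - x i\<bar>))"
    proof (rule integral_mono)
      have "integrable (lebn n) (\<lambda>y. ?G y * \<phi> y - ?G y * \<phi> x)" using G G\<phi> by simp
      then show "integrable (lebn n) (\<lambda>y. norm (?G y * (\<phi> y - \<phi> x)))"
        by (simp only: right_diff_distrib integrable_norm)
      show "integrable (lebn n) (\<lambda>y. B * (\<Sum>i<n. gauss_kernel n \<sigma> x y * \<bar>y i - x i\<bar>))"
        by (intro integrable_mult_right Bochner_Integration.integrable_sum integrable_gauss_kernel_abs_moment that) simp
      fix y assume "y \<in> space (lebn n)"
      then have "gauss_kernel n \<sigma> x y * norm (\<phi> y - \<phi> x) \<le> gauss_kernel n \<sigma> x y * (B * (\<Sum>i<n. \<bar>y i - x i\<bar>))"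
        using B(2) x by (intro mult_left_mono) auto
      then show "norm (?G y * (\<phi> y - \<phi> x)) \<le> B * (\<Sum>i<n. gauss_kernel n \<sigma> x y * \<bar>y i - x i\<bar>)"
        by (simp add: norm_mult sum_distrib_left mult.left_commute)
    qed
    also have "\<dots> = B * (\<Sum>i<n. LINT y|lebn n. gauss_kernel n \<sigma> x y * \<bar>y i - x i\<bar>)"
      using integrable_gauss_kernel_abs_moment[OF that] by (simp add: Bochner_Integration.integral_sum)
    also have "\<dots> = B * (real n * (\<sigma> * sqrt (2 / pi)))"
      by (simp add: integral_gauss_kernel_abs_moment[OF that])
    finally show ?thesis .
  qed
  show ?thesis
  proof (rule LIM_zero_cancel, rule Lim_null_comparison)
    show "\<forall>\<^sub>F k in sequentially. norm ((LINT y|lebn n. of_real (gauss_kernel n (1 / Suc k) x y) * \<phi> y) - \<phi> x)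
        \<le> B * (real n * (1 / Suc k * sqrt (2 / pi)))"
      by (intro always_eventually allI est) simp
    show "(\<lambda>k. B * (real n * (1 / Suc k * sqrt (2 / pi)))) \<longlonglongrightarrow> 0" by real_asymp
  qed
qed

lemma gauss_weight_tendsto: "(\<lambda>k. gauss_weight n (1 / Suc k) \<xi>) \<longlonglongrightarrow> 1"
proof -
  have "(\<lambda>k. exp (- (1 / Suc k * a)\<^sup>2 / 2)) \<longlonglongrightarrow> 1" for a :: real
  proof -
    have "(\<lambda>k. 1 / real (Suc k)) \<longlonglongrightarrow> 0" by real_asymp
    from tendsto_exp[OF tendsto_divide[OF tendsto_minus[OF tendsto_power[OF tendsto_mult[OF this tendsto_const[of a]], of 2]] tendsto_const[of 2]]]
    show ?thesis by simp
  qed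
  then have "(\<lambda>k. \<Prod>i<n. exp (- (1 / Suc k * \<xi> i)\<^sup>2 / 2)) \<longlonglongrightarrow> (\<Prod>i<n. 1)" by (intro tendsto_prod)
  then show ?thesis by (simp add: gauss_weight_def)
qed

text \<open>The damped expression has two limits as the Gaussian spreads out: by the kernel formula
  it mollifies \<phi> and tends to \<phi>, while dominated convergence removes the weight.\<close>

theorem fourier_inverse_fourier:
  assumes \<phi>: "\<phi> \<in> schwartz n" and x: "x \<in> space (lebn n)"
  shows "fourier n (inverse_fourier n \<phi>) x = \<phi> x"
proof (rule LIMSEQ_unique)
  note inv = inverse_fourier_schwartz[OF \<phi>]
  have [measurable]: "inverse_fourier n \<phi> \<in> borel_measurable (lebn n)" using inv by (rule schwartz_measurable)
  have "(\<lambda>k. fourier n (\<lambda>\<xi>. of_real (gauss_weight n (1 / Suc k) \<xi>) * inverse_fourier n \<phi> \<xi>) x) \<longlonglongrightarrow> \<phi> x"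
    using gauss_kernel_mollify_schwartz[OF \<phi> x]
    by (subst fourier_gauss_weight_inverse_fourier[OF schwartz_integrable[OF \<phi>]]) auto
  then show "(\<lambda>k. fourier n (\<lambda>\<xi>. of_real (gauss_weight n (1 / Suc k) \<xi>) * inverse_fourier n \<phi> \<xi>) x) \<longlonglongrightarrow> \<phi> x" .
  show "(\<lambda>k. fourier n (\<lambda>\<xi>. of_real (gauss_weight n (1 / Suc k) \<xi>) * inverse_fourier n \<phi> \<xi>) x) \<longlonglongrightarrow> fourier n (inverse_fourier n \<phi>) x"
    unfolding fourier_def
  proof (intro tendsto_mult_left integral_dominated_convergence[where w = "\<lambda>\<xi>. norm (inverse_fourier n \<phi> \<xi>)"])
    show "AE \<xi> in lebn n. (\<lambda>k. cis (- dot n \<xi> x) * (of_real (gauss_weight n (1 / Suc k) \<xi>) * inverse_fourier n \<phi> \<xi>))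
        \<longlonglongrightarrow> cis (- dot n \<xi> x) * inverse_fourier n \<phi> \<xi>"
    proof (rule AE_I2)
      fix \<xi>
      have "(\<lambda>k. cis (- dot n \<xi> x) * (complex_of_real (gauss_weight n (1 / Suc k) \<xi>) * inverse_fourier n \<phi> \<xi>))
        \<longlonglongrightarrow> cis (- dot n \<xi> x) * (complex_of_real 1 * inverse_fourier n \<phi> \<xi>)"
        by (intro tendsto_intros gauss_weight_tendsto)
      then show "(\<lambda>k. cis (- dot n \<xi> x) * (of_real (gauss_weight n (1 / Suc k) \<xi>) * inverse_fourier n \<phi> \<xi>))
        \<longlonglongrightarrow> cis (- dot n \<xi> x) * inverse_fourier n \<phi> \<xi>" by simp
    qed
    show "AE \<xi> in lebn n. norm (cis (- dot n \<xi> x) * (of_real (gauss_weight n (1 / Suc k) \<xi>) * inverse_fourier n \<phi> \<xi>))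
        \<le> norm (inverse_fourier n \<phi> \<xi>)" for k
      by (intro AE_I2) (auto simp: norm_mult abs_of_nonneg gauss_weight_bounds intro!: mult_left_le_one_le)
    show "integrable (lebn n) (\<lambda>\<xi>. norm (inverse_fourier n \<phi> \<xi>))"
      by (intro integrable_norm schwartz_integrable inv)
  qed measurable
qed

section \<open>The Fourier transform on square integrable functions\<close>

lemma square_integrable_measurable [measurable_dest]: "square_integrable n f \<Longrightarrow> f \<in> borel_measurable (lebn n)"
  by (simp add: square_integrable_def)

lemma L2norm_fun_nonneg [simp]: "0 \<le> L2norm_fun n f"
  by (simp add: L2norm_fun_def)

lemma L2norm_fun_power2: "(L2norm_fun n f)\<^sup>2 = (LINT x|lebn n. (norm (f x))\<^sup>2)"
  by (simp add: L2norm_fun_def)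

lemma nn_integral_norm_power2:
  assumes "square_integrable n f"
  shows "(\<integral>\<^sup>+x. ennreal ((norm (f x))\<^sup>2) \<partial>lebn n) = ennreal ((L2norm_fun n f)\<^sup>2)"
  using assms by (simp add: square_integrable_def L2norm_fun_power2 nn_integral_eq_integral)

lemma square_integrableI_nn:
  assumes "f \<in> borel_measurable (lebn n)" "(\<integral>\<^sup>+x. ennreal ((norm (f x))\<^sup>2) \<partial>lebn n) \<le> ennreal C" "C \<ge> 0"
  shows "square_integrable n f" and "(LINT x|lebn n. (norm (f x))\<^sup>2) \<le> C"
proof -
  show sq: "square_integrable n f"
    using assms unfolding square_integrable_def
    by (auto intro!: integrableI_bounded intro: le_less_trans[OF _ ennreal_less_top])
  have "ennreal (LINT x|lebn n. (norm (f x))\<^sup>2) \<le> ennreal C"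
    using assms sq by (subst nn_integral_eq_integral[symmetric]) (auto simp: square_integrable_def)
  then show "(LINT x|lebn n. (norm (f x))\<^sup>2) \<le> C" using assms(3) by simp
qed

lemma power2_norm_diff_le: "(norm (a - b :: complex))\<^sup>2 \<le> 2 * (norm a)\<^sup>2 + 2 * (norm b)\<^sup>2"
proof -
  have "(norm (a - b))\<^sup>2 \<le> (norm a + norm b)\<^sup>2" by (intro power_mono norm_triangle_ineq4) auto
  also have "\<dots> \<le> 2 * (norm a)\<^sup>2 + 2 * (norm b)\<^sup>2"
    using sum_squares_bound[of "norm a" "norm b"] by (simp add: power2_sum)
  finally show ?thesis .
qed

lemma square_integrable_diff:
  assumes "square_integrable n f" "square_integrable n g"
  shows "square_integrable n (\<lambda>x. f x - g x)"
proof -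
  have [measurable]: "f \<in> borel_measurable (lebn n)" "g \<in> borel_measurable (lebn n)"
    using assms by (auto simp: square_integrable_def)
  have "integrable (lebn n) (\<lambda>x. (norm (f x - g x))\<^sup>2)"
  proof (rule Bochner_Integration.integrable_bound)
    show "integrable (lebn n) (\<lambda>x. 2 * (norm (f x))\<^sup>2 + 2 * (norm (g x))\<^sup>2)"
      using assms by (simp add: square_integrable_def)
  qed (auto simp: power2_norm_diff_le)
  then show ?thesis by (simp add: square_integrable_def)
qed

lemma square_integrable_mult_integrable:
  assumes "square_integrable n f" "square_integrable n g"
  shows "integrable (lebn n) (\<lambda>x. f x * g x)"
proof (rule Bochner_Integration.integrable_bound)
  have [measurable]: "f \<in> borel_measurable (lebn n)" "g \<in> borel_measurable (lebn n)"
    using assms by (auto simp: square_integrable_def)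
  show "integrable (lebn n) (\<lambda>x. (norm (f x))\<^sup>2 + (norm (g x))\<^sup>2)"
    using assms by (simp add: square_integrable_def)
  show "(\<lambda>x. f x * g x) \<in> borel_measurable (lebn n)" by measurable
  show "AE x in lebn n. norm (f x * g x) \<le> norm ((norm (f x))\<^sup>2 + (norm (g x))\<^sup>2)"
  proof (rule AE_I2)
    fix x
    have "2 * (norm (f x) * norm (g x)) \<le> (norm (f x))\<^sup>2 + (norm (g x))\<^sup>2"
      using sum_squares_bound[of "norm (f x)" "norm (g x)"] by simp
    moreover have "0 \<le> norm (f x) * norm (g x)" by simp
    ultimately show "norm (f x * g x) \<le> norm ((norm (f x))\<^sup>2 + (norm (g x))\<^sup>2)" unfolding norm_mult real_norm_def by linarith
  qed
qed

text \<open>Pairings are continuous under convergence in mean square. A weighted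
  arithmetic-geometric inequality takes the place of Cauchy-Schwarz; the prescribed rate leaves room
  for its weight.\<close>

lemma integral_mult_tendsto:
  assumes f: "square_integrable n f" "\<And>k. square_integrable n (F k)" and \<phi>: "square_integrable n \<phi>"
    and le: "\<And>k. (LINT x|lebn n. (norm (F k x - f x))\<^sup>2) \<le> 4 * (1 / 8) ^ k"
  shows "(\<lambda>k. LINT x|lebn n. F k x * \<phi> x) \<longlonglongrightarrow> (LINT x|lebn n. f x * \<phi> x)"
proof (rule LIM_zero_cancel, rule Lim_null_comparison)
  define N where "N = (LINT x|lebn n. (norm (\<phi> x))\<^sup>2)"
  show "\<forall>\<^sub>F k in sequentially. norm ((LINT x|lebn n. F k x * \<phi> x) - (LINT x|lebn n. f x * \<phi> x)) \<le> 2 * (1 / 4) ^ k + N / 2 * (1 / 2) ^ k"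
  proof (intro always_eventually allI)
    fix k
    let ?d = "\<lambda>x. F k x - f x"
    have d: "square_integrable n ?d" using f by (intro square_integrable_diff)
    have "(LINT x|lebn n. F k x * \<phi> x) - (LINT x|lebn n. f x * \<phi> x) = (LINT x|lebn n. ?d x * \<phi> x)"
      using square_integrable_mult_integrable[OF f(1) \<phi>] square_integrable_mult_integrable[OF f(2) \<phi>]
      by (simp add: left_diff_distrib)
    also have "norm \<dots> \<le> (LINT x|lebn n. norm (?d x * \<phi> x))" by simp
    also have "\<dots> \<le> (LINT x|lebn n. 2 ^ k / 2 * (norm (?d x))\<^sup>2 + (1 / 2) ^ k / 2 * (norm (\<phi> x))\<^sup>2)"
    proof (rule integral_mono)
      show "integrable (lebn n) (\<lambda>x. norm (?d x * \<phi> x))"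
        by (intro integrable_norm square_integrable_mult_integrable d \<phi>)
      show "integrable (lebn n) (\<lambda>x. 2 ^ k / 2 * (norm (?d x))\<^sup>2 + (1 / 2) ^ k / 2 * (norm (\<phi> x))\<^sup>2)"
        using d \<phi> by (intro Bochner_Integration.integrable_add integrable_mult_right) (auto simp: square_integrable_def)
      fix x
      \<comment> \<open>The weight \<open>2 ^ k\<close> makes both contributions vanish: the rate
        \<open>(1 / 8) ^ k\<close> of the difference becomes \<open>(1 / 4) ^ k\<close>, and the
        fixed function is left with \<open>(1 / 2) ^ k\<close>.\<close>
      have "0 \<le> (2 ^ k * norm (?d x) - norm (\<phi> x))\<^sup>2 * (1 / 2) ^ k" by simp
      also have "\<dots> = 2 ^ k * (norm (?d x))\<^sup>2 + (1 / 2) ^ k * (norm (\<phi> x))\<^sup>2 - 2 * (norm (?d x) * norm (\<phi> x))"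
        by (simp add: power2_diff power_one_over field_simps power2_eq_square)
      finally show "norm (?d x * \<phi> x) \<le> 2 ^ k / 2 * (norm (?d x))\<^sup>2 + (1 / 2) ^ k / 2 * (norm (\<phi> x))\<^sup>2"
        by (simp add: norm_mult)
    qed
    also have "\<dots> = 2 ^ k / 2 * (LINT x|lebn n. (norm (?d x))\<^sup>2) + (1 / 2) ^ k / 2 * N"
      using d \<phi> by (simp add: N_def square_integrable_def)
    also have "\<dots> \<le> 2 ^ k / 2 * (4 * (1 / 8) ^ k) + (1 / 2) ^ k / 2 * N"
      by (intro add_right_mono mult_left_mono le) simp
    also have "\<dots> = 2 * (1 / 4) ^ k + N / 2 * (1 / 2) ^ k"
    proof -
      have "(2::real) ^ k * (1 / 8) ^ k = (1 / 4) ^ k" by (simp add: power_mult_distrib[symmetric])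
      then show ?thesis by simp
    qed
    finally show "norm ((LINT x|lebn n. F k x * \<phi> x) - (LINT x|lebn n. f x * \<phi> x)) \<le> 2 * (1 / 4) ^ k + N / 2 * (1 / 2) ^ k" .
  qed
  show "(\<lambda>k. 2 * (1 / 4) ^ k + N / 2 * (1 / 2) ^ k) \<longlonglongrightarrow> 0"
    by (auto intro!: tendsto_eq_intros LIMSEQ_realpow_zero)
qed

section \<open>Schur's test and contraction of the transform in mean square\<close>

lemma nn_integral_gauss_kernel:
  assumes "\<sigma> > 0"
  shows "(\<integral>\<^sup>+y. ennreal (gauss_kernel n \<sigma> x y) \<partial>lebn n) = 1"
  by (subst nn_integral_eq_integral) (simp_all add: integrable_gauss_kernel integral_gauss_kernel assms)

text \<open>Schur's test: after \<open>2 |a x| |a y| \<le> |a x|^2 + |a y|^2\<close> each summand is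
  integrated first in the variable on which only the kernel depends. By symmetry the kernel has mass
  1 in either variable. Extended integrals avoid any integrability assumption on
  \<open>a\<close>.\<close>

lemma nn_integral_gauss_kernel_bilinear:
  assumes "\<sigma> > 0" and [measurable]: "a \<in> borel_measurable (lebn n)"
  shows "(\<integral>\<^sup>+x. ennreal (norm (a x :: complex)) * (\<integral>\<^sup>+y. ennreal (gauss_kernel n \<sigma> x y * norm (a y)) \<partial>lebn n) \<partial>lebn n)
      \<le> (\<integral>\<^sup>+x. ennreal ((norm (a x))\<^sup>2) \<partial>lebn n)"
proof -
  let ?G = "gauss_kernel n \<sigma>" and ?A = "\<lambda>x. ennreal ((norm (a x))\<^sup>2)"
  define I where "I = (\<integral>\<^sup>+x. ?A x \<partial>lebn n)"
  have pt: "2 * (ennreal (norm (a x)) * ennreal (?G x y * norm (a y))) \<le> ennreal (?G x y) * ?A x + ennreal (?G x y) * ?A y" for x y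
  proof -
    have "?G x y * (2 * (norm (a x) * norm (a y))) \<le> ?G x y * ((norm (a x))\<^sup>2 + (norm (a y))\<^sup>2)"
      using sum_squares_bound[of "norm (a x)" "norm (a y)"] by (intro mult_left_mono) auto
    then have "ennreal (?G x y * (2 * (norm (a x) * norm (a y)))) \<le> ennreal (?G x y * ((norm (a x))\<^sup>2 + (norm (a y))\<^sup>2))"
      by (rule ennreal_leI)
    then show ?thesis
      by (simp add: ennreal_mult[symmetric] ennreal_plus[symmetric] distrib_left mult_ac del: ennreal_plus
          flip: ennreal_numeral)
  qed
  have "2 * (\<integral>\<^sup>+x. ennreal (norm (a x)) * (\<integral>\<^sup>+y. ennreal (?G x y * norm (a y)) \<partial>lebn n) \<partial>lebn n)
      = (\<integral>\<^sup>+x. \<integral>\<^sup>+y. 2 * (ennreal (norm (a x)) * ennreal (?G x y * norm (a y))) \<partial>lebn n \<partial>lebn n)"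
    by (simp add: nn_integral_cmult)
  also have "\<dots> \<le> (\<integral>\<^sup>+x. \<integral>\<^sup>+y. ennreal (?G x y) * ?A x + ennreal (?G x y) * ?A y \<partial>lebn n \<partial>lebn n)"
    by (intro nn_integral_mono pt)
  also have "\<dots> = (\<integral>\<^sup>+x. (\<integral>\<^sup>+y. ennreal (?G x y) * ?A x \<partial>lebn n) + (\<integral>\<^sup>+y. ennreal (?G x y) * ?A y \<partial>lebn n) \<partial>lebn n)"
    by (simp add: nn_integral_add)
  also have "\<dots> = (\<integral>\<^sup>+x. \<integral>\<^sup>+y. ennreal (?G x y) * ?A x \<partial>lebn n \<partial>lebn n) + (\<integral>\<^sup>+x. \<integral>\<^sup>+y. ennreal (?G x y) * ?A y \<partial>lebn n \<partial>lebn n)"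
    by (subst nn_integral_add) auto
  also have "(\<integral>\<^sup>+x. \<integral>\<^sup>+y. ennreal (?G x y) * ?A x \<partial>lebn n \<partial>lebn n) = I"
    by (simp add: nn_integral_multc nn_integral_gauss_kernel[OF \<open>\<sigma> > 0\<close>] I_def)
  also have "(\<integral>\<^sup>+x. \<integral>\<^sup>+y. ennreal (?G x y) * ?A y \<partial>lebn n \<partial>lebn n) = (\<integral>\<^sup>+y. \<integral>\<^sup>+x. ennreal (?G x y) * ?A y \<partial>lebn n \<partial>lebn n)"
    by (rule lebn_pair.Fubini'[symmetric]) measurable
  also have "\<dots> = I"
    by (subst gauss_kernel_commute) (simp add: nn_integral_multc nn_integral_gauss_kernel[OF \<open>\<sigma> > 0\<close>] I_def)
  finally have "2 * (\<integral>\<^sup>+x. ennreal (norm (a x)) * (\<integral>\<^sup>+y. ennreal (?G x y * norm (a y)) \<partial>lebn n) \<partial>lebn n) \<le> 2 * I"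
    by (simp add: mult_2)
  then show ?thesis unfolding I_def by (subst (asm) ennreal_mult_le_mult_iff) auto
qed

text \<open>By the multiplication formula, the Gaussian-weighted integral of
  \<open>|fourier n g|^2\<close> equals the pairing of \<open>g\<close> with the transform of the
  weighted conjugate. That transform is the Gaussian average of the conjugate of \<open>g\<close>,
  so Schur's test applies, and Fatou's lemma removes the weight. If \<open>g\<close> is not square
  integrable, the right-hand side is infinite.\<close>

theorem fourier_L2_contraction_integrable:
  assumes g: "integrable (lebn n) g"
  shows "(\<integral>\<^sup>+\<xi>. ennreal ((norm (fourier n g \<xi>))\<^sup>2) \<partial>lebn n) \<le> (\<integral>\<^sup>+x. ennreal ((norm (g x))\<^sup>2) \<partial>lebn n)"
proof -
  have [measurable]: "g \<in> borel_measurable (lebn n)" using g by simp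
  define D where "D = (2 * pi) powr (- real n / 2) * (LINT x|lebn n. norm (g x))"
  have D: "norm (fourier n g \<xi>) \<le> D" for \<xi> unfolding D_def by (rule norm_fourier_le[OF g])
  have damped: "(\<integral>\<^sup>+\<xi>. ennreal (gauss_weight n \<sigma> \<xi> * (norm (fourier n g \<xi>))\<^sup>2) \<partial>lebn n) \<le> (\<integral>\<^sup>+x. ennreal ((norm (g x))\<^sup>2) \<partial>lebn n)"
    if "\<sigma> > 0" for \<sigma>
  proof -
    define \<psi> where "\<psi> = (\<lambda>\<xi>. of_real (gauss_weight n \<sigma> \<xi>) * inverse_fourier n (\<lambda>x. cnj (g x)) \<xi>)"
    have cnjF: "inverse_fourier n (\<lambda>x. cnj (g x)) \<xi> = cnj (fourier n g \<xi>)" for \<xi> by (simp add: inverse_fourier_def)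
    have \<psi>: "integrable (lebn n) \<psi>"
      unfolding \<psi>_def by (rule gauss_weight_mult_integrable[OF _ _ that, of _ _ D]) (simp_all add: cnjF D)
    have "integrable (lebn n) (\<lambda>\<xi>. of_real (gauss_weight n \<sigma> \<xi>) * of_real ((norm (fourier n g \<xi>))\<^sup>2) :: complex)"
      using power_mono[OF D norm_ge_zero]
      by (intro gauss_weight_mult_integrable[OF _ _ that, of _ _ "D\<^sup>2"]) (auto simp: norm_power)
    then have "integrable (lebn n) (\<lambda>\<xi>. Re (of_real (gauss_weight n \<sigma> \<xi>) * of_real ((norm (fourier n g \<xi>))\<^sup>2)))"
      by (rule integrable_Re)
    then have int: "integrable (lebn n) (\<lambda>\<xi>. gauss_weight n \<sigma> \<xi> * (norm (fourier n g \<xi>))\<^sup>2)" by simp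
    have "complex_of_real (LINT \<xi>|lebn n. gauss_weight n \<sigma> \<xi> * (norm (fourier n g \<xi>))\<^sup>2)
        = (LINT \<xi>|lebn n. fourier n g \<xi> * \<psi> \<xi>)"
      unfolding integral_complex_of_real[symmetric] \<psi>_def cnjF
      by (intro Bochner_Integration.integral_cong refl) (simp add: complex_norm_square[symmetric] mult_ac)
    also have "\<dots> = (LINT x|lebn n. g x * fourier n \<psi> x)" by (rule fourier_multiplication[OF g \<psi>])
    finally have eq: "complex_of_real (LINT \<xi>|lebn n. gauss_weight n \<sigma> \<xi> * (norm (fourier n g \<xi>))\<^sup>2)
      = (LINT x|lebn n. g x * fourier n \<psi> x)" .
    have "(\<integral>\<^sup>+\<xi>. ennreal (gauss_weight n \<sigma> \<xi> * (norm (fourier n g \<xi>))\<^sup>2) \<partial>lebn n)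
        = ennreal (LINT \<xi>|lebn n. gauss_weight n \<sigma> \<xi> * (norm (fourier n g \<xi>))\<^sup>2)"
      by (rule nn_integral_eq_integral[OF int]) (simp add: gauss_weight_bounds)
    also have "\<dots> \<le> ennreal (norm (LINT x|lebn n. g x * fourier n \<psi> x))"
      unfolding eq[symmetric] by (simp add: ennreal_leI)
    also have "\<dots> \<le> (\<integral>\<^sup>+x. ennreal (norm (g x * fourier n \<psi> x)) \<partial>lebn n)"
    \<comment> \<open>A function that is not integrable has integral 0 by convention, so the norm
      bound is trivial in that case.\<close>
    proof (cases "integrable (lebn n) (\<lambda>x. g x * fourier n \<psi> x)")
      case True
      then show ?thesis by (rule integral_norm_bound_ennreal)
    qed (simp add: not_integrable_integral_eq)
    also have "\<dots> \<le> (\<integral>\<^sup>+x. ennreal (norm (g x)) * (\<integral>\<^sup>+y. ennreal (gauss_kernel n \<sigma> x y * norm (g y)) \<partial>lebn n) \<partial>lebn n)"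
    proof (rule nn_integral_mono)
      fix x
      have "ennreal (norm (fourier n \<psi> x)) \<le> (\<integral>\<^sup>+y. ennreal (gauss_kernel n \<sigma> x y * norm (g y)) \<partial>lebn n)"
      proof -
        have F: "fourier n \<psi> x = (LINT y|lebn n. of_real (gauss_kernel n \<sigma> x y) * cnj (g y))"
          unfolding \<psi>_def using g by (intro fourier_gauss_weight_inverse_fourier that) simp
        show ?thesis
        proof (cases "integrable (lebn n) (\<lambda>y. of_real (gauss_kernel n \<sigma> x y) * cnj (g y))")
          case True
          then show ?thesis using integral_norm_bound_ennreal[OF True] by (simp add: F norm_mult)
        qed (simp add: F not_integrable_integral_eq)
      qed
      then show "ennreal (norm (g x * fourier n \<psi> x))
          \<le> ennreal (norm (g x)) * (\<integral>\<^sup>+y. ennreal (gauss_kernel n \<sigma> x y * norm (g y)) \<partial>lebn n)"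
        by (simp add: norm_mult ennreal_mult mult_left_mono)
    qed
    also have "\<dots> \<le> (\<integral>\<^sup>+x. ennreal ((norm (g x))\<^sup>2) \<partial>lebn n)"
      by (rule nn_integral_gauss_kernel_bilinear[OF that]) measurable
    finally show ?thesis .
  qed
  have "(\<integral>\<^sup>+\<xi>. ennreal ((norm (fourier n g \<xi>))\<^sup>2) \<partial>lebn n)
      = (\<integral>\<^sup>+\<xi>. liminf (\<lambda>k. ennreal (gauss_weight n (1 / Suc k) \<xi> * (norm (fourier n g \<xi>))\<^sup>2)) \<partial>lebn n)"
  proof (intro nn_integral_cong)
    fix \<xi>
    have "(\<lambda>k. ennreal (gauss_weight n (1 / Suc k) \<xi> * (norm (fourier n g \<xi>))\<^sup>2)) \<longlonglongrightarrow> ennreal (1 * (norm (fourier n g \<xi>))\<^sup>2)"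
      by (intro tendsto_ennrealI tendsto_mult gauss_weight_tendsto tendsto_const)
    then show "ennreal ((norm (fourier n g \<xi>))\<^sup>2) = liminf (\<lambda>k. ennreal (gauss_weight n (1 / Suc k) \<xi> * (norm (fourier n g \<xi>))\<^sup>2))"
      by (simp add: lim_imp_Liminf)
  qed
  also have "\<dots> \<le> liminf (\<lambda>k. \<integral>\<^sup>+\<xi>. ennreal (gauss_weight n (1 / Suc k) \<xi> * (norm (fourier n g \<xi>))\<^sup>2) \<partial>lebn n)"
    by (rule nn_integral_liminf) measurable
  also have "\<dots> \<le> liminf (\<lambda>k::nat. \<integral>\<^sup>+x. ennreal ((norm (g x))\<^sup>2) \<partial>lebn n)"
    by (intro Liminf_mono always_eventually allI damped) simp
  also have "\<dots> = (\<integral>\<^sup>+x. ennreal ((norm (g x))\<^sup>2) \<partial>lebn n)" by (simp add: Liminf_const)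
  finally show ?thesis .
qed

text \<open>Completeness in mean square for a sequence with geometric rate. Multiplying the squared
  steps by \<open>4 ^ k\<close> still gives a finite total integral, which forces the steps to be at
  most a multiple of \<open>(1 / 2) ^ k\<close> almost everywhere. Fatou's lemma carries the
  estimates to the pointwise limit.\<close>

lemma rapidly_Cauchy_L2_limit:
  assumes [measurable]: "\<And>k. h k \<in> borel_measurable (lebn n)"
    and cauchy: "\<And>j k. j \<ge> k \<Longrightarrow> (\<integral>\<^sup>+x. ennreal ((norm (h j x - h k x :: complex))\<^sup>2) \<partial>lebn n) \<le> ennreal (4 * (1 / 8) ^ k)"
  obtains l where "l \<in> borel_measurable (lebn n)"
    "\<And>k. (\<integral>\<^sup>+x. ennreal ((norm (h k x - l x))\<^sup>2) \<partial>lebn n) \<le> ennreal (4 * (1 / 8) ^ k)"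
    "\<forall>C. (\<forall>k. (\<integral>\<^sup>+x. ennreal ((norm (h k x))\<^sup>2) \<partial>lebn n) \<le> C) \<longrightarrow> (\<integral>\<^sup>+x. ennreal ((norm (l x))\<^sup>2) \<partial>lebn n) \<le> C"
proof -
  define d where "d = (\<lambda>k x. norm (h (Suc k) x - h k x))"
  have "(\<integral>\<^sup>+x. (\<Sum>k. ennreal (4 ^ k * (d k x)\<^sup>2)) \<partial>lebn n) = (\<Sum>k. \<integral>\<^sup>+x. ennreal (4 ^ k * (d k x)\<^sup>2) \<partial>lebn n)"
    unfolding d_def by (intro nn_integral_suminf) measurable
  also have "\<dots> \<le> (\<Sum>k. ennreal (4 * (1 / 2) ^ k))"
  proof (intro suminf_le summableI)
    fix k
    have "(\<integral>\<^sup>+x. ennreal (4 ^ k * (d k x)\<^sup>2) \<partial>lebn n) = ennreal (4 ^ k) * (\<integral>\<^sup>+x. ennreal ((d k x)\<^sup>2) \<partial>lebn n)"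
      unfolding d_def by (simp add: ennreal_mult nn_integral_cmult)
    also have "\<dots> \<le> ennreal (4 ^ k) * ennreal (4 * (1 / 8) ^ k)"
      unfolding d_def by (intro mult_left_mono cauchy) auto
    also have "\<dots> = ennreal (4 * (1 / 2) ^ k)"
    proof -
      have "(4::real) ^ k * (1 / 8) ^ k = (1 / 2) ^ k" by (simp add: power_mult_distrib[symmetric])
      then show ?thesis by (simp add: ennreal_mult[symmetric])
    qed
    finally show "(\<integral>\<^sup>+x. ennreal (4 ^ k * (d k x)\<^sup>2) \<partial>lebn n) \<le> ennreal (4 * (1 / 2) ^ k)" .
  qed
  also have "\<dots> = ennreal (\<Sum>k. 4 * (1 / 2) ^ k)"
    by (rule suminf_ennreal2) (auto intro!: summable_mult summable_geometric)
  finally have fin: "(\<integral>\<^sup>+x. (\<Sum>k. ennreal (4 ^ k * (d k x)\<^sup>2)) \<partial>lebn n) \<noteq> \<infinity>"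
    by (metis ennreal_less_top infinity_ennreal_def leD)
  have ae: "AE x in lebn n. (\<Sum>k. ennreal (4 ^ k * (d k x)\<^sup>2)) \<noteq> \<infinity>"
    by (rule nn_integral_PInf_AE[OF _ fin]) (unfold d_def, measurable)
  \<comment> \<open>On the null set where the sequence diverges \<open>lim\<close> has an
    unspecified value; \<open>l\<close> is nevertheless measurable.\<close>
  define l where "l = (\<lambda>x. lim (\<lambda>k. h k x))"
  have l[measurable]: "l \<in> borel_measurable (lebn n)" unfolding l_def by measurable
  have conv: "AE x in lebn n. (\<lambda>k. h k x) \<longlonglongrightarrow> l x"
    using ae
  proof eventually_elim
    case (elim x)
    define S where "S = (\<Sum>k. ennreal (4 ^ k * (d k x)\<^sup>2))"
    define C where "C = enn2real S"
    have "S \<noteq> \<infinity>" using elim unfolding S_def .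
    then have "S < top" by (simp add: top.not_eq_extremum)
    then have "ennreal C = S" unfolding C_def by (rule ennreal_enn2real)
    then have C: "C \<ge> 0" "S = ennreal C" by (simp_all add: C_def)
    have "d k x \<le> sqrt C * (1 / 2) ^ k" for k
    proof -
      have "(\<Sum>k\<in>{k}. ennreal (4 ^ k * (d k x)\<^sup>2)) \<le> S"
        unfolding S_def by (rule sum_le_suminf[OF summableI]) (rule finite.intros zero_le)+
      then have "ennreal (4 ^ k * (d k x)\<^sup>2) \<le> ennreal C"
        unfolding C(2) by (simp only: sum.insert sum.empty finite.emptyI empty_iff not_False_eq_True add_0_right)
      then have "4 ^ k * (d k x)\<^sup>2 \<le> C" using C(1) by (simp only: ennreal_le_iff)
      moreover have "((2::real) ^ k)\<^sup>2 = 4 ^ k" by (simp add: power2_eq_square flip: power_mult_distrib)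
      ultimately have "(2 ^ k * d k x)\<^sup>2 \<le> C" by (simp only: power_mult_distrib)
      then have "2 ^ k * d k x \<le> sqrt C" by (rule real_le_rsqrt)
      then show ?thesis by (simp add: field_simps power_one_over)
    qed
    then have dle: "norm (norm (h (Suc k) x - h k x)) \<le> sqrt C * (1 / 2) ^ k" for k by (simp add: d_def)
    have "summable (\<lambda>k. sqrt C * (1 / 2) ^ k)" by (intro summable_mult summable_geometric) simp
    then have "summable (\<lambda>k. norm (h (Suc k) x - h k x))"
      by (rule summable_comparison_test') (rule dle)
    then have "summable (\<lambda>k. h (Suc k) x - h k x)" by (rule summable_norm_cancel)
    then have "convergent (\<lambda>k. \<Sum>i<k. h (Suc i) x - h i x)" by (simp add: summable_iff_convergent)
    then have "convergent (\<lambda>k. h k x - h 0 x)" by (simp add: sum_lessThan_telescope[of "\<lambda>k. h k x"])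
    then have "convergent (\<lambda>k. h k x)"
      using convergent_diff_const_right_iff by blast
    then show ?case by (simp add: l_def convergent_LIMSEQ_iff)
  qed
  show thesis
  proof (rule that[OF l])
    fix k
    have "(\<integral>\<^sup>+x. ennreal ((norm (h k x - l x))\<^sup>2) \<partial>lebn n) = (\<integral>\<^sup>+x. liminf (\<lambda>j. ennreal ((norm (h (j + k) x - h k x))\<^sup>2)) \<partial>lebn n)"
    proof (rule nn_integral_cong_AE, use conv in eventually_elim)
      case (elim x)
      have "(\<lambda>j. ennreal ((norm (h (j + k) x - h k x))\<^sup>2)) \<longlonglongrightarrow> ennreal ((norm (l x - h k x))\<^sup>2)"
        by (intro tendsto_ennrealI tendsto_intros LIMSEQ_ignore_initial_segment elim)
      from lim_imp_Liminf[OF trivial_limit_sequentially this] show ?case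
        by (simp add: norm_minus_commute[of _ "l x"])
    qed
    also have "\<dots> \<le> liminf (\<lambda>j. \<integral>\<^sup>+x. ennreal ((norm (h (j + k) x - h k x))\<^sup>2) \<partial>lebn n)"
      by (rule nn_integral_liminf) measurable
    also have "\<dots> \<le> liminf (\<lambda>j::nat. ennreal (4 * (1 / 8) ^ k))"
      by (intro Liminf_mono always_eventually allI cauchy) simp
    finally show "(\<integral>\<^sup>+x. ennreal ((norm (h k x - l x))\<^sup>2) \<partial>lebn n) \<le> ennreal (4 * (1 / 8) ^ k)"
      by (simp add: Liminf_const)
  next
    have "(\<integral>\<^sup>+x. ennreal ((norm (l x))\<^sup>2) \<partial>lebn n) \<le> C" if C: "\<And>k. (\<integral>\<^sup>+x. ennreal ((norm (h k x))\<^sup>2) \<partial>lebn n) \<le> C" for C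
    proof -
      have "(\<integral>\<^sup>+x. ennreal ((norm (l x))\<^sup>2) \<partial>lebn n) = (\<integral>\<^sup>+x. liminf (\<lambda>j. ennreal ((norm (h j x))\<^sup>2)) \<partial>lebn n)"
      proof (rule nn_integral_cong_AE, use conv in eventually_elim)
        case (elim x)
        have "(\<lambda>j. ennreal ((norm (h j x))\<^sup>2)) \<longlonglongrightarrow> ennreal ((norm (l x))\<^sup>2)"
          by (intro tendsto_ennrealI tendsto_intros elim)
        from lim_imp_Liminf[OF trivial_limit_sequentially this] show ?case by (rule sym)
      qed
      also have "\<dots> \<le> liminf (\<lambda>j. \<integral>\<^sup>+x. ennreal ((norm (h j x))\<^sup>2) \<partial>lebn n)"
        by (rule nn_integral_liminf) measurable
      also have "\<dots> \<le> liminf (\<lambda>j::nat. C)"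
        by (intro Liminf_mono always_eventually allI C)
      finally show ?thesis by (simp add: Liminf_const)
    qed
    then show "\<forall>C. (\<forall>k. (\<integral>\<^sup>+x. ennreal ((norm (h k x))\<^sup>2) \<partial>lebn n) \<le> C) \<longrightarrow> (\<integral>\<^sup>+x. ennreal ((norm (l x))\<^sup>2) \<partial>lebn n) \<le> C" by blast
  qed
qed

text \<open>Approximation by integrable functions, whose transforms are Cauchy by the contraction.
  The limit is characterised by the multiplication formula tested against Schwartz functions, which
  is exactly what a representing function has to satisfy.\<close>

theorem fourier_L2_extension:
  assumes f: "square_integrable n f"
  obtains h where "square_integrable n h" "L2norm_fun n h \<le> L2norm_fun n f"
    "\<And>\<phi>. \<phi> \<in> schwartz n \<Longrightarrow> (LINT x|lebn n. h x * \<phi> x) = (LINT x|lebn n. f x * fourier n \<phi> x)"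
proof -
  have [measurable]: "f \<in> borel_measurable (lebn n)" using f by (simp add: square_integrable_def)
  have f2: "integrable (lebn n) (\<lambda>x. (norm (f x))\<^sup>2)" using f by (simp add: square_integrable_def)
  \<comment> \<open>Cutting away small values makes f integrable: where \<open>norm (f x)\<close>
    exceeds \<open>1 / Suc m\<close>, it is at most \<open>Suc m\<close> times its square.\<close>
  define tr where "tr = (\<lambda>m::nat. \<lambda>x. if norm (f x) > 1 / Suc m then f x else 0)"
  have tr_meas [measurable]: "tr m \<in> borel_measurable (lebn n)" for m unfolding tr_def by measurable
  have tr_le: "norm (tr m x) \<le> norm (f x)" for m x by (simp add: tr_def)
  have tr_diff_le: "norm (tr m x - f x) \<le> norm (f x)" for m x by (simp add: tr_def)
  have tr_int: "integrable (lebn n) (tr m)" for m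
  proof (rule Bochner_Integration.integrable_bound)
    show "integrable (lebn n) (\<lambda>x. Suc m * (norm (f x))\<^sup>2)" using f2 by simp
    show "AE x in lebn n. norm (tr m x) \<le> norm (Suc m * (norm (f x))\<^sup>2)"
    proof (rule AE_I2)
      fix x
      show "norm (tr m x) \<le> norm (Suc m * (norm (f x))\<^sup>2)"
      proof (cases "norm (f x) > 1 / Suc m")
        case True
        then have "1 * norm (f x) \<le> (Suc m * norm (f x)) * norm (f x)"
          by (intro mult_right_mono) (auto simp: field_simps)
        then show ?thesis using True by (simp add: tr_def power2_eq_square mult.assoc)
      qed (simp add: tr_def)
    qed
  qed simp
  have tr_sq: "square_integrable n (tr m)" for m
    unfolding square_integrable_def
    by (auto intro!: Bochner_Integration.integrable_bound[OF f2] power_mono tr_le)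
  have "(\<lambda>m. LINT x|lebn n. (norm (tr m x - f x))\<^sup>2) \<longlonglongrightarrow> (LINT x|lebn n. 0)"
  proof (rule integral_dominated_convergence[OF _ _ f2])
    show "AE x in lebn n. (\<lambda>m. (norm (tr m x - f x))\<^sup>2) \<longlonglongrightarrow> 0"
    proof (rule AE_I2)
      fix x
      have "\<forall>\<^sub>F m in sequentially. tr m x = f x"
      proof (cases "f x = 0")
        case False
        have "(\<lambda>m. 1 / real (Suc m)) \<longlonglongrightarrow> 0" by real_asymp
        then have "\<forall>\<^sub>F m in sequentially. 1 / real (Suc m) < norm (f x)" using False by (intro order_tendstoD) auto
        then show ?thesis by eventually_elim (simp add: tr_def)
      qed (simp add: tr_def)
      then have "\<forall>\<^sub>F m in sequentially. (norm (tr m x - f x))\<^sup>2 = 0" by eventually_elim simp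
      then show "(\<lambda>m. (norm (tr m x - f x))\<^sup>2) \<longlonglongrightarrow> 0" by (rule tendsto_eventually)
    qed
    show "AE x in lebn n. norm ((norm (tr m x - f x))\<^sup>2) \<le> (norm (f x))\<^sup>2" for m
      by (auto intro!: power_mono tr_diff_le)
  qed measurable
  then have lim: "(\<lambda>m. LINT x|lebn n. (norm (tr m x - f x))\<^sup>2) \<longlonglongrightarrow> 0" by simp
  have "\<exists>m. (LINT x|lebn n. (norm (tr m x - f x))\<^sup>2) < (1 / 8) ^ k" for k
    using order_tendstoD(2)[OF lim, of "(1 / 8) ^ k"] by (auto simp: eventually_sequentially)
  \<comment> \<open>Two members of this sequence differ in squared norm by at most twice the sum of
    their errors; for the larger index this gives the constant 4 in the rate.\<close>
  then obtain r where r: "\<And>k. (LINT x|lebn n. (norm (tr (r k) x - f x))\<^sup>2) < (1 / 8) ^ k" by metis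
  define g where "g = (\<lambda>k. tr (r k))"
  have g_int: "integrable (lebn n) (g k)" and g_sq: "square_integrable n (g k)" for k
    unfolding g_def by (rule tr_int tr_sq)+
  have [measurable]: "g k \<in> borel_measurable (lebn n)" for k unfolding g_def by measurable
  have gf: "square_integrable n (\<lambda>x. g k x - f x)" for k by (intro square_integrable_diff g_sq f)
  have gle: "(LINT x|lebn n. (norm (g k x - f x))\<^sup>2) \<le> (1 / 8) ^ k" for k using r[of k] by (simp add: g_def)
  have g_cauchy: "(\<integral>\<^sup>+x. ennreal ((norm (g j x - g k x))\<^sup>2) \<partial>lebn n) \<le> ennreal (4 * (1 / 8) ^ k)" if "j \<ge> k" for j k
  proof -
    have sq: "square_integrable n (\<lambda>x. g j x - g k x)" by (intro square_integrable_diff g_sq)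
    have "(LINT x|lebn n. (norm (g j x - g k x))\<^sup>2) \<le> (LINT x|lebn n. 2 * (norm (g j x - f x))\<^sup>2 + 2 * (norm (g k x - f x))\<^sup>2)"
    proof (rule integral_mono)
      show "integrable (lebn n) (\<lambda>x. 2 * (norm (g j x - f x))\<^sup>2 + 2 * (norm (g k x - f x))\<^sup>2)"
        using gf by (simp add: square_integrable_def)
      show "(norm (g j x - g k x))\<^sup>2 \<le> 2 * (norm (g j x - f x))\<^sup>2 + 2 * (norm (g k x - f x))\<^sup>2" for x
        using power2_norm_diff_le[of "g j x - f x" "g k x - f x"] by simp
    qed (use sq in \<open>simp add: square_integrable_def\<close>)
    also have "\<dots> = 2 * (LINT x|lebn n. (norm (g j x - f x))\<^sup>2) + 2 * (LINT x|lebn n. (norm (g k x - f x))\<^sup>2)"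
      using gf by (simp add: square_integrable_def)
    also have "\<dots> \<le> 2 * (1 / 8) ^ j + 2 * (1 / 8) ^ k" by (intro add_mono mult_left_mono gle) auto
    also have "\<dots> \<le> 2 * (1 / 8) ^ k + 2 * (1 / 8) ^ k"
      using that by (intro add_mono mult_left_mono power_decreasing) auto
    finally show ?thesis
      using sq by (subst nn_integral_eq_integral) (auto simp: square_integrable_def intro!: ennreal_leI)
  qed
  define h where "h = (\<lambda>k. fourier n (g k))"
  have h_meas [measurable]: "h k \<in> borel_measurable (lebn n)" for k unfolding h_def by measurable
  have h_cauchy: "(\<integral>\<^sup>+x. ennreal ((norm (h j x - h k x))\<^sup>2) \<partial>lebn n) \<le> ennreal (4 * (1 / 8) ^ k)" if "j \<ge> k" for j k
    unfolding h_def fourier_diff[OF g_int g_int, symmetric]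
    by (rule order_trans[OF fourier_L2_contraction_integrable g_cauchy[OF that]])
      (intro Bochner_Integration.integrable_diff g_int)
  obtain l where l: "l \<in> borel_measurable (lebn n)"
    "\<And>k. (\<integral>\<^sup>+x. ennreal ((norm (h k x - l x))\<^sup>2) \<partial>lebn n) \<le> ennreal (4 * (1 / 8) ^ k)"
    "\<forall>C. (\<forall>k. (\<integral>\<^sup>+x. ennreal ((norm (h k x))\<^sup>2) \<partial>lebn n) \<le> C) \<longrightarrow> (\<integral>\<^sup>+x. ennreal ((norm (l x))\<^sup>2) \<partial>lebn n) \<le> C"
    by (rule rapidly_Cauchy_L2_limit[OF h_meas, OF h_cauchy, rotated]) (rule that)
  have [measurable]: "l \<in> borel_measurable (lebn n)" by (rule l)
  have h_le: "(\<integral>\<^sup>+x. ennreal ((norm (h k x))\<^sup>2) \<partial>lebn n) \<le> ennreal ((L2norm_fun n f)\<^sup>2)" for k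
  proof -
    have "(\<integral>\<^sup>+x. ennreal ((norm (h k x))\<^sup>2) \<partial>lebn n) \<le> (\<integral>\<^sup>+x. ennreal ((norm (g k x))\<^sup>2) \<partial>lebn n)"
      unfolding h_def by (rule fourier_L2_contraction_integrable[OF g_int])
    also have "\<dots> \<le> (\<integral>\<^sup>+x. ennreal ((norm (f x))\<^sup>2) \<partial>lebn n)"
      unfolding g_def by (intro nn_integral_mono ennreal_leI power_mono tr_le) auto
    finally show ?thesis by (simp add: nn_integral_norm_power2[OF f])
  qed
  have h_sq: "square_integrable n (h k)" for k by (rule square_integrableI_nn[OF h_meas h_le]) simp
  note l_le = l(3)[rule_format, OF h_le]
  have l_sq: "square_integrable n l" by (rule square_integrableI_nn[OF l(1) l_le]) simp
  show thesis
  proof (rule that[OF l_sq])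
    show "L2norm_fun n l \<le> L2norm_fun n f"
      using square_integrableI_nn(2)[OF l(1) l_le] unfolding L2norm_fun_power2[symmetric]
      by (rule power2_le_imp_le) simp_all
    fix \<phi> assume \<phi>: "\<phi> \<in> schwartz n"
    have 1: "(\<lambda>k. LINT x|lebn n. h k x * \<phi> x) \<longlonglongrightarrow> (LINT x|lebn n. l x * \<phi> x)"
      by (rule integral_mult_tendsto[OF l_sq h_sq schwartz_square_integrable[OF \<phi>]])
        (rule square_integrableI_nn(2)[OF _ l(2)], auto)
    have "(\<lambda>k. LINT x|lebn n. g k x * fourier n \<phi> x) \<longlonglongrightarrow> (LINT x|lebn n. f x * fourier n \<phi> x)"
      by (rule integral_mult_tendsto[OF f g_sq schwartz_square_integrable[OF fourier_schwartz[OF \<phi>]]])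
        (rule order_trans[OF gle], simp)
    then have 2: "(\<lambda>k. LINT x|lebn n. h k x * \<phi> x) \<longlonglongrightarrow> (LINT x|lebn n. f x * fourier n \<phi> x)"
      unfolding h_def fourier_multiplication[OF g_int schwartz_integrable[OF \<phi>]] .
    show "(LINT x|lebn n. l x * \<phi> x) = (LINT x|lebn n. f x * fourier n \<phi> x)"
      by (rule LIMSEQ_unique[OF 1 2])
  qed
qed

corollary inverse_fourier_L2_extension:
  assumes f: "square_integrable n f"
  obtains h where "square_integrable n h" "L2norm_fun n h \<le> L2norm_fun n f"
    "\<And>\<phi>. \<phi> \<in> schwartz n \<Longrightarrow> (LINT x|lebn n. h x * \<phi> x) = (LINT x|lebn n. f x * inverse_fourier n \<phi> x)"
proof -
  have "square_integrable n (\<lambda>x. cnj (f x))" using f by (simp add: square_integrable_def borel_measurable_cnj)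
  then obtain h where h: "square_integrable n h" "L2norm_fun n h \<le> L2norm_fun n (\<lambda>x. cnj (f x))"
    "\<And>\<phi>. \<phi> \<in> schwartz n \<Longrightarrow> (LINT x|lebn n. h x * \<phi> x) = (LINT x|lebn n. cnj (f x) * fourier n \<phi> x)"
    by (rule fourier_L2_extension) (rule that)
  show thesis
  proof (rule that[of "\<lambda>x. cnj (h x)"])
    show "square_integrable n (\<lambda>x. cnj (h x))" using h(1) by (simp add: square_integrable_def borel_measurable_cnj)
    show "L2norm_fun n (\<lambda>x. cnj (h x)) \<le> L2norm_fun n f" using h(2) by (simp add: L2norm_fun_def)
    fix \<phi> assume \<phi>: "\<phi> \<in> schwartz n"
    have "(LINT x|lebn n. cnj (h x) * \<phi> x) = cnj (LINT x|lebn n. h x * cnj (\<phi> x))"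
      by (simp flip: Bochner_Integration.integral_cnj)
    also have "\<dots> = cnj (LINT x|lebn n. cnj (f x) * fourier n (\<lambda>x. cnj (\<phi> x)) x)"
      by (simp add: h(3)[OF schwartz_cnj[OF \<phi>]])
    also have "\<dots> = (LINT x|lebn n. f x * inverse_fourier n \<phi> x)"
      by (simp add: inverse_fourier_def flip: Bochner_Integration.integral_cnj)
    finally show "(LINT x|lebn n. cnj (h x) * \<phi> x) = (LINT x|lebn n. f x * inverse_fourier n \<phi> x)" .
  qed
qed

section \<open>Uniqueness of representing functions\<close>

text \<open>The factors that repeated differentiation brings out of \<open>smooth_cutoff\<close>.
  What counts is closure under derivatives and at most exponential growth, which a Gaussian
  outweighs.\<close>

inductive expoly :: "(real \<Rightarrow> real) \<Rightarrow> bool" where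
  const: "expoly (\<lambda>t. c)"
| ident: "expoly (\<lambda>t. t)"
| exp: "expoly (\<lambda>t. exp (c * t))"
| add: "expoly P \<Longrightarrow> expoly Q \<Longrightarrow> expoly (\<lambda>t. P t + Q t)"
| mult: "expoly P \<Longrightarrow> expoly Q \<Longrightarrow> expoly (\<lambda>t. P t * Q t)"

lemma expoly_derivative:
  assumes "expoly P"
  shows "\<exists>P'. expoly P' \<and> (\<forall>t. (P has_real_derivative P' t) (at t))"
  using assms
proof induction
  case (const c)
  show ?case by (intro exI[of _ "\<lambda>t. 0"]) (auto intro: expoly.const)
next
  case ident
  show ?case by (intro exI[of _ "\<lambda>t. 1"]) (auto intro: expoly.const)
next
  case (exp c)
  show ?case
    by (intro exI[of _ "\<lambda>t. c * exp (c * t)"])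
      (auto intro!: expoly.mult expoly.const expoly.exp derivative_eq_intros)
next
  case (add P Q)
  then obtain P' Q' where "expoly P'" "\<forall>t. (P has_real_derivative P' t) (at t)"
    "expoly Q'" "\<forall>t. (Q has_real_derivative Q' t) (at t)" by blast
  then show ?case
    by (intro exI[of _ "\<lambda>t. P' t + Q' t"]) (auto intro!: expoly.add DERIV_add)
next
  case (mult P Q)
  then obtain P' Q' where "expoly P'" "\<forall>t. (P has_real_derivative P' t) (at t)"
    "expoly Q'" "\<forall>t. (Q has_real_derivative Q' t) (at t)" by blast
  then show ?case using mult
    by (intro exI[of _ "\<lambda>t. P' t * Q t + Q' t * P t"]) (auto intro!: expoly.add expoly.mult DERIV_mult)
qed

lemma expoly_growth:
  assumes "expoly P"
  shows "\<exists>C D. C \<ge> 0 \<and> D \<ge> 0 \<and> (\<forall>t. \<bar>P t\<bar> \<le> C * exp (D * \<bar>t\<bar>))"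
  using assms
proof induction
  case (const c)
  show ?case by (rule exI[of _ "\<bar>c\<bar>"], rule exI[of _ 0]) simp
next
  case ident
  have "\<bar>t\<bar> \<le> exp \<bar>t\<bar>" for t :: real using exp_ge_add_one_self[of "\<bar>t\<bar>"] by linarith
  then show ?case by (intro exI[of _ 1]) simp
next
  case (exp c)
  show ?case
  proof (rule exI[of _ 1], rule exI[of _ "\<bar>c\<bar>"], intro conjI allI)
    fix t
    have "c * t \<le> \<bar>c\<bar> * \<bar>t\<bar>" by (simp add: abs_mult[symmetric])
    then show "\<bar>exp (c * t)\<bar> \<le> 1 * exp (\<bar>c\<bar> * \<bar>t\<bar>)" by simp
  qed auto
next
  case (add P Q)
  then obtain C D C' D' where C: "C \<ge> 0" "D \<ge> 0" "\<And>t. \<bar>P t\<bar> \<le> C * exp (D * \<bar>t\<bar>)"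
    and C': "C' \<ge> 0" "D' \<ge> 0" "\<And>t. \<bar>Q t\<bar> \<le> C' * exp (D' * \<bar>t\<bar>)" by blast
  show ?case
  proof (rule exI[of _ "C + C'"], rule exI[of _ "D + D'"], intro conjI allI)
    fix t
    have "C * exp (D * \<bar>t\<bar>) \<le> C * exp ((D + D') * \<bar>t\<bar>)" "C' * exp (D' * \<bar>t\<bar>) \<le> C' * exp ((D + D') * \<bar>t\<bar>)"
      using C C' by (intro mult_left_mono; simp add: mult_right_mono)+
    then show "\<bar>P t + Q t\<bar> \<le> (C + C') * exp ((D + D') * \<bar>t\<bar>)"
      using C(3)[of t] C'(3)[of t] unfolding distrib_right[of C] by linarith
  qed (use C C' in auto)
next
  case (mult P Q)
  then obtain C D C' D' where C: "C \<ge> 0" "D \<ge> 0" "\<And>t. \<bar>P t\<bar> \<le> C * exp (D * \<bar>t\<bar>)"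
    and C': "C' \<ge> 0" "D' \<ge> 0" "\<And>t. \<bar>Q t\<bar> \<le> C' * exp (D' * \<bar>t\<bar>)" by blast
  show ?case
  proof (rule exI[of _ "C * C'"], rule exI[of _ "D + D'"], intro conjI allI)
    fix t
    have "\<bar>P t\<bar> * \<bar>Q t\<bar> \<le> (C * exp (D * \<bar>t\<bar>)) * (C' * exp (D' * \<bar>t\<bar>))"
      using C C' by (intro mult_mono) auto
    also have "\<dots> = (C * C') * (exp (D * \<bar>t\<bar>) * exp (D' * \<bar>t\<bar>))" by simp
    finally show "\<bar>P t * Q t\<bar> \<le> (C * C') * exp ((D + D') * \<bar>t\<bar>)"
      by (simp only: abs_mult exp_add distrib_right)
  qed (use C C' in auto)
qed

text \<open>As \<open>j \<rightarrow> \<infinity>\<close>, these smooth functions converge pointwise to \<open>exp (- t\<^sup>2)\<close> times the indicator of \<open>t < a\<close>.\<close>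

definition smooth_cutoff :: "real \<Rightarrow> real \<Rightarrow> real \<Rightarrow> real" where
  "smooth_cutoff j a t = exp (- t\<^sup>2) * exp (- j * exp (j * (t - a)))"

text \<open>For t < a the inner exponential decays and beats the factor j in front of it. For t
  \<ge> a it is at least 1; that factor then still drives the whole to 0, including at t =
  a.\<close>

lemma smooth_cutoff_tendsto:
  "(\<lambda>j. smooth_cutoff (real j) a t) \<longlonglongrightarrow> exp (- t\<^sup>2) * (if t < a then 1 else 0)"
proof -
  have "(\<lambda>j. exp (- real j * exp (real j * (t - a)))) \<longlonglongrightarrow> (if t < a then 1 else 0)"
  proof (cases "t < a")
    case True
    define c where "c = a - t"
    have "c > 0" using True by (simp add: c_def)
    then have "(\<lambda>j. exp (- real j * exp (real j * (- c)))) \<longlonglongrightarrow> 1" by real_asymp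
    then show ?thesis using True by (simp add: c_def)
  next
    case False
    have lim: "(\<lambda>j. exp (- real j)) \<longlonglongrightarrow> 0" by real_asymp
    have le: "exp (- real j * exp (real j * (t - a))) \<le> exp (- real j)" for j
    proof -
      have "1 \<le> exp (real j * (t - a))" using False by simp
      then have "real j * 1 \<le> real j * exp (real j * (t - a))" by (intro mult_left_mono) auto
      then show ?thesis by simp
    qed
    have "(\<lambda>j. exp (- real j * exp (real j * (t - a)))) \<longlonglongrightarrow> 0"
      by (rule tendsto_sandwich[OF always_eventually always_eventually tendsto_const lim]) (rule allI, rule exp_ge_zero le)+
    then show ?thesis using False by simp
  qed
  then show ?thesis unfolding smooth_cutoff_def by (intro tendsto_mult_left)
qed

lemma smooth_cutoff_bounds: "0 \<le> smooth_cutoff j a t" "j \<ge> 0 \<Longrightarrow> smooth_cutoff j a t \<le> exp (- t\<^sup>2)"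
  by (simp_all add: smooth_cutoff_def)

lemma expoly_smooth_cutoff_derivative:
  assumes "expoly P"
  shows "\<exists>P'. expoly P' \<and> (\<forall>t. ((\<lambda>t. P t * smooth_cutoff j a t) has_real_derivative P' t * smooth_cutoff j a t) (at t))"
proof -
  obtain P' where P': "expoly P'" "\<forall>t. (P has_real_derivative P' t) (at t)"
    using expoly_derivative[OF assms] by blast
  define R where "R = (\<lambda>t. P' t + P t * ((- 2) * t + (- j * j * exp (- j * a)) * exp (j * t)))"
  have "expoly R" unfolding R_def
    by (intro expoly.add expoly.mult expoly.const expoly.ident expoly.exp P' assms)
  moreover have "((\<lambda>t. P t * smooth_cutoff j a t) has_real_derivative R t * smooth_cutoff j a t) (at t)" for t
  proof -
    have "(smooth_cutoff j a has_real_derivative smooth_cutoff j a t * ((- 2) * t + (- j * j * exp (- j * a)) * exp (j * t))) (at t)"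
      unfolding smooth_cutoff_def[abs_def]
      by (auto intro!: derivative_eq_intros simp: algebra_simps exp_diff exp_minus divide_inverse)
    from DERIV_mult[OF P'(2)[rule_format] this] show ?thesis
      by (rule DERIV_cong) (simp add: R_def algebra_simps)
  qed
  ultimately show ?thesis by blast
qed

lemma expoly_smooth_cutoff_decay:
  assumes "expoly P" "j \<ge> 0"
  shows "\<exists>B\<ge>0. \<forall>t. (1 + \<bar>t\<bar>) ^ k * \<bar>P t * smooth_cutoff j a t\<bar> \<le> B"
proof -
  obtain C D where C: "C \<ge> 0" "D \<ge> 0" "\<And>t. \<bar>P t\<bar> \<le> C * exp (D * \<bar>t\<bar>)"
    using expoly_growth[OF assms(1)] by blast
  have "(1 + \<bar>t\<bar>) ^ k * \<bar>P t * smooth_cutoff j a t\<bar> \<le> C * exp ((real k + D)\<^sup>2 / 4)" for t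
  proof -
    have "(1 + \<bar>t\<bar>) ^ k \<le> exp \<bar>t\<bar> ^ k" by (intro power_mono) (auto simp: exp_ge_add_one_self)
    then have 1: "(1 + \<bar>t\<bar>) ^ k \<le> exp (real k * \<bar>t\<bar>)" by (simp add: exp_of_nat_mult)
    have 2: "\<bar>P t * smooth_cutoff j a t\<bar> \<le> C * exp (D * \<bar>t\<bar>) * exp (- t\<^sup>2)"
      unfolding abs_mult using C(3)[of t] smooth_cutoff_bounds[of j a t] assms(2) C(1)
      by (intro mult_mono) auto
    have "(1 + \<bar>t\<bar>) ^ k * \<bar>P t * smooth_cutoff j a t\<bar> \<le> exp (real k * \<bar>t\<bar>) * (C * exp (D * \<bar>t\<bar>) * exp (- t\<^sup>2))"
      by (intro mult_mono 1 2) auto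
    also have "\<dots> = C * (exp (real k * \<bar>t\<bar>) * exp (D * \<bar>t\<bar>) * exp (- t\<^sup>2))" by simp
    also have "\<dots> = C * exp ((real k + D) * \<bar>t\<bar> - t\<^sup>2)"
      by (simp only: exp_add[symmetric] distrib_right diff_conv_add_uminus)
    also have "\<dots> \<le> C * exp ((real k + D)\<^sup>2 / 4)"
    proof -
      \<comment> \<open>Completing the square: the exponent is largest at
        \<open>\<bar>t\<bar> = (real k + D) / 2\<close>.\<close>
      have "0 \<le> (\<bar>t\<bar> - (real k + D) / 2)\<^sup>2" by simp
      then have "(real k + D) * \<bar>t\<bar> - t\<^sup>2 \<le> (real k + D)\<^sup>2 / 4"
        by (simp add: power2_diff power_divide mult.commute)
      then show ?thesis using C(1) by (intro mult_left_mono) auto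
    qed
    finally show ?thesis .
  qed
  then show ?thesis using C(1) by (intro exI[of _ "C * exp ((real k + D)\<^sup>2 / 4)"]) auto
qed

lemma one_plus_euclid_norm_le_prod: "1 + euclid_norm n x \<le> (\<Prod>i<n. 1 + \<bar>x i\<bar>)"
  using euclid_norm_le_sum_abs[of n x] one_plus_sum_le_prod[of "\<lambda>i. \<bar>x i\<bar>" n] by simp

text \<open>Arbitrary prefactors from \<open>expoly\<close> make the family invariant, since a
  derivative in the l-th variable replaces the l-th prefactor only. The members of interest are
  those with all prefactors 1.\<close>

lemma schwartz_prod_expoly:
  assumes "\<And>i. expoly (P i)" and j: "j \<ge> 0"
  shows "(\<lambda>x. \<Prod>i<n. complex_of_real (P i (x i) * smooth_cutoff j (a i) (x i))) \<in> schwartz n"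
    (is "?f P \<in> _")
proof -
  have "?f P \<in> {?f P | P. \<forall>i. expoly (P i)}" using assms by blast
  then show ?thesis
  proof (coinduct rule: schwartz_coinduct)
    case (derivative f l)
    then obtain P where f: "f = ?f P" and P: "\<And>i. expoly (P i)" by blast
    obtain P' where P': "expoly P'" "\<And>t. ((\<lambda>t. P l t * smooth_cutoff j (a l) t) has_real_derivative P' t * smooth_cutoff j (a l) t) (at t)"
      using expoly_smooth_cutoff_derivative[OF P] by blast
    have "((\<lambda>s. f (x(l := s))) has_vector_derivative ?f (P(l := P')) x) (at (x l))" for x
    proof -
      define R where "R = (\<Prod>i\<in>{..<n} - {l}. complex_of_real (P i (x i) * smooth_cutoff j (a i) (x i)))"
      have l: "l \<in> {..<n}" using derivative by simp
      have 1: "f (x(l := s)) = of_real (P l s * smooth_cutoff j (a l) s) * R" for s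
        unfolding f R_def by (subst prod.remove[OF _ l]) (auto intro!: prod.cong)
      have 2: "?f (P(l := P')) x = of_real (P' (x l) * smooth_cutoff j (a l) (x l)) * R"
        unfolding R_def by (subst prod.remove[OF _ l]) (auto intro!: prod.cong)
      show ?thesis unfolding 1 2
        by (intro has_vector_derivative_mult_left has_vector_derivative_of_real)
          (simp add: P' flip: has_real_derivative_iff_has_vector_derivative)
    qed
    moreover have "\<forall>i. expoly ((P(l := P')) i)" using P P' by simp
    ultimately show ?case by (intro bexI[of _ "?f (P(l := P'))"]) blast+
  next
    case (decay f k)
    then obtain P where f: "f = ?f P" and P: "\<And>i. expoly (P i)" by blast
    have "\<exists>B\<ge>0. \<forall>t. (1 + \<bar>t\<bar>) ^ k * \<bar>P i t * smooth_cutoff j (a i) t\<bar> \<le> B" for i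
      by (rule expoly_smooth_cutoff_decay[OF P j])
    then obtain B where B: "\<And>i. B i \<ge> 0" "\<And>i t. (1 + \<bar>t\<bar>) ^ k * \<bar>P i t * smooth_cutoff j (a i) t\<bar> \<le> B i" by metis
    have "(1 + euclid_norm n x) ^ k * norm (f x) \<le> (\<Prod>i<n. B i)" for x
    proof -
      have "(1 + euclid_norm n x) ^ k * norm (f x) \<le> (\<Prod>i<n. 1 + \<bar>x i\<bar>) ^ k * norm (f x)"
        using one_plus_euclid_norm_le_prod[of n x] by (intro mult_right_mono power_mono) auto
      also have "\<dots> = (\<Prod>i<n. (1 + \<bar>x i\<bar>) ^ k * \<bar>P i (x i) * smooth_cutoff j (a i) (x i)\<bar>)"
        unfolding f by (simp add: prod.distrib prod_power_distrib norm_mult abs_mult prod_norm[symmetric])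
      also have "\<dots> \<le> (\<Prod>i<n. B i)" using B by (intro prod_mono) auto
      finally show ?thesis .
    qed
    then show ?case by blast
  qed
qed

section \<open>Orthants as a determining class\<close>

lemma sets_lebn_eq_sigma_orthants:
  "sets (lebn n) = sigma_sets (space (lebn n)) (range (\<lambda>a. {x \<in> space (lebn n). \<forall>i<n. x i < a i}))"
proof -
  have "sets (lebn n) = sets (Pi\<^sub>M {..<n} (\<lambda>_. sigma UNIV (range lessThan :: real set set)))"
    unfolding lebn_def by (intro sets_PiM_cong refl) (simp add: borel_Iio)
  also have "\<dots> = sets (sigma (\<Pi>\<^sub>E i\<in>{..<n}. UNIV) {{f\<in>(\<Pi>\<^sub>E i\<in>{..<n}. UNIV). \<forall>i\<in>j. f i \<in> A i} | A j. j \<in> {{..<n}} \<and> A \<in> Pi j (\<lambda>_. range lessThan)})"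
  proof (rule sets_PiM_sigma)
    show "\<exists>S\<subseteq>range lessThan. countable S \<and> (UNIV :: real set) = \<Union>S"
      by (intro exI[of _ "range (\<lambda>m::nat. {..<real m})"]) (auto intro: reals_Archimedean2)
  qed auto
  also have "{{f\<in>(\<Pi>\<^sub>E i\<in>{..<n}. UNIV). \<forall>i\<in>j. f i \<in> A i} | A j. j \<in> {{..<n}} \<and> A \<in> Pi j (\<lambda>_. range lessThan :: real set set)}
      = range (\<lambda>a. {x \<in> space (lebn n). \<forall>i<n. x i < a i})" (is "?L = ?R")
  proof (intro equalityI subsetI)
    fix X assume "X \<in> ?L"
    then obtain A where A: "X = {f\<in>(\<Pi>\<^sub>E i\<in>{..<n}. UNIV). \<forall>i\<in>{..<n}. f i \<in> A i}" "A \<in> {..<n} \<rightarrow> range lessThan" by blast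
    then have "\<forall>i\<in>{..<n}. \<exists>a. A i = {..<a}" by blast
    then obtain a where "\<forall>i\<in>{..<n}. A i = {..<a i}" by metis
    then have "X = {x \<in> space (lebn n). \<forall>i<n. x i < a i}" using A(1) by (auto simp: space_lebn PiE_def)
    then show "X \<in> ?R" by blast
  next
    fix X assume "X \<in> ?R"
    then obtain a where "X = {x \<in> space (lebn n). \<forall>i<n. x i < a i}" by blast
    then show "X \<in> ?L" by (intro CollectI exI[of _ "\<lambda>i. {..<a i}"] exI[of _ "{..<n}"]) (auto simp: space_lebn PiE_def)
  qed
  also have "(\<Pi>\<^sub>E i\<in>{..<n}. UNIV) = space (lebn n)" by (simp add: space_lebn PiE_def)
  finally show ?thesis by (subst (asm) sets_measure_of) auto
qed

text \<open>The positive and the negative part of \<open>u\<close> are densities of two finite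
  measures. They agree on the orthants, a generating family closed under intersection, hence
  everywhere, and densities are unique almost everywhere.\<close>

lemma AE_zero_if_orthant_integrals_zero:
  fixes u :: "vec \<Rightarrow> real"
  assumes u: "integrable (lebn n) u"
    and zero: "\<And>a. (LINT x|lebn n. u x * indicator {x \<in> space (lebn n). \<forall>i<n. x i < a i} x) = 0"
  shows "AE x in lebn n. u x = 0"
proof -
  let ?Q = "\<lambda>a. {x \<in> space (lebn n). \<forall>i<n. x i < a i}"
  have [measurable]: "u \<in> borel_measurable (lebn n)" using u by simp
  have Q: "?Q a \<in> sets (lebn n)" for a
    unfolding sets_lebn_eq_sigma_orthants by (intro sigma_sets.Basic) blast
  define f where "f = (\<lambda>x. ennreal (u x))"
  define g where "g = (\<lambda>x. ennreal (- u x))"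
  have fg[measurable]: "f \<in> borel_measurable (lebn n)" "g \<in> borel_measurable (lebn n)" unfolding f_def g_def by measurable
  have fin: "(\<integral>\<^sup>+x. f x \<partial>lebn n) < \<infinity>" "(\<integral>\<^sup>+x. g x \<partial>lebn n) < \<infinity>"
    using u unfolding real_integrable_def f_def g_def by (auto simp: less_top)
  have eq: "emeasure (density (lebn n) f) (?Q a) = emeasure (density (lebn n) g) (?Q a)" for a
  proof -
    let ?v = "\<lambda>x. u x * indicator (?Q a) x"
    have v: "integrable (lebn n) ?v" by (rule integrable_real_mult_indicator[OF Q u])
    have f: "emeasure (density (lebn n) f) (?Q a) = (\<integral>\<^sup>+x. ennreal (?v x) \<partial>lebn n)"
      by (subst emeasure_density[OF fg(1) Q]) (auto simp: f_def indicator_def intro!: nn_integral_cong)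
    have g: "emeasure (density (lebn n) g) (?Q a) = (\<integral>\<^sup>+x. ennreal (- ?v x) \<partial>lebn n)"
      by (subst emeasure_density[OF fg(2) Q]) (auto simp: g_def indicator_def intro!: nn_integral_cong)
    have top: "(\<integral>\<^sup>+x. ennreal (?v x) \<partial>lebn n) < top" "(\<integral>\<^sup>+x. ennreal (- ?v x) \<partial>lebn n) < top"
      using v unfolding real_integrable_def by (auto simp: top.not_eq_extremum)
    have e: "enn2real (\<integral>\<^sup>+x. ennreal (?v x) \<partial>lebn n) = enn2real (\<integral>\<^sup>+x. ennreal (- ?v x) \<partial>lebn n)"
      using real_lebesgue_integral_def[OF v] zero[of a] by simp
    have "(\<integral>\<^sup>+x. ennreal (?v x) \<partial>lebn n) = ennreal (enn2real (\<integral>\<^sup>+x. ennreal (?v x) \<partial>lebn n))"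
      by (rule ennreal_enn2real[OF top(1), symmetric])
    also have "\<dots> = (\<integral>\<^sup>+x. ennreal (- ?v x) \<partial>lebn n)"
      unfolding e by (rule ennreal_enn2real[OF top(2)])
    finally show ?thesis unfolding f g .
  qed
  have "density (lebn n) f = density (lebn n) g"
  proof (rule measure_eqI_generator_eq[where E = "range ?Q" and A = "\<lambda>m. ?Q (\<lambda>_. real m)" and \<Omega> = "space (lebn n)"])
    show "Int_stable (range ?Q)"
    proof (rule Int_stableI_image)
      fix a b :: vec
      have "?Q a \<inter> ?Q b = ?Q (\<lambda>i. min (a i) (b i))" by auto
      then show "\<exists>c\<in>UNIV. ?Q a \<inter> ?Q b = ?Q c" by (intro bexI[of _ "\<lambda>i. min (a i) (b i)"] UNIV_I)
    qed
    show "(\<Union>m. ?Q (\<lambda>_. real m)) = space (lebn n)"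
    proof -
      have "\<exists>m::nat. \<forall>i<n. x i < real m" for x :: vec
      proof -
        obtain m :: nat where m: "(\<Sum>i<n. \<bar>x i\<bar>) < real m"
          using reals_Archimedean2[of "\<Sum>i<n. \<bar>x i\<bar>"] by (rule exE)
        have "x i < real m" if "i < n" for i
        proof -
          have "\<bar>x i\<bar> \<le> (\<Sum>i<n. \<bar>x i\<bar>)" using that by (intro member_le_sum) auto
          then show ?thesis using m by linarith
        qed
        then show ?thesis by blast
      qed
      then show ?thesis by auto
    qed
    show "emeasure (density (lebn n) f) (?Q (\<lambda>_. real m)) \<noteq> \<infinity>" for m
    proof -
      have "emeasure (density (lebn n) f) (?Q (\<lambda>_. real m)) \<le> emeasure (density (lebn n) f) (space (lebn n))"
        by (intro emeasure_mono) auto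
      also have "\<dots> = (\<integral>\<^sup>+x. f x \<partial>lebn n)"
        by (subst emeasure_density) (auto intro!: nn_integral_cong)
      finally show ?thesis using fin by auto
    qed
  qed (auto simp: eq sets_lebn_eq_sigma_orthants)
  then have "AE x in lebn n. f x = g x"
    by (subst (asm) lebn.density_unique_iff) auto
  then show ?thesis
  proof eventually_elim
    case (elim x)
    then show ?case unfolding f_def g_def by (cases "u x" "0::real" rule: linorder_cases) (auto simp: ennreal_neg ennreal_eq_0_iff)
  qed
qed

text \<open>Products of smooth cutoffs converge to a Gaussian \<open>w\<close> times the indicator
  of an orthant. The function \<open>k\<close> need not be integrable over an orthant, but
  \<open>k x * w x\<close> is, because \<open>w\<close> is itself a Schwartz function; it also
  dominates the approximants. As \<open>w\<close> has no zeros, \<open>k\<close> vanishes with the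
  product.\<close>

theorem AE_zero_if_schwartz_integrals_zero:
  fixes k :: "vec \<Rightarrow> complex"
  assumes [measurable]: "k \<in> borel_measurable (lebn n)"
    and int: "\<And>\<phi>. \<phi> \<in> schwartz n \<Longrightarrow> integrable (lebn n) (\<lambda>x. k x * \<phi> x)"
    and zero: "\<And>\<phi>. \<phi> \<in> schwartz n \<Longrightarrow> (LINT x|lebn n. k x * \<phi> x) = 0"
  shows "AE x in lebn n. k x = 0"
proof -
  define \<phi> where "\<phi> = (\<lambda>j a x. \<Prod>i<n. complex_of_real (smooth_cutoff j (a i) (x i)))"
  have \<phi>: "\<phi> j a \<in> schwartz n" if "j \<ge> 0" for j a
    using schwartz_prod_expoly[where P = "\<lambda>_ _. 1" and j = j and a = a and n = n] that
    by (simp add: \<phi>_def expoly.const)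
  define w where "w = (\<lambda>x. \<Prod>i<n. complex_of_real (exp (- (x i)\<^sup>2)))"
  have w: "w = \<phi> 0 (\<lambda>_. 0)" by (simp add: w_def \<phi>_def smooth_cutoff_def)
  have kw: "integrable (lebn n) (\<lambda>x. k x * w x)" unfolding w by (intro int \<phi>) simp
  let ?Q = "\<lambda>a. {x \<in> space (lebn n). \<forall>i<n. x i < a i}"
  have Q: "(LINT x|lebn n. (k x * w x) * indicator (?Q a) x) = 0" for a
  proof (rule LIMSEQ_unique)
    have "(\<lambda>j. LINT x|lebn n. k x * \<phi> (real j) a x) = (\<lambda>j. 0)" by (intro ext zero \<phi>) simp
    then show "(\<lambda>j. LINT x|lebn n. k x * \<phi> (real j) a x) \<longlonglongrightarrow> 0" by simp
    show "(\<lambda>j. LINT x|lebn n. k x * \<phi> (real j) a x) \<longlonglongrightarrow> (LINT x|lebn n. (k x * w x) * indicator (?Q a) x)"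
    proof (rule integral_dominated_convergence[where w = "\<lambda>x. norm (k x * w x)"])
      have "?Q a \<in> sets (lebn n)" unfolding sets_lebn_eq_sigma_orthants by (intro sigma_sets.Basic) blast
      then show "(\<lambda>x. (k x * w x) * indicator (?Q a) x) \<in> borel_measurable (lebn n)"
        by (intro borel_measurable_times borel_measurable_integrable[OF kw] borel_measurable_indicator)
      show "(\<lambda>x. k x * \<phi> (real j) a x) \<in> borel_measurable (lebn n)" for j
        using borel_measurable_integrable[OF int[OF \<phi>]] by simp
      show "integrable (lebn n) (\<lambda>x. norm (k x * w x))" by (rule integrable_norm[OF kw])
      show "AE x in lebn n. (\<lambda>j. k x * \<phi> (real j) a x) \<longlonglongrightarrow> (k x * w x) * indicator (?Q a) x"
      proof (rule AE_I2)
        fix x assume x: "x \<in> space (lebn n)"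
        have "(\<lambda>j. \<phi> (real j) a x) \<longlonglongrightarrow> (\<Prod>i<n. complex_of_real (exp (- (x i)\<^sup>2) * (if x i < a i then 1 else 0)))"
          unfolding \<phi>_def by (intro tendsto_prod tendsto_of_real smooth_cutoff_tendsto)
        also have "(\<Prod>i<n. complex_of_real (exp (- (x i)\<^sup>2) * (if x i < a i then 1 else 0))) = w x * indicator (?Q a) x"
        proof (cases "\<forall>i<n. x i < a i")
          case True
          then show ?thesis using x by (simp add: w_def)
        next
          case False
          then obtain i where "i < n" "\<not> x i < a i" by blast
          then have "(\<Prod>i<n. complex_of_real (exp (- (x i)\<^sup>2) * (if x i < a i then 1 else 0))) = 0"
            by (intro prod_zero) auto
          moreover have "indicator (?Q a) x = (0::complex)" using False by (auto simp: indicator_def)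
          ultimately show ?thesis by (simp only: mult_zero_right)
        qed
        finally show "(\<lambda>j. k x * \<phi> (real j) a x) \<longlonglongrightarrow> (k x * w x) * indicator (?Q a) x"
          unfolding mult.assoc by (intro tendsto_mult_left)
      qed
      show "AE x in lebn n. norm (k x * \<phi> (real j) a x) \<le> norm (k x * w x)" for j
      proof (rule AE_I2)
        fix x
        have "norm (\<phi> (real j) a x) \<le> norm (w x)"
          unfolding \<phi>_def w_def prod_norm[symmetric]
          using smooth_cutoff_bounds by (intro prod_mono) auto
        then show "norm (k x * \<phi> (real j) a x) \<le> norm (k x * w x)" by (simp add: norm_mult mult_left_mono)
      qed
    qed
  qed
  \<comment> \<open>One argument for real and imaginary parts; \<open>hr\<close> lets the
    real-valued indicator pass through \<open>h\<close>.\<close>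
  have part: "AE x in lebn n. h (k x * w x) = 0"
    if h: "bounded_linear h" and hr: "\<And>z r. h (z * of_real r) = h z * r" for h :: "complex \<Rightarrow> real"
  proof (rule AE_zero_if_orthant_integrals_zero)
    show "integrable (lebn n) (\<lambda>x. h (k x * w x))" by (rule integrable_bounded_linear[OF h kw])
    fix a
    have Qs: "?Q a \<in> sets (lebn n)" unfolding sets_lebn_eq_sigma_orthants by (intro sigma_sets.Basic) blast
    have "integrable (lebn n) (\<lambda>x. indicator (?Q a) x *\<^sub>R (k x * w x))"
      by (rule integrable_mult_indicator[OF Qs kw])
    then have i: "integrable (lebn n) (\<lambda>x. (k x * w x) * indicator (?Q a) x)"
      by (rule Bochner_Integration.integrable_cong[THEN iffD1, rotated 2]) (auto simp: indicator_def)
    have "(LINT x|lebn n. h (k x * w x) * indicator (?Q a) x) = (LINT x|lebn n. h ((k x * w x) * indicator (?Q a) x))"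
      using hr[of _ "indicator (?Q a) _"] by (simp add: of_real_indicator)
    also have "\<dots> = h (LINT x|lebn n. (k x * w x) * indicator (?Q a) x)"
      by (rule integral_bounded_linear[OF h i])
    finally show "(LINT x|lebn n. h (k x * w x) * indicator (?Q a) x) = 0"
      unfolding Q by (simp add: linear_0[OF bounded_linear.linear[OF h]])
  qed
  have "AE x in lebn n. Re (k x * w x) = 0" "AE x in lebn n. Im (k x * w x) = 0"
    by (rule part; simp add: bounded_linear_Re bounded_linear_Im)+
  then show ?thesis
  proof eventually_elim
    case (elim x)
    then have "k x * w x = 0" by (simp add: complex_eq_iff)
    moreover have "w x \<noteq> 0" by (simp add: w_def)
    ultimately show ?case by simp
  qed
qed

corollary represents_unique:
  assumes g: "represents n T g" and h: "represents n T h"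
  shows "AE x in lebn n. g x = h x"
proof -
  have [measurable]: "g \<in> borel_measurable (lebn n)" "h \<in> borel_measurable (lebn n)"
    using g h by (auto simp: represents_def)
  have "AE x in lebn n. g x - h x = 0"
  proof (rule AE_zero_if_schwartz_integrals_zero)
    fix \<phi> assume \<phi>: "\<phi> \<in> schwartz n"
    have i: "integrable (lebn n) (\<lambda>x. g x * \<phi> x)" "integrable (lebn n) (\<lambda>x. h x * \<phi> x)"
      using g h \<phi> by (simp_all add: represents_def)
    have "T \<phi> = (LINT x|lebn n. g x * \<phi> x)" "T \<phi> = (LINT x|lebn n. h x * \<phi> x)"
      using g h \<phi> by (simp_all add: represents_def)
    then have e: "(LINT x|lebn n. g x * \<phi> x) = (LINT x|lebn n. h x * \<phi> x)" by simp
    show "integrable (lebn n) (\<lambda>x. (g x - h x) * \<phi> x)" unfolding left_diff_distrib using i by simp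
    show "(LINT x|lebn n. (g x - h x) * \<phi> x) = 0" unfolding left_diff_distrib using i e by simp
  qed measurable
  then show ?thesis by eventually_elim simp
qed

section \<open>Distributions with square integrable transform\<close>

lemma partials_zero:
  assumes "\<And>x. x \<in> space (lebn n) \<Longrightarrow> f x = 0" "set js \<subseteq> {..<n}" "x \<in> space (lebn n)"
  shows "partials js f x = 0"
  using assms(2,3)
proof (induction js arbitrary: x)
  case Nil
  then show ?case using assms(1) by simp
next
  case (Cons j js)
  then have "(\<lambda>s. partials js f (x(j := s))) = (\<lambda>s. 0)" by auto
  then show ?case by (simp add: partials_Cons partial_def)
qed

lemma space_lebn_nonempty: "space (lebn n) \<noteq> {}"
  by (auto simp: space_lebn extensional_def)

text \<open>The difference of the two functions is zero on \<open>space (lebn n)\<close>, so its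
  Schwartz norms are 0 and continuity kills it. This makes inversion usable inside a distribution,
  since that identity holds only on the space.\<close>

lemma tempered_cong:
  assumes T: "tempered n T" and \<phi>: "\<phi> \<in> schwartz n" and eq: "\<And>x. x \<in> space (lebn n) \<Longrightarrow> \<psi> x = \<phi> x"
  shows "T \<psi> = T \<phi>"
proof -
  have \<psi>: "\<psi> \<in> schwartz n" by (rule schwartz_cong[OF \<phi> eq])
  define d where "d = (\<lambda>x. \<psi> x + (- 1) * \<phi> x)"
  have d: "d \<in> schwartz n" unfolding d_def by (intro schwartz_add schwartz_cmult \<phi> \<psi>)
  have "schwartz_norm n N d = 0" for N
  proof -
    have "(\<lambda>(js, x). (1 + euclid_norm n x) ^ N * norm (partials js d x)) `
        ({js. set js \<subseteq> {..<n} \<and> length js \<le> N} \<times> space (lebn n)) = {0}" (is "?f ` ?A = _")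
    proof (intro equalityI subsetI)
      fix z assume "z \<in> ?f ` ?A"
      then obtain js x where "z = ?f (js, x)" "set js \<subseteq> {..<n}" "x \<in> space (lebn n)" by auto
      then show "z \<in> {0}" using partials_zero[of n d js x] eq by (simp add: d_def)
    next
      fix z :: real assume "z \<in> {0}"
      moreover obtain x where "x \<in> space (lebn n)" using space_lebn_nonempty by blast
      ultimately show "z \<in> ?f ` ?A"
        using eq by (intro image_eqI[of _ _ "([], x)"]) (auto simp: d_def)
    qed
    then show ?thesis by (simp add: schwartz_norm_def)
  qed
  then have "norm (T d) \<le> 0" using T d unfolding tempered_def by (metis mult_zero_right)
  then have "T d = 0" by simp
  moreover have "\<psi> = (\<lambda>x. \<phi> x + d x)" by (simp add: d_def)
  ultimately show ?thesis using T \<phi> d unfolding tempered_def by (metis add.right_neutral)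
qed

text \<open>The supremum is over a bounded set because only finitely many index lists have length at
  most N.\<close>

lemma schwartz_norm_upper:
  assumes \<phi>: "\<phi> \<in> schwartz n" and x: "x \<in> space (lebn n)"
  shows "(1 + euclid_norm n x) ^ N * norm (\<phi> x) \<le> schwartz_norm n N \<phi>"
proof -
  let ?f = "\<lambda>(js, x). (1 + euclid_norm n x) ^ N * norm (partials js \<phi> x)"
  let ?J = "{js. set js \<subseteq> {..<n} \<and> length js \<le> N}"
  have "\<exists>B. \<forall>x\<in>space (lebn n). (1 + euclid_norm n x) ^ N * norm (partials js \<phi> x) \<le> B" if "js \<in> ?J" for js
    using \<phi> that unfolding schwartz_def by blast
  then obtain B where B: "\<And>js x. js \<in> ?J \<Longrightarrow> x \<in> space (lebn n) \<Longrightarrow> ?f (js, x) \<le> B js"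
    by simp metis
  have fin: "finite ?J" by (rule finite_lists_length_le) simp
  have "?f z \<le> Max (B ` ?J)" if z: "z \<in> ?J \<times> space (lebn n)" for z
  proof -
    obtain js y where "z = (js, y)" "js \<in> ?J" "y \<in> space (lebn n)" using z by blast
    then show ?thesis using B[of js y] Max_ge[of "B ` ?J" "B js"] fin by fastforce
  qed
  then have "bdd_above (?f ` (?J \<times> space (lebn n)))" by (rule bdd_aboveI2)
  moreover have "([], x) \<in> ?J \<times> space (lebn n)" using x by simp
  ultimately have "?f ([], x) \<le> schwartz_norm n N \<phi>"
    unfolding schwartz_norm_def by (intro cSUP_upper)
  then show ?thesis by simp
qed

lemma square_integrable_cong_AE:
  assumes "square_integrable n f" "g \<in> borel_measurable (lebn n)" "AE x in lebn n. f x = g x"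
  shows "square_integrable n g" and "L2norm_fun n f = L2norm_fun n g"
proof -
  have ae: "AE x in lebn n. (norm (f x))\<^sup>2 = (norm (g x))\<^sup>2" using assms(3) by eventually_elim simp
  have [measurable]: "f \<in> borel_measurable (lebn n)" "g \<in> borel_measurable (lebn n)"
    using assms by (auto simp: square_integrable_def)
  have "integrable (lebn n) (\<lambda>x. (norm (g x))\<^sup>2)"
    using assms(1) unfolding square_integrable_def by (intro integrable_cong_AE_imp[OF _ _ ae]) auto
  then show "square_integrable n g" using assms(2) by (simp add: square_integrable_def)
  show "L2norm_fun n f = L2norm_fun n g"
    unfolding L2norm_fun_def by (intro arg_cong[of _ _ sqrt] integral_cong_AE ae) measurable
qed

lemma density_of_represents: "represents n T g \<Longrightarrow> represents n T (density_of n T)"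
  unfolding density_of_def by (rule someI[of "represents n T"])

lemma represents_measurable: "represents n T g \<Longrightarrow> g \<in> borel_measurable (lebn n)"
  by (simp add: represents_def)

lemma square_integrable_inverse_one_plus_euclid_norm:
  "square_integrable n (\<lambda>x. complex_of_real (1 / (1 + euclid_norm n x) ^ (2 * n)))"
proof -
  have "integrable (lebn n) (\<lambda>x. (norm (complex_of_real (1 / (1 + euclid_norm n x) ^ (2 * n))))\<^sup>2)"
  proof (rule Bochner_Integration.integrable_bound[OF integrable_inverse_one_plus_euclid_norm])
    show "AE x in lebn n. norm ((norm (complex_of_real (1 / (1 + euclid_norm n x) ^ (2 * n))))\<^sup>2) \<le> norm (1 / (1 + euclid_norm n x) ^ (2 * n))"
    proof (rule AE_I2)
      fix x
      have inv: "0 \<le> 1 / a \<and> 1 / a \<le> 1" if "1 \<le> a" for a :: real using that by simp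
      have "1 \<le> (1 + euclid_norm n x) ^ (2 * n)" by (intro one_le_power) simp
      from inv[OF this] have r: "0 \<le> 1 / (1 + euclid_norm n x) ^ (2 * n)" "1 / (1 + euclid_norm n x) ^ (2 * n) \<le> 1" by auto
      have "(1 / (1 + euclid_norm n x) ^ (2 * n))\<^sup>2 \<le> 1 / (1 + euclid_norm n x) ^ (2 * n)"
        using mult_left_mono[OF r(2) r(1)] by (simp add: power2_eq_square)
      then show "norm ((norm (complex_of_real (1 / (1 + euclid_norm n x) ^ (2 * n))))\<^sup>2) \<le> norm (1 / (1 + euclid_norm n x) ^ (2 * n))"
        unfolding norm_of_real power2_abs real_norm_def by simp
    qed
  qed measurable
  then show ?thesis by (simp add: square_integrable_def)
qed

text \<open>Continuity of T: the function \<open>(1 + |x|)^(-2n)\<close> is square integrable, hence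
  integrable against \<open>f\<close>, and its reciprocal is absorbed by the Schwartz norm of order
  \<open>2 * n\<close>. Uniqueness of representatives then allows the norm to be read off from
  \<open>f\<close>.\<close>

lemma L2_if_represents:
  assumes T: "represents n T f" and f: "square_integrable n f"
  shows "T \<in> L2 n" and "L2_norm n T = L2norm_fun n f"
proof -
  have rep: "integrable (lebn n) (\<lambda>x. f x * \<phi> x)" "T \<phi> = (LINT x|lebn n. f x * \<phi> x)" if "\<phi> \<in> schwartz n" for \<phi>
    using T that by (auto simp: represents_def)
  define w where "w = (\<lambda>x. 1 / (1 + euclid_norm n x) ^ (2 * n))"
  have fw: "integrable (lebn n) (\<lambda>x. norm (f x * complex_of_real (w x)))"
    unfolding w_def by (intro integrable_norm square_integrable_mult_integrable f square_integrable_inverse_one_plus_euclid_norm)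
  define C where "C = (LINT x|lebn n. norm (f x * complex_of_real (w x)))"
  have "tempered n T"
    unfolding tempered_def
  proof (intro conjI ballI allI exI)
    fix \<phi> \<psi> assume S: "\<phi> \<in> schwartz n" "\<psi> \<in> schwartz n"
    show "T (\<lambda>x. \<phi> x + \<psi> x) = T \<phi> + T \<psi>"
      using rep[OF S(1)] rep[OF S(2)] rep(2)[OF schwartz_add[OF S]] by (simp add: distrib_left)
  next
    fix \<phi> and c :: complex assume S: "\<phi> \<in> schwartz n"
    show "T (\<lambda>x. c * \<phi> x) = c * T \<phi>"
      using rep(2)[OF S] rep(2)[OF schwartz_cmult[OF S]] by (simp add: mult.left_commute[of _ c])
  next
    fix \<phi> assume S: "\<phi> \<in> schwartz n"
    define s where "s = schwartz_norm n (2 * n) \<phi>"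
    have "norm (T \<phi>) \<le> (LINT x|lebn n. norm (f x * \<phi> x))" unfolding rep(2)[OF S] by simp
    also have "\<dots> \<le> (LINT x|lebn n. s * norm (f x * complex_of_real (w x)))"
    proof (rule integral_mono)
      show "integrable (lebn n) (\<lambda>x. norm (f x * \<phi> x))" by (rule integrable_norm[OF rep(1)[OF S]])
      show "integrable (lebn n) (\<lambda>x. s * norm (f x * complex_of_real (w x)))" by (rule integrable_mult_right[OF fw])
      fix x assume x: "x \<in> space (lebn n)"
      have pos: "0 < (1 + euclid_norm n x) ^ (2 * n)" by (intro zero_less_power) (simp add: add_pos_nonneg)
      have "norm (\<phi> x) \<le> s * w x"
        using schwartz_norm_upper[OF S x, of "2 * n"] pos by (simp add: s_def w_def field_simps)
      moreover have "w x \<ge> 0" using pos by (simp add: w_def)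
      ultimately show "norm (f x * \<phi> x) \<le> s * norm (f x * complex_of_real (w x))"
        by (simp add: norm_mult mult_left_mono mult.left_commute[of s])
    qed
    also have "\<dots> = C * s" by (simp add: C_def)
    finally show "norm (T \<phi>) \<le> C * schwartz_norm n (2 * n) \<phi>" by (simp add: s_def)
  qed
  then show "T \<in> L2 n" using assms by (auto simp: L2_def)
  have d: "represents n T (density_of n T)" by (rule density_of_represents[OF T])
  show "L2_norm n T = L2norm_fun n f"
    unfolding L2_norm_def
    using square_integrable_cong_AE(2)[OF f represents_measurable[OF d] represents_unique[OF T d]] by simp
qed

text \<open>Inversion by duality: \<phi> is replaced by the transform of its inverse
  transform.\<close>

lemma fourier_inversion_represents:
  assumes "tempered n T" "represents n (fourier_dist n T) v" "\<phi> \<in> schwartz n"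
  shows "T \<phi> = (LINT \<xi>|lebn n. v \<xi> * inverse_fourier n \<phi> \<xi>)"
proof -
  have "T \<phi> = T (fourier n (inverse_fourier n \<phi>))"
    by (rule tempered_cong[OF assms(1) fourier_schwartz[OF inverse_fourier_schwartz[OF assms(3)]]])
      (simp add: fourier_inverse_fourier[OF assms(3)])
  also have "\<dots> = (LINT \<xi>|lebn n. v \<xi> * inverse_fourier n \<phi> \<xi>)"
    using assms(2) inverse_fourier_schwartz[OF assms(3)] by (simp add: represents_def fourier_dist_def)
  finally show ?thesis .
qed

text \<open>Bounds a distribution by its transform. It is applied to the solution, to its partial
  derivatives and to its time derivative.\<close>

lemma L2_if_inverse_fourier:
  assumes g: "square_integrable n g"
    and T: "\<And>\<phi>. \<phi> \<in> schwartz n \<Longrightarrow> T \<phi> = (LINT \<xi>|lebn n. g \<xi> * inverse_fourier n \<phi> \<xi>)"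
  shows "T \<in> L2 n" and "L2_norm n T \<le> L2norm_fun n g"
proof -
  obtain h where h: "square_integrable n h" "L2norm_fun n h \<le> L2norm_fun n g"
    "\<And>\<phi>. \<phi> \<in> schwartz n \<Longrightarrow> (LINT x|lebn n. h x * \<phi> x) = (LINT x|lebn n. g x * inverse_fourier n \<phi> x)"
    by (rule inverse_fourier_L2_extension[OF g]) (rule that)
  have "represents n T h"
    using h square_integrable_mult_integrable[OF h(1) schwartz_square_integrable] T
    by (simp add: represents_def square_integrable_def)
  from L2_if_represents[OF this h(1)] show "T \<in> L2 n" "L2_norm n T \<le> L2norm_fun n g" using h(2) by auto
qed

text \<open>The reverse bound, of the transform by the distribution; it is applied to the initial
  data.\<close>

lemma fourier_dist_L2:
  assumes "T \<in> L2 n" and w: "represents n (fourier_dist n T) w"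
  shows "square_integrable n w" and "L2norm_fun n w \<le> L2_norm n T"
proof -
  obtain f where f: "represents n T f" "square_integrable n f" using assms by (auto simp: L2_def)
  obtain h where h: "square_integrable n h" "L2norm_fun n h \<le> L2norm_fun n f"
    "\<And>\<phi>. \<phi> \<in> schwartz n \<Longrightarrow> (LINT x|lebn n. h x * \<phi> x) = (LINT x|lebn n. f x * fourier n \<phi> x)"
    by (rule fourier_L2_extension[OF f(2)]) (rule that)
  have "represents n (fourier_dist n T) h"
    using h square_integrable_mult_integrable[OF h(1) schwartz_square_integrable] f(1) fourier_schwartz
    by (simp add: represents_def square_integrable_def fourier_dist_def)
  from square_integrable_cong_AE[OF h(1) represents_measurable[OF w] represents_unique[OF this w]]
  show "square_integrable n w" "L2norm_fun n w \<le> L2_norm n T"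
    using h(2) L2_if_represents(2)[OF f] by auto
qed

lemma sobolev_weight_measurable [measurable]:
  "g \<in> borel_measurable (lebn n) \<Longrightarrow> sobolev_weight n s g \<in> borel_measurable (lebn n)"
  unfolding sobolev_weight_def by measurable

text \<open>The functions \<open>w0\<close> and \<open>w1\<close> of a solution need not be the ones
  chosen by \<open>density_of\<close>; almost everywhere uniqueness identifies the weighted
  norms.\<close>

lemma sobolev_representative:
  assumes "T \<in> sobolev n s" and w: "represents n (fourier_dist n T) w"
  shows "square_integrable n (sobolev_weight n s w)" and "L2norm_fun n (sobolev_weight n s w) = sobolev_norm n s T"
proof -
  obtain g where g: "represents n (fourier_dist n T) g" "square_integrable n (sobolev_weight n s g)"
    using assms by (auto simp: sobolev_def)
  have *: "square_integrable n (sobolev_weight n s h) \<and> L2norm_fun n (sobolev_weight n s g) = L2norm_fun n (sobolev_weight n s h)"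
    if h: "represents n (fourier_dist n T) h" for h
  proof -
    have "AE x in lebn n. sobolev_weight n s g x = sobolev_weight n s h x"
      using represents_unique[OF g(1) h] by eventually_elim (simp add: sobolev_weight_def)
    from square_integrable_cong_AE[OF g(2) sobolev_weight_measurable[OF represents_measurable[OF h]] this]
    show ?thesis by auto
  qed
  show "square_integrable n (sobolev_weight n s w)" using *[OF w] by simp
  show "L2norm_fun n (sobolev_weight n s w) = sobolev_norm n s T"
    using *[OF w] *[OF density_of_represents[OF w]] by (simp add: sobolev_norm_def)
qed

lemma norm_sobolev_weight_power2:
  "(norm (sobolev_weight n s g \<xi>))\<^sup>2 = (1 + (euclid_norm n \<xi>)\<^sup>2) powr s * (norm (g \<xi>))\<^sup>2"
proof -
  have "((1 + (euclid_norm n \<xi>)\<^sup>2) powr (s / 2))\<^sup>2 = (1 + (euclid_norm n \<xi>)\<^sup>2) powr s"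
    by (simp add: power2_eq_square powr_add[symmetric])
  then show ?thesis by (simp add: sobolev_weight_def norm_mult power_mult_distrib)
qed

lemma square_integrable_if_le:
  assumes [measurable]: "v \<in> borel_measurable (lebn n)" and a: "square_integrable n a" and c: "square_integrable n c" and "K \<ge> 0"
    and le: "\<And>\<xi>. \<xi> \<in> space (lebn n) \<Longrightarrow> (norm (v \<xi>))\<^sup>2 \<le> K\<^sup>2 * ((norm (a \<xi>))\<^sup>2 + (norm (c \<xi>))\<^sup>2)"
  shows "square_integrable n v" and "L2norm_fun n v \<le> K * (L2norm_fun n a + L2norm_fun n c)"
proof -
  have int: "integrable (lebn n) (\<lambda>\<xi>. K\<^sup>2 * ((norm (a \<xi>))\<^sup>2 + (norm (c \<xi>))\<^sup>2))"
    using a c by (simp add: square_integrable_def)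
  have vi: "integrable (lebn n) (\<lambda>\<xi>. (norm (v \<xi>))\<^sup>2)"
    by (rule Bochner_Integration.integrable_bound[OF int]) (use le in \<open>auto intro: order_trans[OF _ abs_ge_self]\<close>)
  then show "square_integrable n v" by (simp add: square_integrable_def)
  have "(L2norm_fun n v)\<^sup>2 \<le> (LINT \<xi>|lebn n. K\<^sup>2 * ((norm (a \<xi>))\<^sup>2 + (norm (c \<xi>))\<^sup>2))"
    unfolding L2norm_fun_power2 by (rule integral_mono[OF vi int le])
  also have "\<dots> = K\<^sup>2 * ((L2norm_fun n a)\<^sup>2 + (L2norm_fun n c)\<^sup>2)"
    unfolding L2norm_fun_power2 using a c by (simp add: square_integrable_def)
  also have "\<dots> \<le> K\<^sup>2 * (L2norm_fun n a + L2norm_fun n c)\<^sup>2"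
    by (intro mult_left_mono) (auto simp: power2_sum)
  also have "\<dots> = (K * (L2norm_fun n a + L2norm_fun n c))\<^sup>2" by (simp add: power_mult_distrib)
  finally show "L2norm_fun n v \<le> K * (L2norm_fun n a + L2norm_fun n c)"
    by (rule power2_le_imp_le) (use \<open>K \<ge> 0\<close> in simp)
qed

section \<open>Decay in Sobolev norms\<close>

lemma L2_set_L2norm_components_le:
  assumes [measurable]: "v \<in> borel_measurable (lebn n)"
    and G: "square_integrable n (\<lambda>\<xi>. of_real (euclid_norm n \<xi>) * v \<xi>)"
  shows "\<And>j. j < n \<Longrightarrow> square_integrable n (\<lambda>\<xi>. \<i> * of_real (\<xi> j) * v \<xi>)"
    and "L2_set (\<lambda>j. L2norm_fun n (\<lambda>\<xi>. \<i> * of_real (\<xi> j) * v \<xi>)) {..<n} \<le> L2norm_fun n (\<lambda>\<xi>. of_real (euclid_norm n \<xi>) * v \<xi>)"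
proof -
  have int: "integrable (lebn n) (\<lambda>\<xi>. (\<xi> j)\<^sup>2 * (norm (v \<xi>))\<^sup>2)" if "j < n" for j
  proof (rule Bochner_Integration.integrable_bound)
    show "integrable (lebn n) (\<lambda>\<xi>. (norm (of_real (euclid_norm n \<xi>) * v \<xi>))\<^sup>2)"
      using G by (simp add: square_integrable_def)
    show "AE \<xi> in lebn n. norm ((\<xi> j)\<^sup>2 * (norm (v \<xi>))\<^sup>2) \<le> norm ((norm (of_real (euclid_norm n \<xi>) * v \<xi>))\<^sup>2)"
    proof (rule AE_I2)
      fix \<xi>
      have "\<bar>\<xi> j\<bar>\<^sup>2 \<le> (euclid_norm n \<xi>)\<^sup>2"
        using abs_component_le_euclid_norm[OF that, of \<xi>] by (intro power_mono) auto
      then show "norm ((\<xi> j)\<^sup>2 * (norm (v \<xi>))\<^sup>2) \<le> norm ((norm (of_real (euclid_norm n \<xi>) * v \<xi>))\<^sup>2)"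
        by (simp add: norm_mult power_mult_distrib mult_right_mono)
    qed
    show "(\<lambda>\<xi>. (\<xi> j)\<^sup>2 * (norm (v \<xi>))\<^sup>2) \<in> borel_measurable (lebn n)" using that by measurable
  qed
  show "square_integrable n (\<lambda>\<xi>. \<i> * of_real (\<xi> j) * v \<xi>)" if "j < n" for j
    using int[OF that] that by (simp add: square_integrable_def norm_mult power_mult_distrib)
  have "(\<Sum>j<n. (L2norm_fun n (\<lambda>\<xi>. \<i> * of_real (\<xi> j) * v \<xi>))\<^sup>2) = (\<Sum>j<n. LINT \<xi>|lebn n. (\<xi> j)\<^sup>2 * (norm (v \<xi>))\<^sup>2)"
    by (simp add: L2norm_fun_power2 norm_mult power_mult_distrib)
  also have "\<dots> = (LINT \<xi>|lebn n. (\<Sum>j<n. (\<xi> j)\<^sup>2 * (norm (v \<xi>))\<^sup>2))"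
    using int by (simp add: Bochner_Integration.integral_sum)
  also have "\<dots> = (L2norm_fun n (\<lambda>\<xi>. of_real (euclid_norm n \<xi>) * v \<xi>))\<^sup>2"
    by (simp add: L2norm_fun_power2 norm_mult power_mult_distrib power2_euclid_norm sum_distrib_right)
  finally show "L2_set (\<lambda>j. L2norm_fun n (\<lambda>\<xi>. \<i> * of_real (\<xi> j) * v \<xi>)) {..<n} \<le> L2norm_fun n (\<lambda>\<xi>. of_real (euclid_norm n \<xi>) * v \<xi>)"
    by (simp add: L2_set_def)
qed

text \<open>A derivative chosen separately at each frequency becomes a sequential limit of
  measurable difference quotients, and so is measurable in the frequency.\<close>

lemma has_vector_derivative_sequential:
  assumes "(f has_vector_derivative D) (at t within {t..})"
  shows "(\<lambda>k. of_real (real (Suc k)) * (f (t + 1 / Suc k) - f t)) \<longlonglongrightarrow> (D :: complex)"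
proof -
  have "((\<lambda>s. (1 / norm (s - t)) *\<^sub>R (f s - (f t + (s - t) *\<^sub>R D))) \<longlongrightarrow> 0) (at t within {t..})"
    using assms unfolding has_vector_derivative_def has_derivative_within by simp
  then have seq: "((\<lambda>s. (1 / norm (s - t)) *\<^sub>R (f s - (f t + (s - t) *\<^sub>R D))) \<circ> X) \<longlonglongrightarrow> 0"
    if "\<And>k. X k \<in> {t..} - {t}" "X \<longlonglongrightarrow> t" for X
    using that unfolding tendsto_at_iff_sequentially by blast
  have lim: "((\<lambda>s. (1 / norm (s - t)) *\<^sub>R (f s - (f t + (s - t) *\<^sub>R D))) \<circ> (\<lambda>k. t + 1 / real (Suc k))) \<longlonglongrightarrow> 0"
  proof (rule seq)
    show "(\<lambda>k. t + 1 / real (Suc k)) \<longlonglongrightarrow> t" by real_asymp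
  qed simp
  have "((\<lambda>s. (1 / norm (s - t)) *\<^sub>R (f s - (f t + (s - t) *\<^sub>R D))) \<circ> (\<lambda>k. t + 1 / real (Suc k))) k
      = of_real (real (Suc k)) * (f (t + 1 / Suc k) - f t) - D" for k
  proof -
    have "real (Suc k) \<noteq> 0" by simp
    then show ?thesis by (simp add: scaleR_conv_of_real algebra_simps del: of_nat_Suc)
  qed
  then have "(\<lambda>k. of_real (real (Suc k)) * (f (t + 1 / Suc k) - f t) - D) \<longlonglongrightarrow> 0" using lim by (simp only: fun_eq_iff[symmetric] o_def)
  then show ?thesis by (rule LIM_zero_cancel)
qed

text \<open>From here on the equation enters only through \<open>energy\<close>, together with
  \<open>p \<xi>\<close> being the time derivative. As \<open>p \<xi>\<close> is picked frequency by
  frequency, its measurability in \<xi> is not assumed but derived.\<close>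

locale fourier_energy_decay =
  fixes n :: nat and C \<sigma> :: real and u0 u1 :: distribution and u :: "real \<Rightarrow> distribution"
    and v :: "real \<Rightarrow> vec \<Rightarrow> complex" and w0 w1 :: "vec \<Rightarrow> complex" and p :: "vec \<Rightarrow> real \<Rightarrow> complex"
  assumes C: "C > 0" and \<sigma>: "\<sigma> > 0"
    and tempered: "\<And>t. t \<ge> 0 \<Longrightarrow> tempered n (u t)"
    and v: "\<And>t. t \<ge> 0 \<Longrightarrow> represents n (fourier_dist n (u t)) (v t)"
    and w0: "represents n (fourier_dist n u0) w0" and w1: "represents n (fourier_dist n u1) w1"
    and p: "\<And>\<xi> t. \<lbrakk>\<xi> \<in> space (lebn n); t \<ge> 0\<rbrakk> \<Longrightarrow> ((\<lambda>t. v t \<xi>) has_vector_derivative p \<xi> t) (at t within {0..})"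
    and energy: "\<And>\<xi> t. \<lbrakk>\<xi> \<in> space (lebn n); t \<ge> 0\<rbrakk> \<Longrightarrow>
      (1 + (euclid_norm n \<xi>)\<^sup>2) * (norm (v t \<xi>))\<^sup>2 + (norm (p \<xi> t))\<^sup>2
        \<le> C * exp (- 2 * \<sigma> * t) * ((1 + (euclid_norm n \<xi>)\<^sup>2) * (norm (w0 \<xi>))\<^sup>2 + (norm (w1 \<xi>))\<^sup>2)"
begin

definition decay :: "real \<Rightarrow> real" where "decay t = sqrt C * exp (- \<sigma> * t)"

lemma decay_nonneg: "decay t \<ge> 0" using C by (simp add: decay_def)

lemma decay_power2: "(decay t)\<^sup>2 = C * exp (- 2 * \<sigma> * t)"
  using C by (simp add: decay_def power_mult_distrib power2_eq_square[of "exp _"] flip: exp_add)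

lemma v_measurable: "t \<ge> 0 \<Longrightarrow> v t \<in> borel_measurable (lebn n)"
  using represents_measurable[OF v] .

lemma u_eq: "t \<ge> 0 \<Longrightarrow> \<phi> \<in> schwartz n \<Longrightarrow> u t \<phi> = (LINT \<xi>|lebn n. v t \<xi> * inverse_fourier n \<phi> \<xi>)"
  by (rule fourier_inversion_represents[OF tempered v])

text \<open>Dividing the energy inequality by \<open>1 + |\<xi>|^2\<close> puts the weight of order
  -1 on the second datum.\<close>

lemma L2_decay:
  assumes "u0 \<in> L2 n" "u1 \<in> sobolev n (-1)" "t \<ge> 0"
  shows "u t \<in> L2 n" and "L2_norm n (u t) \<le> decay t * (L2_norm n u0 + sobolev_norm n (-1) u1)"
proof -
  note a = fourier_dist_L2[OF assms(1) w0] and c = sobolev_representative[OF assms(2) w1]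
  have "(norm (v t \<xi>))\<^sup>2 \<le> (decay t)\<^sup>2 * ((norm (w0 \<xi>))\<^sup>2 + (norm (sobolev_weight n (-1) w1 \<xi>))\<^sup>2)"
    if \<xi>: "\<xi> \<in> space (lebn n)" for \<xi>
  proof -
    define M where "M = 1 + (euclid_norm n \<xi>)\<^sup>2"
    have M: "M > 0" by (simp add: M_def add_pos_nonneg)
    have "M * (norm (v t \<xi>))\<^sup>2 \<le> (decay t)\<^sup>2 * (M * (norm (w0 \<xi>))\<^sup>2 + (norm (w1 \<xi>))\<^sup>2)"
      using energy[OF \<xi> assms(3)] unfolding decay_power2 M_def by (smt (verit) zero_le_power2)
    also have "\<dots> = M * ((decay t)\<^sup>2 * ((norm (w0 \<xi>))\<^sup>2 + (norm (w1 \<xi>))\<^sup>2 / M))"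
      using M by (simp add: field_simps)
    finally have "(norm (v t \<xi>))\<^sup>2 \<le> (decay t)\<^sup>2 * ((norm (w0 \<xi>))\<^sup>2 + (norm (w1 \<xi>))\<^sup>2 / M)" using M by simp
    moreover have "(norm (sobolev_weight n (-1) w1 \<xi>))\<^sup>2 = (norm (w1 \<xi>))\<^sup>2 / M"
      unfolding norm_sobolev_weight_power2 using M by (simp add: M_def powr_minus_divide)
    ultimately show ?thesis by simp
  qed
  then have vt: "square_integrable n (v t)"
      "L2norm_fun n (v t) \<le> decay t * (L2norm_fun n w0 + L2norm_fun n (sobolev_weight n (-1) w1))"
    using square_integrable_if_le[OF v_measurable[OF assms(3)] a(1) c(1) decay_nonneg] by blast+
  show "u t \<in> L2 n" by (rule L2_if_inverse_fourier(1)[OF vt(1) u_eq[OF assms(3)]])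
  have ut: "L2_norm n (u t) \<le> L2norm_fun n (v t)" by (rule L2_if_inverse_fourier(2)[OF vt(1) u_eq[OF assms(3)]])
  have "decay t * (L2norm_fun n w0 + L2norm_fun n (sobolev_weight n (-1) w1)) \<le> decay t * (L2_norm n u0 + sobolev_norm n (-1) u1)"
    using a(2) c(2) by (intro mult_left_mono decay_nonneg) simp
  then show "L2_norm n (u t) \<le> decay t * (L2_norm n u0 + sobolev_norm n (-1) u1)" using ut vt(2) by linarith
qed

context
  fixes t :: real
  assumes u0: "u0 \<in> sobolev n 1" and u1: "u1 \<in> L2 n" and t: "t \<ge> 0"
begin

lemma energy_data:
  "square_integrable n (sobolev_weight n 1 w0)" "square_integrable n w1"
  "decay t * (L2norm_fun n (sobolev_weight n 1 w0) + L2norm_fun n w1) \<le> decay t * (sobolev_norm n 1 u0 + L2_norm n u1)"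
  using sobolev_representative[OF u0 w0] fourier_dist_L2[OF u1 w1]
  by (auto intro!: mult_left_mono decay_nonneg)

lemma energy':
  assumes "\<xi> \<in> space (lebn n)" "s \<ge> 0"
  shows "(1 + (euclid_norm n \<xi>)\<^sup>2) * (norm (v s \<xi>))\<^sup>2 + (norm (p \<xi> s))\<^sup>2
    \<le> (decay s)\<^sup>2 * ((norm (sobolev_weight n 1 w0 \<xi>))\<^sup>2 + (norm (w1 \<xi>))\<^sup>2)"
  using energy[OF assms] unfolding norm_sobolev_weight_power2 decay_power2 by (simp add: add_pos_nonneg)

text \<open>The weight of the energy exceeds \<open>|\<xi>|^2\<close>, so it controls
  \<open>|\<xi>| v\<close>, from which the square norms of the components
  \<open>\<i> \<xi>_j v\<close> recombine.\<close>

lemma gradient_decay: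
  shows "\<forall>j<n. partial_dist j (u t) \<in> L2 n" and "grad_L2_norm n (u t) \<le> decay t * (sobolev_norm n 1 u0 + L2_norm n u1)"
proof -
  note [measurable] = v_measurable[OF t]
  have G: "(norm (of_real (euclid_norm n \<xi>) * v t \<xi>))\<^sup>2 \<le> (decay t)\<^sup>2 * ((norm (sobolev_weight n 1 w0 \<xi>))\<^sup>2 + (norm (w1 \<xi>))\<^sup>2)"
    if \<xi>: "\<xi> \<in> space (lebn n)" for \<xi>
  proof -
    have "(norm (of_real (euclid_norm n \<xi>) * v t \<xi>))\<^sup>2 = (euclid_norm n \<xi>)\<^sup>2 * (norm (v t \<xi>))\<^sup>2"
      by (simp add: norm_mult power_mult_distrib)
    then show ?thesis using energy'[OF \<xi> t] by (simp add: distrib_right) (smt (verit) zero_le_power2)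
  qed
  have Gm: "(\<lambda>\<xi>. of_real (euclid_norm n \<xi>) * v t \<xi>) \<in> borel_measurable (lebn n)" by measurable
  have Gt: "square_integrable n (\<lambda>\<xi>. of_real (euclid_norm n \<xi>) * v t \<xi>)"
    "L2norm_fun n (\<lambda>\<xi>. of_real (euclid_norm n \<xi>) * v t \<xi>) \<le> decay t * (L2norm_fun n (sobolev_weight n 1 w0) + L2norm_fun n w1)"
    by (rule square_integrable_if_le[OF Gm energy_data(1,2) decay_nonneg G], assumption)+
  note comp = L2_set_L2norm_components_le[OF v_measurable[OF t] Gt(1)]
  have S: "partial_dist j (u t) \<phi> = (LINT \<xi>|lebn n. (\<i> * of_real (\<xi> j) * v t \<xi>) * inverse_fourier n \<phi> \<xi>)"
    if j: "j < n" and \<phi>: "\<phi> \<in> schwartz n" for j \<phi>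
  proof -
    have "partial_dist j (u t) \<phi> = - (LINT \<xi>|lebn n. v t \<xi> * inverse_fourier n (partial j \<phi>) \<xi>)"
      unfolding partial_dist_def using u_eq[OF t schwartz_partial[OF \<phi> j]] by simp
    also have "(LINT \<xi>|lebn n. v t \<xi> * inverse_fourier n (partial j \<phi>) \<xi>) = (LINT \<xi>|lebn n. - ((\<i> * of_real (\<xi> j) * v t \<xi>) * inverse_fourier n \<phi> \<xi>))"
      by (intro Bochner_Integration.integral_cong refl) (simp add: inverse_fourier_partial[OF \<phi> j])
    finally show ?thesis by simp
  qed
  have L: "partial_dist j (u t) \<in> L2 n" "L2_norm n (partial_dist j (u t)) \<le> L2norm_fun n (\<lambda>\<xi>. \<i> * of_real (\<xi> j) * v t \<xi>)"
    if j: "j < n" for j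
    by (rule L2_if_inverse_fourier[OF comp(1)[OF j] S[OF j]], assumption)+
  show "\<forall>j<n. partial_dist j (u t) \<in> L2 n" using L(1) by blast
  have "grad_L2_norm n (u t) \<le> L2_set (\<lambda>j. L2norm_fun n (\<lambda>\<xi>. \<i> * of_real (\<xi> j) * v t \<xi>)) {..<n}"
    unfolding grad_L2_norm_def
    by (intro L2_set_mono) (use L(2) in \<open>auto simp: L2_norm_def\<close>)
  also note comp(2)
  also note Gt(2)
  also note energy_data(3)
  finally show "grad_L2_norm n (u t) \<le> decay t * (sobolev_norm n 1 u0 + L2_norm n u1)" .
qed

text \<open>The derivative is defined weakly, by pairing \<open>P\<close> with inverse transforms of
  test functions. Differentiation under the integral shows that it is the derivative, and the energy
  inequality bounds it.\<close>

lemma time_derivative_decay: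
  "\<exists>ut. has_time_derivative n u ut t \<and> ut \<in> L2 n \<and> L2_norm n ut \<le> decay t * (sobolev_norm n 1 u0 + L2_norm n u1)"
proof -
  define P where "P = (\<lambda>\<xi>. p \<xi> t)"
  have P_meas [measurable]: "P \<in> borel_measurable (lebn n)"
  proof (rule borel_measurable_LIMSEQ_metric)
    show "(\<lambda>\<xi>. of_real (real (Suc k)) * (v (t + 1 / Suc k) \<xi> - v t \<xi>)) \<in> borel_measurable (lebn n)" for k
      using v_measurable[of t] v_measurable[of "t + 1 / Suc k"] t by simp
    fix \<xi> assume "\<xi> \<in> space (lebn n)"
    then have "((\<lambda>t. v t \<xi>) has_vector_derivative P \<xi>) (at t within {t..})"
      unfolding P_def using t by (intro has_vector_derivative_within_subset[OF p]) auto
    then show "(\<lambda>k. of_real (real (Suc k)) * (v (t + 1 / Suc k) \<xi> - v t \<xi>)) \<longlonglongrightarrow> P \<xi>"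
      by (rule has_vector_derivative_sequential)
  qed
  have "(norm (P \<xi>))\<^sup>2 \<le> (decay t)\<^sup>2 * ((norm (sobolev_weight n 1 w0 \<xi>))\<^sup>2 + (norm (w1 \<xi>))\<^sup>2)"
    if "\<xi> \<in> space (lebn n)" for \<xi>
  proof -
    have "0 \<le> (1 + (euclid_norm n \<xi>)\<^sup>2) * (norm (v t \<xi>))\<^sup>2" by simp
    then show ?thesis using energy'[OF that t] unfolding P_def by linarith
  qed
  then have Pt: "square_integrable n P"
    "L2norm_fun n P \<le> decay t * (L2norm_fun n (sobolev_weight n 1 w0) + L2norm_fun n w1)"
    using square_integrable_if_le[OF P_meas energy_data(1,2) decay_nonneg] by blast+
  define ut :: distribution where "ut = (\<lambda>\<phi>. LINT \<xi>|lebn n. P \<xi> * inverse_fourier n \<phi> \<xi>)"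
  have "has_time_derivative n u ut t"
    unfolding has_time_derivative_def
  proof
    fix \<phi> assume \<phi>: "\<phi> \<in> schwartz n"
    define \<psi> where "\<psi> = inverse_fourier n \<phi>"
    have \<psi>: "\<psi> \<in> schwartz n" unfolding \<psi>_def by (rule inverse_fourier_schwartz[OF \<phi>])
    note [measurable] = schwartz_measurable[OF \<psi>]
    \<comment> \<open>For s \<ge> 0 the square of \<open>decay s\<close> is at most C, so D
      dominates \<open>(norm (p \<xi> s))\<^sup>2\<close> for all times at once, and the assumptions
      on the data make it integrable.\<close>
    define D where "D = (\<lambda>\<xi>. C * ((norm (sobolev_weight n 1 w0 \<xi>))\<^sup>2 + (norm (w1 \<xi>))\<^sup>2))"
    have pD: "(norm (p \<xi> s))\<^sup>2 \<le> D \<xi>" if "\<xi> \<in> space (lebn n)" "s \<ge> 0" for \<xi> s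
    proof -
      have "(norm (p \<xi> s))\<^sup>2 \<le> (decay s)\<^sup>2 * ((norm (sobolev_weight n 1 w0 \<xi>))\<^sup>2 + (norm (w1 \<xi>))\<^sup>2)"
      proof -
        have "0 \<le> (1 + (euclid_norm n \<xi>)\<^sup>2) * (norm (v s \<xi>))\<^sup>2" by simp
        then show ?thesis using energy'[OF that] by linarith
      qed
      also have "\<dots> \<le> D \<xi>"
        unfolding D_def decay_power2 using C \<sigma> that(2) by (intro mult_right_mono) auto
      finally show ?thesis .
    qed
    have "((\<lambda>s. LINT \<xi>|lebn n. v s \<xi> * \<psi> \<xi>) has_vector_derivative (LINT \<xi>|lebn n. p \<xi> t * \<psi> \<xi>)) (at t within {0..})"
    proof (rule has_vector_derivative_integral[where g = "\<lambda>\<xi>. D \<xi> + (norm (\<psi> \<xi>))\<^sup>2"])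
      show "integrable (lebn n) (\<lambda>\<xi>. v s \<xi> * \<psi> \<xi>)" if "s \<in> {0..}" for s
        using v[of s] that \<psi> by (simp add: represents_def)
      show "((\<lambda>s. v s \<xi> * \<psi> \<xi>) has_vector_derivative p \<xi> s * \<psi> \<xi>) (at s within {0..})"
        if "s \<in> {0..}" "\<xi> \<in> space (lebn n)" for s \<xi>
        using that by (intro has_vector_derivative_mult_left p) auto
      show "norm (p \<xi> s * \<psi> \<xi>) \<le> D \<xi> + (norm (\<psi> \<xi>))\<^sup>2" if "s \<in> {0..}" "\<xi> \<in> space (lebn n)" for s \<xi>
      proof -
        have "2 * (norm (p \<xi> s) * norm (\<psi> \<xi>)) \<le> (norm (p \<xi> s))\<^sup>2 + (norm (\<psi> \<xi>))\<^sup>2"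
          using sum_squares_bound[of "norm (p \<xi> s)" "norm (\<psi> \<xi>)"] by simp
        moreover have "0 \<le> norm (p \<xi> s) * norm (\<psi> \<xi>)" by simp
        moreover have "(norm (p \<xi> s))\<^sup>2 \<le> D \<xi>" using pD[of \<xi> s] that by simp
        ultimately show ?thesis unfolding norm_mult using zero_le_power2[of "norm (\<psi> \<xi>)"] by linarith
      qed
      show "integrable (lebn n) (\<lambda>\<xi>. D \<xi> + (norm (\<psi> \<xi>))\<^sup>2)"
        using energy_data(1,2) schwartz_square_integrable[OF \<psi>] by (simp add: D_def square_integrable_def)
      show "(\<lambda>\<xi>. p \<xi> t * \<psi> \<xi>) \<in> borel_measurable (lebn n)"
        using P_meas unfolding P_def by measurable
    qed (use t in auto)
    then show "((\<lambda>s. u s \<phi>) has_vector_derivative ut \<phi>) (at t within {0..})"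
      unfolding ut_def P_def \<psi>_def
      by (rule has_vector_derivative_transform[rotated 2]) (use t u_eq[OF _ \<phi>] in auto)
  qed
  moreover have "ut \<in> L2 n" "L2_norm n ut \<le> L2norm_fun n P"
    by (rule L2_if_inverse_fourier[OF Pt(1)], simp add: ut_def)+
  ultimately show ?thesis using Pt(2) energy_data(3) by (intro exI[of _ ut]) auto
qed

end

end

theorem theorem2:
  fixes T m0 :: real and b m1 :: "real \<Rightarrow> real"
  assumes "T > 0"
    and "continuous_on UNIV b" and "\<And>t. b t \<ge> 0" and "\<And>t. b (t + T) = b t"
    and "\<exists>t. b t \<noteq> 0"
    and "\<exists>b'. has_weak_derivative b b' \<and> b' \<in> L_infinity"
    and "m0 \<noteq> 0"
    and "m1 \<in> borel_measurable lebesgue" and "\<And>t. m1 (t + T) = m1 t"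
    and "bdd_above ((\<lambda>t. \<bar>m1 t\<bar>) ` {0..})" and "(SUP t\<in>{0..}. \<bar>m1 t\<bar>) = 1"
  shows "\<exists>\<epsilon>>0. (\<forall>t. m0\<^sup>2 + \<epsilon> * m1 t > 0) \<and>
    (\<exists>\<sigma>>0. \<exists>C>0. \<forall>n\<ge>1. \<forall>u0 u1 u.
       cauchy_solution n b (\<lambda>t. m0\<^sup>2 + \<epsilon> * m1 t) u0 u1 u \<longrightarrow>
       (u0 \<in> L2 n \<and> u1 \<in> sobolev n (-1) \<longrightarrow>
          (\<forall>t\<ge>0. u t \<in> L2 n \<and>
             L2_norm n (u t) \<le> C * exp (- \<sigma> * t) * (L2_norm n u0 + sobolev_norm n (-1) u1))) \<and>
       (u0 \<in> sobolev n 1 \<and> u1 \<in> L2 n \<longrightarrow>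
          (\<forall>t\<ge>0. (\<forall>j<n. partial_dist j (u t) \<in> L2 n) \<and>
             grad_L2_norm n (u t) \<le> C * exp (- \<sigma> * t) * (sobolev_norm n 1 u0 + L2_norm n u1))) \<and>
       (u0 \<in> sobolev n 1 \<and> u1 \<in> L2 n \<longrightarrow>
          (\<forall>t\<ge>0. \<exists>ut. has_time_derivative n u ut t \<and> ut \<in> L2 n \<and>
             L2_norm n ut \<le> C * exp (- \<sigma> * t) * (sobolev_norm n 1 u0 + L2_norm n u1))))"
proof -
  obtain t0 where t0: "b t0 \<noteq> 0" using assms(5) by blast
  \<comment> \<open>The supremum is over t \<ge> 0; a shift by whole periods extends the bound to
    all times.\<close>
  have m1: "\<bar>m1 t\<bar> \<le> 1" for t
  proof -
    obtain k :: int where "t - of_int k * T \<in> {0..T}" by (rule int_multiple_shift_into_period[OF assms(1)])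
    then have "\<bar>m1 (t - of_int k * T)\<bar> \<le> (SUP t\<in>{0..}. \<bar>m1 t\<bar>)"
      by (intro cSUP_upper assms(10)) auto
    then show ?thesis using periodic_add_int[of m1 T t "- k", OF assms(9)] assms(11) by simp
  qed
  obtain \<epsilon> \<sigma> C :: real where eps: "\<epsilon> > 0" "\<sigma> > 0" "C > 0" "\<And>t. m0\<^sup>2 + \<epsilon> * m1 t > 0"
    and decay: "\<forall>\<mu> y p t. \<mu> \<ge> 0 \<longrightarrow> (\<forall>t\<ge>0. (y has_vector_derivative p t) (at t within {0..})) \<longrightarrow>
       (\<forall>c>0. abs_continuous_on 0 c p) \<longrightarrow>
       (AE t in lebesgue. 0 < t \<longrightarrow> (\<exists>z. (p has_vector_derivative z) (at t) \<and>
         z + of_real \<mu> * y t + 2 * of_real (b t) * p t + of_real (m0\<^sup>2 + \<epsilon> * m1 t) * y t = 0)) \<longrightarrow> t \<ge> 0 \<longrightarrow>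
      (1 + \<mu>) * (norm (y t))\<^sup>2 + (norm (p t))\<^sup>2 \<le> C * exp (- 2 * \<sigma> * t) * ((1 + \<mu>) * (norm (y 0))\<^sup>2 + (norm (p 0))\<^sup>2)"
    by (rule uniform_exponential_decay[OF assms(1-4) t0 assms(7) m1]) (rule that)
  have sol: "\<exists>v w0 w1 p. fourier_energy_decay n C \<sigma> u0 u1 u v w0 w1 p"
    if cs: "cauchy_solution n b (\<lambda>t. m0\<^sup>2 + \<epsilon> * m1 t) u0 u1 u" for n u0 u1 u
  proof -
    obtain v w0 w1 where sol: "\<And>t. t \<ge> 0 \<Longrightarrow> tempered n (u t)"
      "\<And>t. t \<ge> 0 \<Longrightarrow> represents n (fourier_dist n (u t)) (v t)"
      "represents n (fourier_dist n u0) w0" "represents n (fourier_dist n u1) w1"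
      and car: "\<And>\<xi>. \<xi> \<in> space (lebn n) \<Longrightarrow>
        caratheodory_solution b (\<lambda>t. m0\<^sup>2 + \<epsilon> * m1 t) ((euclid_norm n \<xi>)\<^sup>2) (w0 \<xi>) (w1 \<xi>) (\<lambda>t. v t \<xi>)"
      using cs unfolding cauchy_solution_def by blast
    \<comment> \<open>The derivative is existentially quantified at each frequency; the axiom of
      choice collects these into one function of frequency and time.\<close>
    have "\<forall>\<xi>\<in>space (lebn n). \<exists>p. (\<forall>t\<ge>0. ((\<lambda>t. v t \<xi>) has_vector_derivative p t) (at t within {0..})) \<and>
        (\<forall>c>0. abs_continuous_on 0 c p) \<and>
        (AE t in lebesgue. 0 < t \<longrightarrow> (\<exists>z. (p has_vector_derivative z) (at t) \<and>
         z + of_real ((euclid_norm n \<xi>)\<^sup>2) * v t \<xi> + 2 * of_real (b t) * p t + of_real (m0\<^sup>2 + \<epsilon> * m1 t) * v t \<xi> = 0)) \<and>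
        v 0 \<xi> = w0 \<xi> \<and> p 0 = w1 \<xi>"
      by (intro ballI) (rule car[unfolded caratheodory_solution_def])
    from bchoice[OF this] obtain p where p: "\<forall>\<xi>\<in>space (lebn n). (\<forall>t\<ge>0. ((\<lambda>t. v t \<xi>) has_vector_derivative p \<xi> t) (at t within {0..})) \<and>
        (\<forall>c>0. abs_continuous_on 0 c (p \<xi>)) \<and>
        (AE t in lebesgue. 0 < t \<longrightarrow> (\<exists>z. (p \<xi> has_vector_derivative z) (at t) \<and>
         z + of_real ((euclid_norm n \<xi>)\<^sup>2) * v t \<xi> + 2 * of_real (b t) * p \<xi> t + of_real (m0\<^sup>2 + \<epsilon> * m1 t) * v t \<xi> = 0)) \<and>
        v 0 \<xi> = w0 \<xi> \<and> p \<xi> 0 = w1 \<xi>" by (rule exE)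
    have "fourier_energy_decay n C \<sigma> u0 u1 u v w0 w1 p"
    proof
      fix \<xi> t assume \<xi>: "\<xi> \<in> space (lebn n)" and t: "t \<ge> (0::real)"
      show "(1 + (euclid_norm n \<xi>)\<^sup>2) * (norm (v t \<xi>))\<^sup>2 + (norm (p \<xi> t))\<^sup>2
        \<le> C * exp (- 2 * \<sigma> * t) * ((1 + (euclid_norm n \<xi>)\<^sup>2) * (norm (w0 \<xi>))\<^sup>2 + (norm (w1 \<xi>))\<^sup>2)"
      proof -
        note p\<xi> = bspec[OF p \<xi>]
        have "(1 + (euclid_norm n \<xi>)\<^sup>2) * (norm (v t \<xi>))\<^sup>2 + (norm (p \<xi> t))\<^sup>2
          \<le> C * exp (- 2 * \<sigma> * t) * ((1 + (euclid_norm n \<xi>)\<^sup>2) * (norm (v 0 \<xi>))\<^sup>2 + (norm (p \<xi> 0))\<^sup>2)"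
          by (rule decay[rule_format, OF zero_le_power2 _ _ conjunct1[OF conjunct2[OF conjunct2[OF p\<xi>]]] t])
            (use p\<xi> in simp_all)
        then show ?thesis using p\<xi> by simp
      qed
      show "((\<lambda>t. v t \<xi>) has_vector_derivative p \<xi> t) (at t within {0..})" using bspec[OF p \<xi>] t by simp
    qed (fact eps sol)+
    then show ?thesis by blast
  qed
  show ?thesis
  \<comment> \<open>The square root of C appears because the energy inequality is one between
    squares, with decay rate \<open>2 * \<sigma>\<close>.\<close>
  proof (rule exI[of _ \<epsilon>], intro conjI, fact eps(1), rule allI, fact eps(4),
      rule exI[of _ \<sigma>], intro conjI, fact eps(2), rule exI[of _ "sqrt C"], intro conjI allI impI)
    show "sqrt C > 0" using eps by simp
  next
    fix n u0 u1 u and t :: real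
    assume cs: "cauchy_solution n b (\<lambda>t. m0\<^sup>2 + \<epsilon> * m1 t) u0 u1 u" and t: "0 \<le> t"
    obtain v w0 w1 p where "fourier_energy_decay n C \<sigma> u0 u1 u v w0 w1 p" using sol[OF cs] by blast
    then interpret fourier_energy_decay n C \<sigma> u0 u1 u v w0 w1 p .
    {
      assume "u0 \<in> L2 n \<and> u1 \<in> sobolev n (-1)"
      then show "u t \<in> L2 n" "L2_norm n (u t) \<le> sqrt C * exp (- \<sigma> * t) * (L2_norm n u0 + sobolev_norm n (-1) u1)"
        using L2_decay[OF _ _ t] unfolding decay_def by auto
    next
      assume d: "u0 \<in> sobolev n 1 \<and> u1 \<in> L2 n"
      then show "grad_L2_norm n (u t) \<le> sqrt C * exp (- \<sigma> * t) * (sobolev_norm n 1 u0 + L2_norm n u1)"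
        using gradient_decay(2)[OF _ _ t] unfolding decay_def by auto
      show "\<exists>ut. has_time_derivative n u ut t \<and> ut \<in> L2 n \<and>
             L2_norm n ut \<le> sqrt C * exp (- \<sigma> * t) * (sobolev_norm n 1 u0 + L2_norm n u1)"
        using time_derivative_decay[OF _ _ t] d unfolding decay_def by auto
      fix j assume "j < n"
      then show "partial_dist j (u t) \<in> L2 n" using gradient_decay(1)[OF _ _ t] d by auto
    }
  qed
qed

end
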